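(* Let $\mathfrak g$ be a Lie algebra of classical type over $\mathbb C$, identified with a subset of $\operatorname{End}(V)$ ($V$ the natural module), and let $f\in\mathfrak g$ be a nilpotent element with Jordan type having all parts of the same parity. Embed $f$ in an $\mathfrak{sl}_2$-triple $(f,2x,e)$ in $\mathfrak g$. Let $k\in\frac12\mathbb Z_{\ge0}$. Considering $V$ as a module for the $\mathfrak{sl}_2$-triple $(f,2x,e)$, let $U$ be the subspace of $V$ spanned by the $\mathfrak{sl}_2$-submodules of $V$ of highest weight $k$ (weight meaning $x$-eigenvalue). Then the coefficients of $\Pi_U L_k(z)\Psi_U\,\bar 1$ lie in the finite $W$-algebra $U(\mathfrak g,f)$. Here $L_k(z)$ is the Lax type operator of the subalgebra $\mathfrak g^k$ and nilpotent element $f_k$ defined in the context.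
   Context: Finite $W$-algebra: $\mathfrak g$ carries a symmetric non-degenerate invariant bilinear form $\langle\cdot\mid\cdot\rangle$. $\mathfrak g_j$ is the $j$-eigenspace of $\operatorname{ad}x$ on $\mathfrak g$. $J$ is the left ideal of $U(\mathfrak g)$ generated by $\{m-\langle f\mid m\rangle:m\in\mathfrak g_{\ge1}\}$, and $U(\mathfrak g,f)=(U(\mathfrak g)/J)^{\mathfrak g_{\ge1/2}}$ (invariants for the action induced by the adjoint action). $\bar1$ is the image of $1$ in $U(\mathfrak g)/J$; $A\bar1$ means replacing each $U(\mathfrak g)$-coefficient of $A$ by its image in $U(\mathfrak g)/J$. Weight spaces: $V[j]$ is the $j$-eigenspace of $x$ on $V$; $V[<j]$, $V[>j]$, etc. are the obvious sums. $\Pi_{j}$, $\Pi_{<j}$, $\Pi_{[-k,k]}$ denote the projections of $V$ onto $V[j]$, $V[<j]$, $\bigoplus_{-k\le i\le k}V[i]$ along the remaining weight spaces, and $\Psi_{j},\Psi_{>j},\Psi_{[-k,k]}$ the corresponding inclusions. $\Pi_UL_k(z)\Psi_U$ means: restrict $L_k(z)$ to $U\cap V[-k]$ and project $V[k]$ onto $U\cap V[k]$ along the other $\mathfrak{sl}_2$-isotypic components. General Lax type operator: let $\mathfrak a$ be a reductive Lie algebra with a symmetric non-degenerate invariant form, a nilpotent element $f_{\mathfrak a}$ in an $\mathfrak{sl}_2$-triple $(f_{\mathfrak a},2x_{\mathfrak a},e_{\mathfrak a})$, and a faithful finite-dimensional representation $\phi$ on $M$. Let $\{u_i\}$ be a basis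 of $\mathfrak a$ of $\operatorname{ad}x_{\mathfrak a}$-eigenvectors with eigenvalues $\delta(u_i)$, $\{u^i\}$ the dual basis, $U_i=\phi(u_i)$, $U^i=\phi(u^i)$, $F=\phi(f_{\mathfrak a})$, $D=\sum_{u_i\in\mathfrak a_{\ge1}}U^iU_i$, and $$Y=\mathbb 1_M+F+\sum_{u_i\in\mathfrak a_{\le1/2}}z^{\delta(u_i)-1}u_i\otimes U^i+z^{-1}D\in U(\mathfrak a)[[z^{-1/2}]]\otimes\operatorname{End}(M).$$ With $h$ the largest eigenvalue of $x_{\mathfrak a}$ on $M$, the operator $\Pi_{<h}Y\Psi_{>-h}$ is invertible and $$L(z)=\Pi_{h}Y\Psi_{-h}-\Pi_{h}Y\Psi_{>-h}\left(\Pi_{<h}Y\Psi_{>-h}\right)^{-1}\Pi_{<h}Y\Psi_{-h},$$ an operator from $M[-h]$ to $M[h]$ with coefficients power series over $U(\mathfrak a)$ (matrix products over a noncommutative ring). Definition of $L_k(z)$: let $\mathfrak g^k=\{\Pi_{[-k,k]}X\Psi_{[-k,k]}:X\in\mathfrak g\}$, regarded (extending by zero on the other weight spaces) as a Lie subalgebra of $\mathfrak g$, and $f_k=\Pi_{[-k,k]}f\Psi_{[-k,k]}$, a nilpotent element of $\mathfrak g^k$, with grading element $x_k=\Pi_{[-k,k]}x\Psi_{[-k,k]}$. $L_k(z)$ is the operator $L(z)$ above for $\mathfrak a=\mathfrak g^k$, $f_{\mathfrak a}=f_k$, $x_{\mathfrak a}=x_k$, the restricted form, and $M=\bigoplus_{-k\le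 i\le k}V[i]$. In particular its shift matrix $D_k$ is computed in $\mathfrak g^k$ and is not $\Pi_{[-k,k]}D\Psi_{[-k,k]}$. Its coefficients lie in $U(\mathfrak g^k)\subset U(\mathfrak g)$.
   Formalization: The shift matrix D carries a minus sign (with the displayed plus sign the claim fails for gl_2); the form is a nonzero multiple of the trace form of V (other forms fail on gl_4, type (3,1), k=0); for sl_N only those k with g^k contained in g are covered. *)

theory Defs
  imports "HOL-Analysis.Analysis" "HOL-Library.Poly_Mapping"
begin

section \<open>Complex Lie algebras\<close>

class complex_lie_algebra = ab_group_add +
  fixes scaleC :: "complex \<Rightarrow> 'a \<Rightarrow> 'a"  (infixr \<open>*\<^sub>C\<close> 75)
    and lie :: "'a \<Rightarrow> 'a \<Rightarrow> 'a"
  assumes scaleC_add_right: "c *\<^sub>C (a + b) = c *\<^sub>C a + c *\<^sub>C b"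
    and scaleC_add_left: "(c + d) *\<^sub>C a = c *\<^sub>C a + d *\<^sub>C a"
    and scaleC_scaleC: "c *\<^sub>C (d *\<^sub>C a) = (c * d) *\<^sub>C a"
    and scaleC_one: "1 *\<^sub>C a = a"
    and lie_add_left: "lie (a + b) y = lie a y + lie b y"
    and lie_add_right: "lie y (a + b) = lie y a + lie y b"
    and lie_scaleC_left: "lie (c *\<^sub>C a) b = c *\<^sub>C lie a b"
    and lie_scaleC_right: "lie a (c *\<^sub>C b) = c *\<^sub>C lie a b"
    and lie_self: "lie a a = 0"
    and jacobi: "lie a (lie b y) + lie b (lie y a) + lie y (lie a b) = 0"

global_interpretation clie: vector_space "scaleC :: complex \<Rightarrow> 'g::complex_lie_algebra \<Rightarrow> 'g"
  by unfold_locales (simp_all add: scaleC_add_right scaleC_add_left scaleC_scaleC scaleC_one)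


section \<open>The universal enveloping algebra\<close>

text \<open>Words form the free monoid, so that \<open>'g list \<Rightarrow>\<^sub>0 complex\<close> with the convolution product of
  \<open>Poly_Mapping\<close> is the free associative unital algebra on the set \<open>'g\<close>.\<close>

instantiation list :: (type) monoid_add
begin
definition zero_list :: "'a list" where "zero_list = []"
definition plus_list :: "'a list \<Rightarrow> 'a list \<Rightarrow> 'a list" where "plus_list = append"
instance by standard (simp_all add: zero_list_def plus_list_def)
end

type_synonym 'g free_algebra = "'g list \<Rightarrow>\<^sub>0 complex"

definition letter :: "'g \<Rightarrow> 'g free_algebra" where
  "letter a = Poly_Mapping.single [a] 1"

definition scalar :: "complex \<Rightarrow> 'g free_algebra" where
  "scalar c = Poly_Mapping.single [] c"

text \<open>The linearity relations turn the free algebra on the set \<open>'g\<close> into the tensor algebra of the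
  vector space \<open>'g\<close>.\<close>

inductive_set uea_ideal :: "'g::complex_lie_algebra free_algebra set" where
  rel_add: "letter (a + b) - letter a - letter b \<in> uea_ideal"
| rel_scale: "letter (c *\<^sub>C a) - scalar c * letter a \<in> uea_ideal"
| rel_lie: "letter a * letter b - letter b * letter a - letter (lie a b) \<in> uea_ideal"
| sum_in: "p \<in> uea_ideal \<Longrightarrow> q \<in> uea_ideal \<Longrightarrow> p + q \<in> uea_ideal"
| left_in: "p \<in> uea_ideal \<Longrightarrow> r * p \<in> uea_ideal"
| right_in: "p \<in> uea_ideal \<Longrightarrow> p * r \<in> uea_ideal"

lemma uea_ideal_zero: "0 \<in> uea_ideal"
  using left_in[OF rel_add, of 0] by simp

lemma uea_ideal_uminus: "p \<in> uea_ideal \<Longrightarrow> - p \<in> uea_ideal"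
  using left_in[of p "- 1"] by simp

lemma uea_ideal_diff: "p \<in> uea_ideal \<Longrightarrow> q \<in> uea_ideal \<Longrightarrow> p - q \<in> uea_ideal"
  using sum_in[of p "- q"] uea_ideal_uminus[of q] by simp

lemma lookup_mult_Nil:
  fixes p q :: "'g free_algebra"
  shows "Poly_Mapping.lookup (p * q) [] = Poly_Mapping.lookup p [] * Poly_Mapping.lookup q []"
proof -
  have *: "([] = l + r) = (l = [] \<and> r = [])" for l r :: "'g list"
    by (auto simp: plus_list_def)
  have "(\<Sum>r. Poly_Mapping.lookup q r when [] = l + r)
      = (Poly_Mapping.lookup q [] when l = [])" for l
    by (cases "l = []") (simp_all add: * when_def[of _ False])
  then show ?thesis
    by (simp add: times_poly_mapping.rep_eq prod_fun_def mult_when)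
qed

lemma uea_ideal_constant_term: "p \<in> uea_ideal \<Longrightarrow> Poly_Mapping.lookup p [] = 0"
  by (induction rule: uea_ideal.induct)
     (simp_all add: lookup_mult_Nil lookup_minus lookup_add letter_def scalar_def lookup_single)

quotient_type (overloaded) 'g uea = "'g::complex_lie_algebra free_algebra" / "\<lambda>p q. p - q \<in> uea_ideal"
proof (rule equivpI)
  show "reflp (\<lambda>p q :: 'g free_algebra. p - q \<in> uea_ideal)"
    by (simp add: reflp_def uea_ideal_zero)
  show "symp (\<lambda>p q :: 'g free_algebra. p - q \<in> uea_ideal)"
    by (metis (no_types, lifting) minus_diff_eq sympI uea_ideal_uminus)
  show "transp (\<lambda>p q :: 'g free_algebra. p - q \<in> uea_ideal)"
  proof (rule transpI)
    fix p q r :: "'g free_algebra"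
    assume "p - q \<in> uea_ideal" "q - r \<in> uea_ideal"
    from sum_in[OF this] show "p - r \<in> uea_ideal" by simp
  qed
qed

instantiation uea :: (complex_lie_algebra) ring_1
begin

lift_definition zero_uea :: "'a uea" is 0 .
lift_definition one_uea :: "'a uea" is 1 .

lift_definition plus_uea :: "'a uea \<Rightarrow> 'a uea \<Rightarrow> 'a uea" is "(+)"
  by (metis add_diff_add sum_in)

lift_definition minus_uea :: "'a uea \<Rightarrow> 'a uea \<Rightarrow> 'a uea" is "(-)"
proof -
  fix p p' q q' :: "'a free_algebra"
  assume "p - p' \<in> uea_ideal" "q - q' \<in> uea_ideal"
  from uea_ideal_diff[OF this] show "p - q - (p' - q') \<in> uea_ideal" by (simp add: algebra_simps)
qed

lift_definition uminus_uea :: "'a uea \<Rightarrow> 'a uea" is uminus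
proof -
  fix p p' :: "'a free_algebra"
  assume "p - p' \<in> uea_ideal"
  from uea_ideal_uminus[OF this] show "- p - - p' \<in> uea_ideal" by simp
qed

lift_definition times_uea :: "'a uea \<Rightarrow> 'a uea \<Rightarrow> 'a uea" is "(*)"
proof -
  fix p p' q q' :: "'a free_algebra"
  assume "p - p' \<in> uea_ideal" "q - q' \<in> uea_ideal"
  then have "(p - p') * q + p' * (q - q') \<in> uea_ideal"
    by (intro sum_in left_in right_in)
  then show "p * q - p' * q' \<in> uea_ideal" by (simp add: algebra_simps)
qed

instance
proof
  fix a b c :: "'a uea"
  show "a + b + c = a + (b + c)" by transfer (simp add: add.assoc uea_ideal_zero)
  show "a + b = b + a" by transfer (simp add: add.commute uea_ideal_zero)
  show "0 + a = a" by transfer (simp add: uea_ideal_zero)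
  show "- a + a = 0" by transfer (simp add: uea_ideal_zero)
  show "a - b = a + - b" by transfer (simp add: uea_ideal_zero)
  show "a * b * c = a * (b * c)" by transfer (simp add: mult.assoc uea_ideal_zero)
  show "(a + b) * c = a * c + b * c" by transfer (simp add: distrib_right uea_ideal_zero)
  show "a * (b + c) = a * b + a * c" by transfer (simp add: distrib_left uea_ideal_zero)
  show "1 * a = a" by transfer (simp add: uea_ideal_zero)
  show "a * 1 = a" by transfer (simp add: uea_ideal_zero)
  show "(0 :: 'a uea) \<noteq> 1"
  proof (transfer, rule notI)
    assume "(0 :: 'a free_algebra) - 1 \<in> uea_ideal"
    from uea_ideal_constant_term[OF this] show False
      by (simp add: lookup_minus lookup_one zero_list_def)
  qed
qed

end

lift_definition uea_of :: "'g::complex_lie_algebra \<Rightarrow> 'g uea" is letter .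
lift_definition uea_scalar :: "complex \<Rightarrow> 'g::complex_lie_algebra uea" is scalar .


section \<open>The finite W-algebra\<close>

definition ad_ge :: "'g::complex_lie_algebra \<Rightarrow> real \<Rightarrow> 'g set" where
  "ad_ge x r = clie.span {a. \<exists>j\<ge>r. lie x a = complex_of_real j *\<^sub>C a}"

inductive_set left_ideal :: "'a::ring_1 set \<Rightarrow> 'a set" for S where
  "0 \<in> left_ideal S"
| "s \<in> S \<Longrightarrow> p \<in> left_ideal S \<Longrightarrow> u * s + p \<in> left_ideal S"

definition W_ideal :: "('g::complex_lie_algebra \<Rightarrow> 'g \<Rightarrow> complex) \<Rightarrow> 'g \<Rightarrow> 'g \<Rightarrow> 'g uea set" where
  "W_ideal B f x = left_ideal {uea_of m - uea_scalar (B f m) | m. m \<in> ad_ge x 1}"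

text \<open>The class \<open>w \<cdot> 1\<close> (with \<open>1\<close> the image of the unit) in the quotient of the enveloping algebra by
  the left ideal \<open>J\<close>.\<close>

definition coset :: "'a::ring_1 set \<Rightarrow> 'a \<Rightarrow> 'a set" where
  "coset J w = (\<lambda>p. w + p) ` J"

definition finite_W_algebra ::
    "('g::complex_lie_algebra \<Rightarrow> 'g \<Rightarrow> complex) \<Rightarrow> 'g \<Rightarrow> 'g \<Rightarrow> 'g uea set set" where
  "finite_W_algebra B f x = {C. \<exists>w. C = coset (W_ideal B f x) w \<and>
     (\<forall>a \<in> ad_ge x (1/2).
        coset (W_ideal B f x) (uea_of a * w - w * uea_of a) = coset (W_ideal B f x) 0)}"


section \<open>Classical Lie algebras and Jordan types\<close>

definition sl_set :: "(complex^'n^'n) set" where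
  "sl_set = {A. trace A = 0}"

definition isometry_algebra :: "complex^'n^'n \<Rightarrow> (complex^'n^'n) set" where
  "isometry_algebra G = {A. transpose A ** G + G ** A = 0}"

definition classical_type :: "(complex^'n^'n) set \<Rightarrow> bool" where
  "classical_type R \<longleftrightarrow> R = UNIV \<or> R = sl_set \<or>
     (\<exists>G. invertible G \<and> (transpose G = G \<or> transpose G = - G) \<and> R = isometry_algebra G)"

text \<open>An identification of an abstract Lie algebra with a Lie algebra of matrices.\<close>

definition faithful_rep :: "('g::complex_lie_algebra \<Rightarrow> complex^'n^'n) \<Rightarrow> bool" where
  "faithful_rep \<phi> \<longleftrightarrow> inj \<phi> \<and> (\<forall>a b. \<phi> (a + b) = \<phi> a + \<phi> b) \<and>
     (\<forall>c a. \<phi> (c *\<^sub>C a) = mat c ** \<phi> a) \<and>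
     (\<forall>a b. \<phi> (lie a b) = \<phi> a ** \<phi> b - \<phi> b ** \<phi> a)"

text \<open>\<open>A\<close> is nilpotent with Jordan blocks of sizes \<open>ps\<close> (in any order): there is a basis \<open>b i j\<close>
  consisting, for each part \<open>ps ! i\<close>, of a chain \<open>b i 0 \<mapsto> b i 1 \<mapsto> \<dots> \<mapsto> 0\<close> of that length.\<close>

definition jordan_type :: "complex^'n^'n \<Rightarrow> nat list \<Rightarrow> bool" where
  "jordan_type A ps \<longleftrightarrow> 0 \<notin> set ps \<and>
     (\<exists>b :: nat \<Rightarrow> nat \<Rightarrow> complex^'n.
        let S = {(i, j). i < length ps \<and> j < ps ! i} in
        inj_on (\<lambda>(i, j). b i j) S \<and>
        vec.independent ((\<lambda>(i, j). b i j) ` S) \<and> vec.span ((\<lambda>(i, j). b i j) ` S) = UNIV \<and>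
        (\<forall>(i, j) \<in> S. A *v b i j = (if Suc j < ps ! i then b i (Suc j) else 0)))"


section \<open>Weight spaces and isotypic components\<close>

text \<open>\<open>M\<close> is the range of an idempotent \<open>P\<close> commuting with \<open>X\<close>, and operators on \<open>M\<close> are extended by
  zero on the kernel of \<open>P\<close>. If \<open>M\<close> is the sum of the weight spaces of \<open>X\<close> on \<open>M\<close>, then
  \<open>weight_proj P X S\<close> is the projection onto the sum of those with weight in \<open>S\<close>.\<close>

definition weight_proj :: "complex^'n^'n \<Rightarrow> complex^'n^'n \<Rightarrow> real set \<Rightarrow> complex^'n^'n" where
  "weight_proj P X S = (THE Q.
     (\<forall>v. P *v v = 0 \<longrightarrow> Q *v v = 0) \<and>
     (\<forall>j v. P *v v = v \<and> X *v v = complex_of_real j *s v \<longrightarrow> Q *v v = (if j \<in> S then v else 0)))"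

definition sl2_submodule ::
    "complex^'n^'n \<Rightarrow> complex^'n^'n \<Rightarrow> complex^'n^'n \<Rightarrow> (complex^'n) set \<Rightarrow> bool" where
  "sl2_submodule F X E S \<longleftrightarrow> vec.subspace S \<and> (\<forall>v\<in>S. F *v v \<in> S \<and> X *v v \<in> S \<and> E *v v \<in> S)"

definition sl2_irreducible ::
    "complex^'n^'n \<Rightarrow> complex^'n^'n \<Rightarrow> complex^'n^'n \<Rightarrow> (complex^'n) set \<Rightarrow> bool" where
  "sl2_irreducible F X E S \<longleftrightarrow> sl2_submodule F X E S \<and> S \<noteq> {0} \<and>
     (\<forall>T. sl2_submodule F X E T \<and> T \<subseteq> S \<longrightarrow> T = {0} \<or> T = S)"

definition isotypic ::
    "complex^'n^'n \<Rightarrow> complex^'n^'n \<Rightarrow> complex^'n^'n \<Rightarrow> real \<Rightarrow> (complex^'n) set" where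
  "isotypic F X E k = vec.span (\<Union>{S. sl2_irreducible F X E S \<and>
     (\<exists>v\<in>S. v \<noteq> 0 \<and> E *v v = 0 \<and> X *v v = complex_of_real k *s v)})"

definition isotypic_proj ::
    "complex^'n^'n \<Rightarrow> complex^'n^'n \<Rightarrow> complex^'n^'n \<Rightarrow> real \<Rightarrow> complex^'n^'n" where
  "isotypic_proj F X E k = (THE Q.
     \<forall>j. \<forall>v \<in> isotypic F X E j. Q *v v = (if j = k then v else 0))"


section \<open>Lax type operators\<close>

text \<open>Power series in \<open>z\<^sup>-\<^sup>1\<^sup>/\<^sup>2\<close> are \<open>fps\<close>, so \<open>fps_X\<close> stands for \<open>z\<^sup>-\<^sup>1\<^sup>/\<^sup>2\<close>.\<close>

definition cmat :: "complex^'n^'m \<Rightarrow> (('g::complex_lie_algebra) uea fps)^'n^'m" where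
  "cmat A = (\<chi> r s. fps_const (uea_scalar (A $ r $ s)))"

text \<open>\<open>u\<close> is an eigenbasis for \<open>ad xa\<close> of the subalgebra \<open>\<aa>\<close>, with eigenvalues \<open>\<delta>\<close>, and \<open>u'\<close> is the
  dual basis with respect to the restriction of \<open>B\<close>; such a pair exists only if this restriction is
  non-degenerate.\<close>

definition dual_eigenbases ::
    "('g::complex_lie_algebra \<Rightarrow> 'g \<Rightarrow> complex) \<Rightarrow> 'g set \<Rightarrow> 'g \<Rightarrow>
     'i set \<Rightarrow> ('i \<Rightarrow> 'g) \<Rightarrow> ('i \<Rightarrow> 'g) \<Rightarrow> ('i \<Rightarrow> real) \<Rightarrow> bool" where
  "dual_eigenbases B \<aa> xa I u u' \<delta> \<longleftrightarrow> finite I \<and>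
     inj_on u I \<and> clie.independent (u ` I) \<and> clie.span (u ` I) = \<aa> \<and>
     (\<forall>i\<in>I. lie xa (u i) = complex_of_real (\<delta> i) *\<^sub>C u i) \<and>
     (\<forall>i\<in>I. u' i \<in> \<aa>) \<and> (\<forall>i\<in>I. \<forall>j\<in>I. B (u i) (u' j) = (if i = j then 1 else 0))"

text \<open>The sign of the shift matrix \<open>D\<close> matters. With \<open>D = + \<Sum> U\<^sup>i U\<^sub>i\<close> invariance fails already for
  \<open>gl\<^sub>2\<close> with the trace form and \<open>f = E\<^sub>2\<^sub>1\<close>: there \<open>D = E\<^sub>2\<^sub>2\<close>, the coefficient of \<open>z\<^sup>-\<^sup>2\<close> in \<open>L(z)\<close>
  would be \<open>e\<^sub>2\<^sub>1 - e\<^sub>1\<^sub>1 e\<^sub>2\<^sub>2 - e\<^sub>1\<^sub>1\<close>, and \<open>ad e\<^sub>1\<^sub>2\<close> maps it to \<open>2\<close> modulo the left ideal. With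
  \<open>D = - E\<^sub>2\<^sub>2\<close> it is \<open>e\<^sub>2\<^sub>1 - e\<^sub>1\<^sub>1 e\<^sub>2\<^sub>2 + e\<^sub>1\<^sub>1\<close>, which is invariant.\<close>

definition shift_matrix ::
    "('g \<Rightarrow> complex^'n^'n) \<Rightarrow> 'i set \<Rightarrow> ('i \<Rightarrow> 'g) \<Rightarrow> ('i \<Rightarrow> 'g) \<Rightarrow> ('i \<Rightarrow> real) \<Rightarrow> complex^'n^'n" where
  "shift_matrix \<phi> I u u' \<delta> = - (\<Sum>i \<in> {i\<in>I. \<delta> i \<ge> 1}. \<phi> (u' i) ** \<phi> (u i))"

text \<open>\<open>P\<close> is the identity of \<open>M\<close>. The eigenvalues \<open>\<delta> i\<close> are half-integers, so rounding
  \<open>2 - 2 \<delta> i\<close> down to an integer has no effect.\<close>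

definition lax_Y ::
    "('g::complex_lie_algebra \<Rightarrow> complex^'n^'n) \<Rightarrow> complex^'n^'n \<Rightarrow> 'g \<Rightarrow>
     'i set \<Rightarrow> ('i \<Rightarrow> 'g) \<Rightarrow> ('i \<Rightarrow> 'g) \<Rightarrow> ('i \<Rightarrow> real) \<Rightarrow> ('g uea fps)^'n^'n" where
  "lax_Y \<phi> P fa I u u' \<delta> = cmat P + cmat (\<phi> fa) +
     (\<Sum>i \<in> {i\<in>I. \<delta> i \<le> 1/2}. mat (fps_X ^ nat \<lfloor>2 - 2 * \<delta> i\<rfloor> * fps_const (uea_of (u i))) ** cmat (\<phi> (u' i))) +
     mat (fps_X ^ 2) ** cmat (shift_matrix \<phi> I u u' \<delta>)"

text \<open>As for all operators on \<open>M\<close>, the map from \<open>M[-h]\<close> to \<open>M[h]\<close> is extended by zero on the other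
  weight spaces; \<open>N\<close> is the inverse of the middle block.\<close>

definition lax_op ::
    "('g::complex_lie_algebra \<Rightarrow> complex^'n^'n) \<Rightarrow> complex^'n^'n \<Rightarrow> 'g \<Rightarrow> 'g \<Rightarrow>
     'i set \<Rightarrow> ('i \<Rightarrow> 'g) \<Rightarrow> ('i \<Rightarrow> 'g) \<Rightarrow> ('i \<Rightarrow> real) \<Rightarrow> ('g uea fps)^'n^'n" where
  "lax_op \<phi> P fa xa I u u' \<delta> =
    (let h = Max {j :: real. \<exists>v. v \<noteq> 0 \<and> P *v v = v \<and> \<phi> xa *v v = complex_of_real j *s v};
         p = (\<lambda>S. cmat (weight_proj P (\<phi> xa) S));
         Y = lax_Y \<phi> P fa I u u' \<delta>;
         N = (THE N. p {-h<..} ** N ** p {..<h} = N \<and>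
                     (p {..<h} ** Y ** p {-h<..}) ** N = p {..<h} \<and>
                     N ** (p {..<h} ** Y ** p {-h<..}) = p {-h<..})
     in p {h} ** Y ** p {-h} - (p {h} ** Y ** p {-h<..}) ** N ** (p {..<h} ** Y ** p {-h}))"

text \<open>For an idempotent \<open>P\<close>, \<open>compress \<phi> P a\<close> is the element of the Lie algebra represented by
  \<open>P \<phi>(a) P\<close>, provided there is one. The truncated algebra is the range of \<open>compress \<phi> P\<close>, for \<open>P\<close> the
  projection onto the weight spaces between \<open>-k\<close> and \<open>k\<close>. For \<open>gl\<close>, \<open>so\<close> and \<open>sp\<close> it is always a
  subalgebra; in \<open>sl\<close> some \<open>P \<phi>(a) P\<close> have non-zero trace unless \<open>P\<close> is \<open>0\<close> or \<open>1\<close>, and the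
  truncation makes sense only in these cases.\<close>

definition compress :: "('g \<Rightarrow> complex^'n^'n) \<Rightarrow> complex^'n^'n \<Rightarrow> 'g \<Rightarrow> 'g" where
  "compress \<phi> P a = inv \<phi> (P ** \<phi> a ** P)"

end

theory Submission
  imports Defs
begin

text \<open>
  All Jordan blocks have the same parity, so \<open>ad x\<close> has integral eigenvalues. Fix a positive degree
  \<open>n\<close>, let \<open>a\<close> be of degree \<open>n\<close> and \<open>a\<^sub>\<chi> = a - \<langle>f | a\<rangle>\<close>; let \<open>P\<close> be the projection onto the weights
  between \<open>-k\<close> and \<open>k\<close>. The column \<open>\<Psi> = \<Pi>\<^sub>-\<^sub>k - N \<Pi>\<^sub><\<^sub>k Y \<Pi>\<^sub>-\<^sub>k\<close> solves \<open>Y \<Psi> = L\<close> with \<open>\<Pi>\<^sub>-\<^sub>k \<Psi> = \<Pi>\<^sub>-\<^sub>k\<close>. Let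
  \<open>\<psi>\<^sub>m\<close> and \<open>\<Lambda>\<^sub>m\<close> be the coefficients of \<open>z\<^sup>-\<^sup>m\<^sup>/\<^sup>2\<close> in \<open>\<Psi>\<close> and \<open>L\<close>, restricted to \<open>U\<close>. Modulo the left ideal,
    \<open>a\<^sub>\<chi> \<psi>\<^sub>m = - P a P \<psi>\<^sub>m\<^sub>-\<^sub>2\<^sub>n\<close> and \<open>a\<^sub>\<chi> \<Lambda>\<^sub>m = P f (1 - P) a P \<psi>\<^sub>m\<^sub>-\<^sub>2\<^sub>n\<close>,
  and the second right hand side is killed by the projection onto \<open>U\<close>, because \<open>f\<close> maps \<open>V[k+1]\<close> into
  the isotypic components of highest weight above \<open>k\<close>.

  Both congruences are proved by induction on \<open>m - 2n\<close>. Applying \<open>a\<^sub>\<chi>\<close> to \<open>Y \<Psi> = L\<close> determines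
  \<open>(P + f\<^sub>k) (a\<^sub>\<chi> \<psi>\<^sub>m + P a P \<psi>\<^sub>m\<^sub>-\<^sub>2\<^sub>n)\<close> up to a vector of weight \<open>k\<close>; this vector vanishes since \<open>f\<^sup>2\<^sup>k\<close>
  maps \<open>V[k]\<close> isomorphically onto \<open>V[-k]\<close>. The commutator of \<open>a\<close> with \<open>Y\<close> is computed separately for the
  truncation of \<open>a\<close>, where it comes from the Casimir tensor of the truncated algebra and the shift matrix
  absorbs the terms in which the induction hypothesis is used, and for the complement \<open>b\<close>, which
  satisfies \<open>P b P = 0\<close> and whose non-zero brackets with the \<open>u\<^sub>i\<close> again have positive degree and
  vanishing truncation, so that they act by the character \<open>\<langle>f | \<cdot>\<rangle>\<close>.
\<close>

section \<open>Linear algebra\<close>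

text \<open>Integrality makes every homogeneous element of degree at least 1/2 have degree at least
  1. Then a_chi itself lies in the left ideal J, and [a, w] = a_chi w - w a_chi lies in J as soon as
  a_chi w does. J absorbs only left factors: the unknown column therefore stays rightmost in every
  product, and a_chi is moved only past constant matrices, with which it commutes, or past letters
  u_i, which leaves brackets.

  U is needed at both ends. On the target side it removes the path that leaves through the top and
  returns by f. On the source side f kills the intersection of U with V[-k], which removes the path
  of [f, b] that leaves through the bottom; otherwise both congruences would acquire further terms.

  The induction treats all a and n together, because the brackets [a, u_i] have other degrees. It
  can start because degrees are bounded while \<open>\<psi> m\<close> vanishes for negative
  \<open>m\<close>.

  No bases of sl2-modules are chosen. The vectors F^j w, with w any highest weight vector, span V;
  matrix identities are tested on them, and the definite descriptions that define the projections
  are resolved there.\<close>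

lemma (in vector_space) eigenvectors_sum_zero:
  assumes "finite \<Lambda>"
    and add: "\<And>u v. T (u + v) = T u + T v" and scale: "\<And>c v. T (scale c v) = scale c (T v)"
    and "\<And>l. l \<in> \<Lambda> \<Longrightarrow> T (v l) = scale l (v l)" and "(\<Sum>l\<in>\<Lambda>. v l) = 0" and "l \<in> \<Lambda>"
  shows "v l = 0"
  using assms(1,4-)
proof (induction \<Lambda> arbitrary: v l rule: finite_induct)
  case (insert a \<Lambda>)
  have T0: "T 0 = 0" using scale[of 0 0] by simp
  have Tsum: "T (\<Sum>l\<in>S. g l) = (\<Sum>l\<in>S. T (g l))" for g :: "'a \<Rightarrow> 'b" and S
    by (induction S rule: infinite_finite_induct) (simp_all add: T0 add)
  have s: "v a + (\<Sum>l\<in>\<Lambda>. v l) = 0" using insert by simp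
  \<comment> \<open>Applying \<open>T - a\<close> removes the summand at \<open>a\<close> and
    multiplies each other one by the non-zero \<open>l - a\<close>.\<close>
  have "T (v a + (\<Sum>l\<in>\<Lambda>. v l)) - scale a (v a + (\<Sum>l\<in>\<Lambda>. v l)) = 0"
    unfolding s by (simp add: T0)
  moreover have "T (v a + (\<Sum>l\<in>\<Lambda>. v l)) = scale a (v a) + (\<Sum>l\<in>\<Lambda>. scale l (v l))"
    using insert.prems(1) by (simp add: add Tsum)
  ultimately have z: "(\<Sum>l\<in>\<Lambda>. scale (l - a) (v l)) = 0"
    by (simp add: scale_right_distrib scale_sum_right sum_subtractf scale_left_diff_distrib)
  have "scale (l - a) (v l) = 0" if "l \<in> \<Lambda>" for l
    using insert.IH[OF _ z that] insert.prems(1) scale by (simp add: mult.commute)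
  then have *: "v l = 0" if "l \<in> \<Lambda>" for l
    using that insert.hyps by (auto simp: scale_eq_0_iff)
  then have "v a = 0" using s by simp
  with * insert.prems(3) show ?case by auto
qed simp

lemma matrix_eq_on_span:
  fixes A B :: "'a::field^'n^'m"
  assumes "vec.span T = UNIV" and "\<And>v. v \<in> T \<Longrightarrow> A *v v = B *v v"
  shows "A = B"
proof -
  have "A *v v = B *v v" if "v \<in> vec.span T" for v
    using that assms(2)
    by (induction rule: vec.span_induct_alt) (simp_all add: vec.add vec.scale)
  with assms(1) show ?thesis by (simp add: matrix_eq)
qed

text \<open>Supplies the existence half of the definite descriptions \<open>weight_proj\<close> and
  \<open>isotypic_proj\<close>. The matrix is prescribed on an eigenbasis; an arbitrary eigenvector
  for \<open>l\<close> involves only basis vectors with that eigenvalue, so it is treated correctly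
  too.\<close>

lemma spectral_projection_exists:
  fixes A :: "complex^'n^'n"
  assumes span: "vec.span {v. \<exists>l. A *v v = l *s v} = UNIV"
  shows "\<exists>Q :: complex^'n^'n. \<forall>l v. A *v v = l *s v \<longrightarrow> Q *v v = (if l \<in> S then v else 0)"
proof -
  obtain B where B: "B \<subseteq> {v. \<exists>l. A *v v = l *s v}" "vec.independent B"
    "{v. \<exists>l. A *v v = l *s v} \<subseteq> vec.span B"
    by (rule vec.maximal_independent_subset)
  have fB: "finite B" using B(2) by (rule vec.finiteI_independent)
  have sB: "vec.span B = UNIV"
    using vec.span_mono[OF B(3)] unfolding span vec.span_span by blast
  have "\<forall>b\<in>B. \<exists>l. A *v b = l *s b" using B(1) by auto
  then obtain w where w: "\<And>b. b \<in> B \<Longrightarrow> A *v b = w b *s b" by metis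
  obtain g :: "complex^'n \<Rightarrow> complex^'n" where g: "Vector_Spaces.linear (*s) (*s) g"
    "\<forall>b\<in>B. g b = (if w b \<in> S then b else 0)"
    using vec.linear_independent_extend[OF B(2), of "\<lambda>b. if w b \<in> S then b else 0"] by blast
  interpret g: Vector_Spaces.linear "(*s)" "(*s)" g by fact
  have "g v = (if l \<in> S then v else 0)" if v: "A *v v = l *s v" for l v
  proof -
    obtain c where c: "v = (\<Sum>b\<in>B. c b *s b)"
    proof -
      have "v \<in> range (\<lambda>c. \<Sum>b\<in>B. c b *s b)" using vec.span_finite[OF fB] sB by blast
      then show ?thesis using that by blast
    qed
    have "(\<Sum>b\<in>B. (c b * (w b - l)) *s b) = A *v v - l *s v"
    proof -
      have "A *v v = (\<Sum>b\<in>B. (c b * w b) *s b)"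
        unfolding c vec.sum vec.scale by (intro sum.cong refl) (simp only: w vec.scale_scale)
      moreover have "l *s v = (\<Sum>b\<in>B. (c b * l) *s b)"
        unfolding c vec.scale_sum_right by (intro sum.cong refl) (simp only: vec.scale_scale mult.commute)
      ultimately show ?thesis
        by (simp only: right_diff_distrib vec.scale_left_diff_distrib sum_subtractf)
    qed
    then have z: "(\<Sum>b\<in>B. (c b * (w b - l)) *s b) = 0" using v by simp
    have cz: "c b = 0 \<or> w b = l" if "b \<in> B" for b
      using vec.independentD[OF B(2) fB subset_refl z that] by simp
    have "g v = (\<Sum>b\<in>B. c b *s (if w b \<in> S then b else 0))"
      unfolding c g.sum g.scale by (intro sum.cong refl) (simp only: g(2))
    also have "\<dots> = (\<Sum>b\<in>B. if l \<in> S then c b *s b else 0)"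
      by (intro sum.cong refl) (use cz in force)
    also have "\<dots> = (if l \<in> S then v else 0)" using c by simp
    finally show ?thesis .
  qed
  then show ?thesis using matrix_works[OF g(1)] by (intro exI[of _ "matrix g"]) simp
qed

primrec mpow :: "'a::semiring_1^'n^'n \<Rightarrow> nat \<Rightarrow> 'a^'n^'n" where
  "mpow A 0 = mat 1"
| "mpow A (Suc m) = A ** mpow A m"

lemma mpow_Suc_right: "mpow A (Suc m) = mpow A m ** A"
proof (induction m)
  case (Suc m)
  have "mpow A (Suc (Suc m)) = A ** (mpow A m ** A)" using Suc by simp
  then show ?case by (simp add: matrix_mul_assoc)
qed simp

lemma mpow_add: "mpow A (i + j) = mpow A i ** mpow A j"
  by (induction i) (simp_all add: matrix_mul_assoc)

lemma matrix_sub_ldistrib: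
  fixes A :: "'a::ring_1^'n^'m"
  shows "A ** (B - C) = A ** B - A ** C"
  by (vector matrix_matrix_mult_def sum_subtractf right_diff_distrib)

lemma matrix_sub_rdistrib:
  fixes A :: "'a::ring_1^'n^'m"
  shows "(A - B) ** C = A ** C - B ** C"
  by (vector matrix_matrix_mult_def sum_subtractf left_diff_distrib)

lemma matrix_add_rdistrib:
  fixes A :: "'a::semiring_1^'n^'m"
  shows "(A + B) ** C = A ** C + B ** C"
  by (vector matrix_matrix_mult_def sum.distrib distrib_right)

lemma matrix_minus_left: "(- A) ** B = - (A ** (B :: 'a::ring_1^'n^'m))"
  by (vector matrix_matrix_mult_def sum_negf)

lemma matrix_minus_right: "A ** (- B) = - (A ** (B :: 'a::ring_1^'n^'m))"
  by (vector matrix_matrix_mult_def sum_negf)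

lemma matrix_sum_left: "(\<Sum>i\<in>S. A i) ** B = (\<Sum>i\<in>S. A i ** (B :: 'a::semiring_1^'n^'m))"
  by (induction S rule: infinite_finite_induct) (simp_all add: matrix_add_rdistrib times0_left)

lemma matrix_sum_right: "A ** (\<Sum>i\<in>S. B i) = (\<Sum>i\<in>S. (A :: 'a::semiring_1^'n^'m) ** B i)"
  by (induction S rule: infinite_finite_induct) (simp_all add: matrix_add_ldistrib times0_right)

lemmas matrix_ring_simps = matrix_add_ldistrib matrix_add_rdistrib matrix_sub_ldistrib matrix_sub_rdistrib
  matrix_minus_left matrix_minus_right times0_left times0_right matrix_mul_assoc

text \<open>The powers of \<open>A\<close> are eigenvectors of \<open>ad X\<close> with the distinct
  eigenvalues \<open>m * s\<close>, so if none vanished there would be arbitrarily many independent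
  matrices.\<close>

lemma nilpotent_if_ad_eigenvector:
  fixes X A :: "complex^'n^'n" and s :: real
  assumes ad: "X ** A - A ** X = s *\<^sub>R A" and "s \<noteq> 0"
  shows "\<exists>m. mpow A m = 0"
proof (rule ccontr)
  assume "\<not> ?thesis"
  then have nz: "mpow A m \<noteq> 0" for m by blast
  define T where "T = (\<lambda>M. X ** M - M ** X)"
  have T: "T (mpow A m) = (of_nat m * s) *\<^sub>R mpow A m" for m
  proof (induction m)
    case (Suc m)
    have "T (mpow A (Suc m)) = (X ** A - A ** X) ** mpow A m + A ** T (mpow A m)"
      by (simp add: T_def matrix_ring_simps)
    also have "\<dots> = s *\<^sub>R (A ** mpow A m) + (of_nat m * s) *\<^sub>R (A ** mpow A m)"
      unfolding Suc ad by (simp only: scalar_matrix_assoc matrix_scalar_ac)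
    finally show ?case by (simp add: algebra_simps)
  qed (simp add: T_def)
  have Tadd: "T (u + v) = T u + T v" for u v by (simp add: T_def matrix_ring_simps)
  have Tscale: "T (c *\<^sub>R v) = c *\<^sub>R T v" for c v
    unfolding T_def matrix_scalar_ac scalar_matrix_assoc[symmetric] scaleR_diff_right by (rule refl)
  have inj: "inj (mpow A)"
  proof (rule injI)
    fix i j assume eq: "mpow A i = mpow A j"
    have "(of_nat i * s) *\<^sub>R mpow A i = (of_nat j * s) *\<^sub>R mpow A i"
      using T[of i] T[of j] unfolding eq by (rule trans[OF sym])
    then show "i = j" using nz[of j] eq \<open>s \<noteq> 0\<close> by auto
  qed
  define N where "N = Suc (DIM(complex^'n^'n))"
  have card: "card (mpow A ` {..<N}) = N" using inj by (simp add: card_image inj_on_subset)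
  have "dependent (mpow A ` {..<N})"
    using independent_bound[of "mpow A ` {..<N}"] card by (auto simp: N_def)
  then obtain t where t: "(\<Sum>v\<in>mpow A ` {..<N}. t v *\<^sub>R v) = 0" "\<exists>v\<in>mpow A ` {..<N}. t v \<noteq> 0"
    using dependent_finite[of "mpow A ` {..<N}"] by auto
  have "(\<Sum>v\<in>mpow A ` {..<N}. t v *\<^sub>R v) = (\<Sum>i<N. t (mpow A i) *\<^sub>R mpow A i)"
    using inj by (subst sum.reindex) (auto simp: inj_on_def)
  \<comment> \<open>\<open>eigenvectors_sum_zero\<close> indexes by eigenvalue;
    \<open>nat \<lfloor>l / s\<rfloor>\<close> recovers the exponent from
    \<open>l = i * s\<close>.\<close>
  also have "\<dots> = (\<Sum>l\<in>(\<lambda>i. of_nat i * s) ` {..<N}. t (mpow A (nat \<lfloor>l / s\<rfloor>)) *\<^sub>R mpow A (nat \<lfloor>l / s\<rfloor>))"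
    using \<open>s \<noteq> 0\<close> by (subst sum.reindex) (auto simp: inj_on_def)
  finally have z: "\<dots> = 0" using t(1) by simp
  have "t (mpow A i) *\<^sub>R mpow A i = 0" if "i < N" for i
  proof -
    have "t (mpow A (nat \<lfloor>l / s\<rfloor>)) *\<^sub>R mpow A (nat \<lfloor>l / s\<rfloor>) = 0" if "l \<in> (\<lambda>i. of_nat i * s) ` {..<N}" for l
      by (rule real_vector.eigenvectors_sum_zero[OF _ Tadd Tscale _ z that])
        (use \<open>s \<noteq> 0\<close> in \<open>auto simp: Tscale T mult_ac\<close>)
    from this[of "of_nat i * s"] show ?thesis using that \<open>s \<noteq> 0\<close> by simp
  qed
  with t(2) nz show False by auto
qed

section \<open>Finite-dimensional representations of sl2\<close>

lemma matrix_minus_vector: "(- A) *v (v :: 'a::ring_1^'n) = - (A *v v)"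
  by (vector matrix_vector_mult_def sum_negf)

lemma two_scale: "2 *s (v :: complex^'n) = v + v"
  by (simp add: vec_eq_iff)

text \<open>The polynomial with root list \<open>as\<close>, evaluated at \<open>A\<close> and
  applied to \<open>v\<close>. For the roots \<open>m - 1, ..., 0\<close> it is the falling
  factorial of \<open>A\<close>, whence the name.\<close>

primrec falling :: "complex^'n^'n \<Rightarrow> complex list \<Rightarrow> complex^'n \<Rightarrow> complex^'n" where
  "falling A [] v = v"
| "falling A (a # as) v = falling A as (A *v v - a *s v)"

lemma falling_add: "falling A as (u + v) = falling A as u + falling A as v"
  by (induction as arbitrary: u v) (simp_all add: vec.add vec.scale_right_distrib add_diff_add)

lemma falling_scale: "falling A as (c *s v) = c *s falling A as v"
proof (induction as arbitrary: v)
  case (Cons a as)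
  have "A *v (c *s v) - a *s (c *s v) = c *s (A *v v - a *s v)"
    by (simp add: vec.scale vec.scale_right_diff_distrib mult.commute)
  then show ?case unfolding falling.simps by (simp only: Cons)
qed simp

lemma falling_diff: "falling A as (u - v) = falling A as u - falling A as v"
  using falling_add[of A as "u - v" v] by simp

lemma falling_apply: "falling A as (A *v v) = A *v falling A as v"
  by (induction as arbitrary: v) (simp_all add: falling_diff falling_scale vec.diff vec.scale)

lemma falling_intertwine:
  assumes "\<And>v. T (A *v v) = A *v T v + c *s T v" and "\<And>u v. T (u - v) = T u - T v"
    and "\<And>c v. T (c *s v) = c *s T v"
  shows "T (falling A as v) = falling A (map (\<lambda>a. a - c) as) (T v)"
  by (induction as arbitrary: v) (simp_all add: assms vec.scale_left_diff_distrib algebra_simps)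

lemma falling_eigenvector:
  assumes "A *v v = l *s v"
  shows "falling A as v = (\<Prod>a\<leftarrow>as. l - a) *s v"
  using assms
proof (induction as)
  case (Cons a as)
  show ?case
    unfolding falling.simps Cons.prems vec.scale_left_diff_distrib[symmetric] falling_scale Cons.IH[OF Cons.prems]
    by simp
qed simp

text \<open>Split off a root \<open>a\<close> of the first polynomial: by induction
  \<open>(A - a) v = 0\<close>, and on such an eigenvector the second polynomial acts by its value
  at \<open>a\<close>, which is not zero. This replaces a Bezout identity.\<close>

lemma falling_coprime_zero:
  assumes "falling A as v = 0" "falling A bs v = 0" "set as \<inter> set bs = {}"
  shows "v = 0"
  using assms
proof (induction as arbitrary: v)
  case (Cons a as)
  have "falling A bs (A *v v - a *s v) = 0"
    by (simp add: falling_diff falling_scale falling_apply Cons.prems(2))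
  moreover have "falling A as (A *v v - a *s v) = 0" "set as \<inter> set bs = {}"
    using Cons.prems(1,3) by auto
  ultimately have "A *v v - a *s v = 0" using Cons.IH by blast
  then have eig: "A *v v = a *s v" by simp
  have "(\<Prod>b\<leftarrow>bs. a - b) *s v = 0"
    unfolding falling_eigenvector[OF eig, symmetric] by (rule Cons.prems(2))
  moreover have "(\<Prod>b\<leftarrow>bs. a - b) \<noteq> 0"
    using Cons.prems(3) by (auto simp: prod_list_zero_iff)
  ultimately show ?case by (simp only: vec.scale_eq_0_iff simp_thms)
qed simp

lemma falling_uminus: "falling (- A) as v = (- 1) ^ length as *s falling A (map uminus as) v"
proof (induction as arbitrary: v)
  case (Cons a as)
  have "(- A) *v v - a *s v = (- 1) *s (A *v v - (- a) *s v)"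
    by (simp add: vec.scale_right_diff_distrib matrix_minus_vector)
  then show ?case unfolding falling.simps by (simp only: Cons falling_scale) simp
qed simp

lemma falling_distinct_span:
  assumes "falling A as v = 0" "distinct as" "vec.subspace K" "\<And>v. v \<in> K \<Longrightarrow> A *v v \<in> K" "v \<in> K"
  shows "v \<in> vec.span {w \<in> K. \<exists>a\<in>set as. A *v w = a *s w}"
proof -
  have "\<exists>w. v = (\<Sum>a\<in>set as. w a) \<and> (\<forall>a\<in>set as. w a \<in> K \<and> A *v w a = a *s w a)"
    using assms(1,2,5)
  proof (induction as arbitrary: v)
    case (Cons a as)
    have "A *v v - a *s v \<in> K"
      using assms(3,4) Cons.prems(3) vec.subspace_diff vec.subspace_scale by blast
    then obtain w where w: "A *v v - a *s v = (\<Sum>b\<in>set as. w b)"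
      "\<And>b. b \<in> set as \<Longrightarrow> w b \<in> K \<and> A *v w b = b *s w b"
      using Cons.IH[of "A *v v - a *s v"] Cons.prems by auto
    \<comment> \<open>\<open>A - a\<close> multiplies \<open>w b\<close> by \<open>b - a\<close>, so
      this correction cancels \<open>(A - a) v\<close> and leaves an eigenvector for
      \<open>a\<close>.\<close>
    define y where "y = v - (\<Sum>b\<in>set as. inverse (b - a) *s w b)"
    have step: "A *v (inverse (b - a) *s w b) - a *s (inverse (b - a) *s w b) = w b" if b: "b \<in> set as" for b
    proof -
      have "b \<noteq> a" using b Cons.prems by auto
      have "A *v (inverse (b - a) *s w b) - a *s (inverse (b - a) *s w b) = ((b - a) * inverse (b - a)) *s w b"
        using w(2)[OF b] by (simp add: vec.scale left_diff_distrib vec.scale_left_diff_distrib mult.commute)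
      then show ?thesis using \<open>b \<noteq> a\<close> by simp
    qed
    have "A *v y - a *s y = A *v v - a *s v
        - (\<Sum>b\<in>set as. A *v (inverse (b - a) *s w b) - a *s (inverse (b - a) *s w b))"
      unfolding y_def vec.diff vec.sum vec.scale_right_diff_distrib vec.scale_sum_right sum_subtractf
      by (simp only: diff_diff_eq2 diff_add_eq add.commute add_diff_eq diff_diff_eq)
    also have "\<dots> = 0" unfolding w(1) by (simp only: step cong: sum.cong) simp
    finally have y: "A *v y = a *s y" by simp
    have yK: "y \<in> K" unfolding y_def
      using assms(3) w(2) Cons.prems(3)
      by (intro vec.subspace_diff vec.subspace_sum vec.subspace_scale) auto
    have "v = (\<Sum>b\<in>set (a # as). if b = a then y else inverse (b - a) *s w b)"
      using Cons.prems(2) by (auto simp: y_def intro!: sum.cong)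
    moreover have "\<forall>b\<in>set (a # as). (if b = a then y else inverse (b - a) *s w b) \<in> K \<and>
       A *v (if b = a then y else inverse (b - a) *s w b) = b *s (if b = a then y else inverse (b - a) *s w b)"
      using y yK w(2) assms(3) Cons.prems(2)
      by (auto simp: vec.scale vec.subspace_scale mult.commute)
    ultimately show ?case by blast
  qed simp
  then obtain w where w: "v = (\<Sum>a\<in>set as. w a)" "\<forall>a\<in>set as. w a \<in> K \<and> A *v w a = a *s w a"
    by blast
  show ?thesis unfolding w(1) by (intro vec.span_sum vec.span_base) (use w(2) in blast)
qed

lemma mpow_Suc_apply: "mpow A (Suc k) *v v = mpow A k *v (A *v v)"
  by (simp add: mpow_Suc_right matrix_vector_mul_assoc del: mpow.simps)

lemma mpow_apply_Suc: "mpow A (Suc k) *v v = A *v (mpow A k *v v)"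
  by (simp add: matrix_vector_mul_assoc)

section \<open>Commutation formulas and highest weight vectors\<close>

locale sl2_triple =
  fixes F X E :: "complex^'n^'n"
  assumes XE: "X ** E - E ** X = E" and XF: "X ** F - F ** X = - F" and EF: "E ** F - F ** E = X + X"
begin

lemma EFv: "E *v (F *v v) = F *v (E *v v) + 2 *s (X *v v)"
proof -
  have *: "E ** F = F ** E + (X + X)" unfolding EF[symmetric] by simp
  show ?thesis
    unfolding matrix_vector_mul_assoc * matrix_vector_mult_add_rdistrib two_scale by (rule refl)
qed

lemma XFv: "X *v (F *v v) = F *v (X *v v) - F *v v"
proof -
  have *: "X ** F = F ** X - F" using XF by (simp add: algebra_simps)
  show ?thesis unfolding matrix_vector_mul_assoc * matrix_vector_mult_diff_rdistrib by (rule refl)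
qed

lemma XEv: "X *v (E *v v) = E *v (X *v v) + E *v v"
proof -
  have *: "X ** E = E ** X + E" using XE by (simp add: algebra_simps)
  show ?thesis unfolding matrix_vector_mul_assoc * matrix_vector_mult_add_rdistrib by (rule refl)
qed

lemma flip: "sl2_triple E (- X) F"
  by unfold_locales (use XE XF EF in \<open>simp_all add: matrix_ring_simps algebra_simps\<close>)

lemma F_nilpotent: "\<exists>m. mpow F m = 0"
  by (rule nilpotent_if_ad_eigenvector[of X F "-1"]) (simp_all add: XF)

text \<open>The usual Cartan element. \<open>X\<close> is half of it, so highest weights are natural
  numbers for \<open>H\<close> and half-integers for \<open>X\<close>.\<close>

definition H :: "complex^'n^'n" where "H = X + X"

lemma Hv: "H *v v = 2 *s (X *v v)"
  unfolding H_def matrix_vector_mult_add_rdistrib two_scale by (rule refl)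

lemma HFv: "H *v (F *v v) = F *v (H *v v) - 2 *s (F *v v)"
  by (simp add: Hv XFv vec.scale vec.scale_right_diff_distrib)

lemma HEv: "H *v (E *v v) = E *v (H *v v) + 2 *s (E *v v)"
  by (simp add: Hv XEv vec.scale vec.scale_right_distrib)

lemma E_mpow_F:
  "E *v (mpow F (Suc m) *v v)
     = mpow F (Suc m) *v (E *v v) + of_nat (Suc m) *s (mpow F m *v (H *v v - of_nat m *s v))"
proof (induction m arbitrary: v)
  case 0
  show ?case by (simp add: EFv Hv)
next
  case (Suc m)
  have r: "mpow F (Suc k) *v v = mpow F k *v (F *v v)" for k v
    by (simp add: mpow_Suc_right matrix_vector_mul_assoc del: mpow.simps)
  have "E *v (mpow F (Suc (Suc m)) *v v)
      = mpow F (Suc m) *v (E *v (F *v v))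
        + of_nat (Suc m) *s (mpow F m *v (H *v (F *v v) - of_nat m *s (F *v v)))"
    unfolding r[of "Suc m"] by (rule Suc)
  also have "mpow F m *v (H *v (F *v v) - of_nat m *s (F *v v))
      = mpow F m *v (F *v (H *v v - of_nat (m + 2) *s v))"
    by (simp add: HFv vec.diff vec.add vec.scale vec.scale_left_distrib)
  also have "\<dots> = mpow F (Suc m) *v (H *v v - of_nat (m + 2) *s v)" by (simp only: r)
  also have "mpow F (Suc m) *v (E *v (F *v v)) = mpow F (Suc (Suc m)) *v (E *v v) + mpow F (Suc m) *v (H *v v)"
    by (simp only: r EFv vec.add vec.diff vec.scale Hv)
  finally show ?case
    unfolding vec.diff vec.scale by (simp add: vec_eq_iff algebra_simps del: mpow.simps)
qed

text \<open>The condition \<open>F E v = 0\<close> is inherited by \<open>(H - m) v\<close> and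
  kills the other term of \<open>E_mpow_F\<close>. As \<open>F\<close> is nilpotent, it follows that
  \<open>H\<close> satisfies a polynomial with natural roots on the kernel of \<open>F E\<close>.
  The hypothesis is not \<open>E v = 0\<close>, because \<open>ker_FE\<close> still has to deduce
  that.\<close>

lemma E_mpow_F_ker:
  "F *v (E *v v) = 0 \<Longrightarrow>
    mpow E m *v (mpow F m *v v) = fact m *s falling H (map of_nat (rev [0..<m])) v"
proof (induction m arbitrary: v)
  case (Suc m)
  let ?v = "H *v v - of_nat m *s v"
  have "E *v (H *v v) = H *v (E *v v) - 2 *s (E *v v)" using HEv[of v] by simp
  then have v': "F *v (E *v ?v) = 0"
    using HFv[of "E *v v"] Suc.prems by (simp add: vec.diff vec.scale)
  have "mpow E (Suc m) *v (mpow F (Suc m) *v v) = mpow E m *v (E *v (mpow F (Suc m) *v v))"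
    by (rule mpow_Suc_apply)
  also have "E *v (mpow F (Suc m) *v v) = of_nat (Suc m) *s (mpow F m *v ?v)"
    unfolding E_mpow_F mpow_Suc_apply[of F m "E *v v"] Suc.prems by simp
  also have "mpow E m *v \<dots> = of_nat (Suc m) *s (fact m *s falling H (map of_nat (rev [0..<m])) ?v)"
    unfolding vec.scale Suc.IH[OF v'] by (rule refl)
  also have "\<dots> = (of_nat (Suc m) * fact m) *s falling H (map of_nat (rev [0..<m])) ?v"
    by (rule vec.scale_scale)
  finally show ?case by simp
qed simp

lemma falling_ker_FE: "\<exists>m. \<forall>v. F *v (E *v v) = 0 \<longrightarrow> falling H (map of_nat (rev [0..<m])) v = 0"
proof -
  obtain m where m: "mpow F m = 0" using F_nilpotent by blast
  have "falling H (map of_nat (rev [0..<m])) v = 0" if "F *v (E *v v) = 0" for v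
    using E_mpow_F_ker[OF that, of m] m by simp
  then show ?thesis by blast
qed

lemma ker_FE:
  assumes v: "F *v (E *v v) = 0"
  shows "E *v v = 0"
proof -
  txt \<open>By the preceding lemma \<open>H\<close> has eigenvalues \<open>\<ge> 2\<close> on \<open>E v\<close>; by the same lemma for the opposite
    triple it has eigenvalues \<open>\<le> 0\<close> there.\<close>
  interpret f: sl2_triple E "- X" F by (rule flip)
  obtain m where m: "falling H (map of_nat (rev [0..<m])) v = 0" using falling_ker_FE v by blast
  obtain m' where m': "falling f.H (map of_nat (rev [0..<m'])) (E *v v) = 0"
    using f.falling_ker_FE v by (metis matrix_vector_mult_0_right)
  have H': "f.H = - H" unfolding f.H_def H_def minus_add_distrib by (rule refl)
  have "falling H (map uminus (map of_nat (rev [0..<m']))) (E *v v) = 0"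
    using m' unfolding H' falling_uminus by (simp only: vec.scale_eq_0_iff) simp
  moreover have "falling H (map (\<lambda>a. a - (- 2)) (map of_nat (rev [0..<m]))) (E *v v) = 0"
  proof -
    have "E *v (falling H (map of_nat (rev [0..<m])) v)
        = falling H (map (\<lambda>a. a - (- 2)) (map of_nat (rev [0..<m]))) (E *v v)"
      by (rule falling_intertwine[where T = "(*v) E" and c = "- 2"]) (simp_all add: HEv vec.diff vec.scale)
    then show ?thesis using m by simp
  qed
  moreover have "set (map uminus (map (of_nat :: nat \<Rightarrow> complex) (rev [0..<m'])))
      \<inter> set (map (\<lambda>a. a - (- 2)) (map of_nat (rev [0..<m]))) = {}"
  proof -
    have "- of_nat a \<noteq> (of_nat b - (- 2) :: complex)" for a b
    proof
      assume "- of_nat a = (of_nat b - (- 2) :: complex)"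
      then have "Re (- of_nat a) = Re (of_nat b - (- 2))" by (rule arg_cong)
      then show False by simp
    qed
    then show ?thesis unfolding set_map by blast
  qed
  ultimately show ?thesis by (rule falling_coprime_zero)
qed

text \<open>The annihilating polynomial has the distinct roots \<open>0, ..., m - 1\<close>, so
  \<open>H\<close> is diagonalizable on the kernel of \<open>E\<close>. The triple itself carries no
  assumption of diagonalizability.\<close>

lemma ker_E_span: "E *v v = 0 \<Longrightarrow> v \<in> vec.span {w. E *v w = 0 \<and> (\<exists>i::nat. H *v w = of_nat i *s w)}"
proof -
  assume v: "E *v v = 0"
  obtain m where m: "\<And>v. F *v (E *v v) = 0 \<Longrightarrow> falling H (map of_nat (rev [0..<m])) v = 0"
    using falling_ker_FE by blast
  have "v \<in> vec.span {w \<in> {w. E *v w = 0}. \<exists>a\<in>set (map of_nat (rev [0..<m])). H *v w = a *s w}"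
  proof (rule falling_distinct_span)
    show "falling H (map of_nat (rev [0..<m])) v = 0" by (rule m) (simp add: v)
    show "vec.subspace {w. E *v w = 0}"
      by (rule vec.subspaceI) (simp_all add: vec.add vec.scale)
    show "H *v w \<in> {w. E *v w = 0}" if "w \<in> {w. E *v w = 0}" for w
      using HEv[of w] that by simp
  qed (simp_all add: v distinct_map inj_on_def)
  then show ?thesis by (rule vec.span_mono[THEN subsetD, rotated]) auto
qed

lemma highest_weight_nat:
  assumes "E *v w = 0" "w \<noteq> 0" "H *v w = \<mu> *s w"
  shows "\<exists>i. \<mu> = of_nat i"
proof -
  obtain m where "falling H (map of_nat (rev [0..<m])) w = 0"
    using falling_ker_FE assms(1) by (metis matrix_vector_mult_0_right)
  then have "(\<Prod>a\<leftarrow>map of_nat (rev [0..<m]). \<mu> - a) = 0"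
    unfolding falling_eigenvector[OF assms(3)] vec.scale_eq_0_iff using assms(2) by blast
  then show ?thesis by (auto simp: prod_list_zero_iff)
qed

lemma im_F_plus_ker_E: "\<exists>z w. v = F *v z + w \<and> E *v w = 0"
proof -
  txt \<open>\<open>E F\<close> is injective on the range of \<open>E\<close>, hence maps it onto itself.\<close>
  interpret f: sl2_triple E "- X" F by (rule flip)
  let ?g = "\<lambda>v. E *v (F *v v)"
  have lin: "Vector_Spaces.linear (*s) (*s) ?g"
    unfolding matrix_vector_mul_assoc by (rule matrix_vector_mul_linear_gen)
  have W: "vec.subspace (range ((*v) E))"
    by (rule vec.subspaceI) (auto simp: vec.add[symmetric] vec.scale[symmetric] intro: range_eqI[of _ _ 0])
  have inj: "inj_on ?g (vec.span (range ((*v) E)))"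
    unfolding vec.span_eq_iff[THEN iffD2, OF W]
  proof (rule inj_onI)
    fix a b assume ab: "a \<in> range ((*v) E)" "b \<in> range ((*v) E)" "?g a = ?g b"
    then obtain u where u: "a - b = E *v u" by (auto simp: vec.diff[symmetric])
    have "?g (a - b) = 0" using ab(3) by (simp add: vec.diff)
    then have "F *v (E *v u) = 0" unfolding u using f.ker_FE by blast
    then have "E *v u = 0" by (rule ker_FE)
    then show "a = b" using u by simp
  qed
  have "?g ` range ((*v) E) = range ((*v) E)"
  proof (rule vec.subspace_dim_equal)
    show "vec.subspace (?g ` range ((*v) E))"
      by (rule vec.linear_subspace_image[OF lin W])
    show "vec.dim (range ((*v) E)) \<le> vec.dim (?g ` range ((*v) E))"
      using vec.dim_image_eq[OF lin inj] by simp
  qed (use W in auto)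
  then have "E *v v \<in> ?g ` range ((*v) E)" by blast
  then obtain z where "E *v v = E *v (F *v z)" by blast
  then have "v = F *v z + (v - F *v z) \<and> E *v (v - F *v z) = 0" by (simp add: vec.diff)
  then show ?thesis by blast
qed

text \<open>A set rather than part of a chosen basis: it contains every vector \<open>j\<close>
  steps below some highest weight vector of \<open>H\<close>-weight \<open>i\<close>, and also
  zero.\<close>

definition chain :: "nat \<Rightarrow> nat \<Rightarrow> (complex^'n) set" where
  "chain i j = {mpow F j *v w | w. E *v w = 0 \<and> H *v w = of_nat i *s w}"

definition chains :: "(complex^'n) set" where
  "chains = (\<Union>i. \<Union>j\<in>{..i}. chain i j)"

lemma chain_H:
  assumes "b \<in> chain i j"
  shows "H *v b = (of_nat i - 2 * of_nat j) *s b"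
proof -
  have "H *v (mpow F j *v w) = (of_nat i - 2 * of_nat j) *s (mpow F j *v w)" if "H *v w = of_nat i *s w" for w
  proof (induction j)
    case (Suc j)
    show ?case unfolding mpow_apply_Suc HFv Suc vec.scale
      by (simp add: vec_eq_iff algebra_simps del: mpow.simps)
  qed (simp add: that)
  then show ?thesis using assms by (auto simp: chain_def)
qed

lemma chain_F: "b \<in> chain i j \<Longrightarrow> F *v b \<in> chain i (Suc j)"
  by (auto simp: chain_def mpow_apply_Suc[symmetric] simp del: mpow.simps)

text \<open>\<open>F^(i+1) w\<close> is again annihilated by \<open>E\<close>, but its
  \<open>H\<close>-weight \<open>-i - 2\<close> is not a natural number.\<close>

lemma chain_zero:
  assumes "b \<in> chain i j" "i < j"
  shows "b = 0"
proof -
  have z: "mpow F (Suc i) *v w = 0" if w: "E *v w = 0" "H *v w = of_nat i *s w" for w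
  proof (rule ccontr)
    assume nz: "mpow F (Suc i) *v w \<noteq> 0"
    have "E *v (mpow F (Suc i) *v w) = 0" unfolding E_mpow_F w by simp
    moreover have "H *v (mpow F (Suc i) *v w) = (of_nat i - 2 * of_nat (Suc i)) *s (mpow F (Suc i) *v w)"
      by (rule chain_H) (use w in \<open>auto simp: chain_def simp del: mpow.simps\<close>)
    ultimately obtain n where "(of_nat i - 2 * of_nat (Suc i) :: complex) = of_nat n"
      using highest_weight_nat nz by blast
    then have "Re (of_nat i - 2 * of_nat (Suc i)) = Re (of_nat n)" by (rule arg_cong)
    then show False by simp
  qed
  obtain w where w: "b = mpow F j *v w" "E *v w = 0" "H *v w = of_nat i *s w"
    using assms(1) by (auto simp: chain_def)
  have "j = (j - Suc i) + Suc i" using assms(2) by simp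
  then have "b = mpow F (j - Suc i) *v (mpow F (Suc i) *v w)"
    unfolding w(1) matrix_vector_mul_assoc mpow_add[symmetric] by (rule arg_cong)
  then show ?thesis using z[OF w(2,3)] by simp
qed

text \<open>Complete reducibility in the form used below. Iterating \<open>V = F V + ker E\<close>
  gives \<open>V = F^m V + span chains\<close> for every \<open>m\<close>, and \<open>F\<close> is
  nilpotent.\<close>

lemma span_chains: "vec.span chains = UNIV"
proof -
  have sub: "chain i j \<subseteq> vec.span chains" for i j
  proof
    fix b assume b: "b \<in> chain i j"
    show "b \<in> vec.span chains"
    proof (cases "j \<le> i")
      case True
      then show ?thesis using b by (intro vec.span_base) (auto simp: chains_def)
    next
      case False
      then show ?thesis using chain_zero[OF b] by (simp add: vec.span_zero)
    qed
  qed
  have F_span: "F *v v \<in> vec.span chains" if "v \<in> vec.span chains" for v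
    using that
  proof (induction rule: vec.span_induct_alt)
    case (step c b v)
    then obtain i j where "b \<in> chain i j" by (auto simp: chains_def)
    then have "F *v b \<in> vec.span chains" using sub chain_F by blast
    then show ?case unfolding vec.add vec.scale using step.IH by (intro vec.span_add vec.span_scale)
  qed (simp add: vec.span_zero)
  have ker: "v \<in> vec.span chains" if "E *v v = 0" for v
  proof -
    have "{w. E *v w = 0 \<and> (\<exists>i::nat. H *v w = of_nat i *s w)} \<subseteq> vec.span chains"
    proof safe
      fix w i assume "E *v w = 0" "H *v w = of_nat i *s w"
      then have "w \<in> chain i 0" by (auto simp: chain_def)
      then show "w \<in> vec.span chains" using sub by blast
    qed
    then show ?thesis
      using ker_E_span[OF that] vec.span_minimal[OF _ vec.subspace_span] by blast
  qed
  have "\<exists>z. v - mpow F m *v z \<in> vec.span chains" for m v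
  proof (induction m arbitrary: v)
    case 0
    show ?case by (rule exI[of _ v]) (simp add: vec.span_zero)
  next
    case (Suc m)
    obtain z w where v: "v = F *v z + w" "E *v w = 0" using im_F_plus_ker_E by blast
    obtain z' where z': "z - mpow F m *v z' \<in> vec.span chains" using Suc by blast
    have "v - mpow F (Suc m) *v z' = F *v (z - mpow F m *v z') + w"
      unfolding mpow_apply_Suc v(1) by (simp add: vec.diff)
    also have "\<dots> \<in> vec.span chains" using F_span[OF z'] ker[OF v(2)] by (rule vec.span_add)
    finally show ?case by blast
  qed
  then show ?thesis using F_nilpotent
    by (metis UNIV_eq_I diff_zero matrix_vector_mult_0)
qed

end

lemma mem_span_projection:
  fixes Q :: "complex^'n^'n"
  assumes "\<And>b. b \<in> S \<Longrightarrow> Q *v b = b \<or> Q *v b = 0" and "v \<in> vec.span S" "Q *v v = v"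
  shows "v \<in> vec.span {b \<in> S. Q *v b = b}"
proof -
  have "Q *v v \<in> vec.span {b \<in> S. Q *v b = b}"
    using assms(2)
  proof (induction rule: vec.span_induct_alt)
    case (step c b v)
    have "Q *v b \<in> vec.span {b \<in> S. Q *v b = b}"
    proof (cases "Q *v b = b")
      case True
      then show ?thesis using step.hyps by (auto intro: vec.span_base)
    next
      case False
      then show ?thesis using assms(1)[OF step.hyps(1)] by (simp add: vec.span_zero)
    qed
    then show ?case unfolding vec.add vec.scale using step.IH by (intro vec.span_add vec.span_scale)
  qed (simp add: vec.span_zero)
  then show ?thesis by (simp only: assms(3))
qed

lemma mat_vector_mult: "mat c *v v = c *s (v :: 'a::semiring_1^'n)"
  by (vector matrix_vector_mult_def mat_def) (simp add: if_distrib if_distribR cong: if_cong)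

lemma span_stable:
  fixes A :: "complex^'n^'n"
  assumes "\<And>b. b \<in> S \<Longrightarrow> A *v b \<in> vec.span S" "v \<in> vec.span S"
  shows "A *v v \<in> vec.span S"
  using assms(2)
proof (induction rule: vec.span_induct_alt)
  case (step c b v)
  then show ?case unfolding vec.add vec.scale
    using assms(1) by (intro vec.span_add vec.span_scale) auto
qed (simp add: vec.span_zero)

section \<open>Weights, weight projections and powers of the lowering operator\<close>

context sl2_triple
begin

definition wt :: "nat \<Rightarrow> nat \<Rightarrow> real" where "wt i j = of_nat i / 2 - of_nat j"

lemma chain_X:
  assumes "b \<in> chain i j"
  shows "X *v b = of_real (wt i j) *s b"
proof -
  have "2 *s (X *v b) = (of_nat i - 2 * of_nat j) *s b"
    using chain_H[OF assms] by (simp only: Hv)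
  also have "\<dots> = 2 *s (of_real (wt i j) *s b)"
    by (simp add: vec_eq_iff wt_def field_simps)
  finally show ?thesis by (rule vec.scale_left_imp_eq[rotated]) simp
qed

lemma highest_weight_X:
  assumes "E *v w = 0" "H *v w = of_nat i *s w"
  shows "X *v w = of_real (of_nat i / 2) *s w"
proof -
  have "w \<in> chain i 0" using assms by (auto simp: chain_def)
  from chain_X[OF this] show ?thesis by (simp only: wt_def of_nat_0 diff_zero)
qed

lemma chain_E_step:
  assumes "E *v w = 0" "H *v w = of_nat i *s w"
  shows "E *v (mpow F (Suc j) *v w) = (of_nat (Suc j) * (of_nat i - of_nat j)) *s (mpow F j *v w)"
  unfolding E_mpow_F assms vec.diff vec.scale
  by (simp add: vec_eq_iff algebra_simps del: mpow.simps)

lemma chain_raise: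
  assumes "E *v w = 0" "H *v w = of_nat i *s w"
  shows "mpow E r *v (mpow F (r + j) *v w) = (\<Prod>s<r. of_nat (Suc (j + s)) * (of_nat i - of_nat (j + s))) *s (mpow F j *v w)"
proof (induction r)
  case (Suc r)
  have "mpow E (Suc r) *v (mpow F (Suc r + j) *v w) = mpow E r *v (E *v (mpow F (Suc (r + j)) *v w))"
    by (simp only: mpow_Suc_apply add_Suc)
  also have "\<dots> = (of_nat (Suc (r + j)) * (of_nat i - of_nat (r + j))) *s (mpow E r *v (mpow F (r + j) *v w))"
    unfolding chain_E_step[OF assms] vec.scale by (rule refl)
  also have "\<dots> = (of_nat (Suc (r + j)) * (of_nat i - of_nat (r + j)) * (\<Prod>s<r. of_nat (Suc (j + s)) * (of_nat i - of_nat (j + s))))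
      *s (mpow F j *v w)"
    unfolding Suc vec.scale_scale by (rule refl)
  finally show ?case by (simp only: prod.lessThan_Suc add.commute[of r j] mult.commute)
qed simp

lemma raise_nonzero:
  "j + r \<le> i \<Longrightarrow> (\<Prod>s<r. of_nat (Suc (j + s)) * (of_nat i - of_nat (j + s)) :: complex) \<noteq> 0"
  by (auto simp del: of_nat_Suc simp flip: of_nat_add) 

lemma span_eigenvectors:
  assumes "\<And>i j b. j \<le> i \<Longrightarrow> b \<in> chain i j \<Longrightarrow> \<exists>l. T *v b = l *s b"
  shows "vec.span {v. \<exists>l. T *v v = l *s v} = UNIV"
proof -
  have "chains \<subseteq> {v. \<exists>l. T *v v = l *s v}" using assms by (auto simp: chains_def)
  from vec.span_mono[OF this] show ?thesis unfolding span_chains by blast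
qed

lemma span_eigenvectors_X: "vec.span {v. \<exists>l. X *v v = l *s v} = UNIV"
  using chain_X by (intro span_eigenvectors) blast

text \<open>Chain vectors are simultaneous eigenvectors of \<open>X\<close>, of the Casimir operator
  and of all the projections, so most identities between these and \<open>F\<close> are checked
  here.\<close>

lemma matrix_eq_on_chains:
  fixes A B :: "complex^'n^'n"
  assumes "\<And>i j b. j \<le> i \<Longrightarrow> b \<in> chain i j \<Longrightarrow> A *v b = B *v b"
  shows "A = B"
  by (rule matrix_eq_on_span[OF span_chains]) (use assms in \<open>auto simp: chains_def\<close>)

text \<open>Existence comes from the spectral projection for the image of \<open>S\<close> in the
  complex numbers; uniqueness holds because the chains, all of real weight, span.\<close>

lemma weight_proj_mat_1:
  assumes "X *v v = of_real j *s v"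
  shows "weight_proj (mat 1) X S *v v = (if j \<in> S then v else 0)"
proof -
  let ?R = "\<lambda>Q. (\<forall>v. mat 1 *v v = 0 \<longrightarrow> Q *v v = 0) \<and>
     (\<forall>j v. mat 1 *v v = v \<and> X *v v = complex_of_real j *s v \<longrightarrow> Q *v v = (if j \<in> S then v else 0))"
  obtain Q :: "complex^'n^'n" where Q: "\<And>l v. X *v v = l *s v \<Longrightarrow> Q *v v = (if l \<in> of_real ` S then v else 0)"
    using spectral_projection_exists[OF span_eigenvectors_X] by metis
  have "Q *v v = (if j \<in> S then v else 0)" if "X *v v = of_real j *s v" for j v
    unfolding Q[OF that] by auto
  then have "?R Q" by simp
  moreover have "Q' = Q" if "?R Q'" for Q'
  proof (rule matrix_eq_on_chains)
    fix i j b assume "b \<in> chain i j"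
    from chain_X[OF this] have "Q' *v b = (if wt i j \<in> S then b else 0)" "Q *v b = (if wt i j \<in> S then b else 0)"
      using that \<open>?R Q\<close> unfolding matrix_vector_mul_lid by blast+
    then show "Q' *v b = Q *v b" by simp
  qed
  ultimately have "?R (weight_proj (mat 1) X S)"
    unfolding weight_proj_def by (rule theI)
  then show ?thesis using assms by simp
qed

abbreviation wproj :: "real set \<Rightarrow> complex^'n^'n" where "wproj S \<equiv> weight_proj (mat 1) X S"

lemma wproj_chain: "b \<in> chain i j \<Longrightarrow> wproj S *v b = (if wt i j \<in> S then b else 0)"
  using weight_proj_mat_1[OF chain_X] by blast

lemma wproj_mult: "wproj S ** wproj T = wproj (S \<inter> T)"
  by (rule matrix_eq_on_chains) (simp add: wproj_chain flip: matrix_vector_mul_assoc)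

lemma wproj_empty: "wproj {} = 0"
  by (rule matrix_eq_on_chains) (simp add: wproj_chain)

lemma wproj_union: "S \<inter> T = {} \<Longrightarrow> wproj (S \<union> T) = wproj S + wproj T"
  by (rule matrix_eq_on_chains) (auto simp: wproj_chain matrix_vector_mult_add_rdistrib)

lemma wproj_X: "wproj S ** X = X ** wproj S"
  by (rule matrix_eq_on_chains) (simp add: wproj_chain chain_X vec.scale flip: matrix_vector_mul_assoc)

lemma wproj_eigenvector: 
  assumes "wproj {j} *v v = v"
  shows "X *v v = of_real j *s v"
proof -
  have "X ** wproj {j} = mat (of_real j) ** wproj {j}"
  proof (rule matrix_eq_on_chains)
    fix i l b assume b: "b \<in> chain i l"
    show "(X ** wproj {j}) *v b = (mat (of_real j) ** wproj {j}) *v b"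
      using chain_X[OF b] by (auto simp: wproj_chain[OF b] mat_vector_mult simp flip: matrix_vector_mul_assoc)
  qed
  then have "X *v (wproj {j} *v v) = mat (of_real j) *v (wproj {j} *v v)"
    by (simp only: matrix_vector_mul_assoc)
  then show ?thesis unfolding assms mat_vector_mult .
qed

text \<open>\<open>lax_op\<close> forms its projections inside the truncated module, for the
  truncated grading element. On the range of \<open>P\<close> this element agrees with
  \<open>X\<close>, so they are ordinary weight projections.\<close>

lemma weight_proj_truncated:
  assumes P: "P = wproj T"
  shows "weight_proj P (P ** X ** P) S = wproj (S \<inter> T)"
proof -
  have PX: "(P ** X ** P) *v v = X *v v" if "P *v v = v" for v
    using that wproj_X[of T] by (metis P matrix_vector_mul_assoc)
  show ?thesis unfolding weight_proj_def[of P]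
  proof (rule the_equality, intro conjI allI impI)
    fix v assume "P *v v = 0"
    have "wproj (S \<inter> T) *v v = wproj S *v (P *v v)"
      by (simp only: P matrix_vector_mul_assoc wproj_mult)
    then show "wproj (S \<inter> T) *v v = 0" using \<open>P *v v = 0\<close> by simp
  next
    fix j v assume v: "P *v v = v \<and> (P ** X ** P) *v v = of_real j *s v"
    then have "wproj S *v v = (if j \<in> S then v else 0)" using PX[of v] by (intro weight_proj_mat_1) metis
    moreover have "wproj (S \<inter> T) *v v = wproj S *v (P *v v)"
      by (simp only: P matrix_vector_mul_assoc wproj_mult)
    ultimately show "wproj (S \<inter> T) *v v = (if j \<in> S then v else 0)" using v by simp
  next
    fix Q assume Q: "(\<forall>v. P *v v = 0 \<longrightarrow> Q *v v = 0) \<and>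
       (\<forall>j v. P *v v = v \<and> P ** X ** P *v v = complex_of_real j *s v \<longrightarrow> Q *v v = (if j \<in> S then v else 0))"
    show "Q = wproj (S \<inter> T)"
    proof (rule matrix_eq_on_chains)
      fix i j b assume b: "b \<in> chain i j"
      let ?j = "wt i j"
      show "Q *v b = wproj (S \<inter> T) *v b"
      proof (cases "?j \<in> T")
        case True
        then have Pb: "P *v b = b" by (simp add: P wproj_chain[OF b])
        then have "(P ** X ** P) *v b = of_real ?j *s b" using PX[of b] chain_X[OF b] by metis
        then have "Q *v b = (if ?j \<in> S then b else 0)" using Q Pb by blast
        then show ?thesis using True by (simp add: wproj_chain[OF b])
      next
        case False
        then have "P *v b = 0" by (simp add: P wproj_chain[OF b])
        then show ?thesis using Q False by (simp add: wproj_chain[OF b])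
      qed
    qed
  qed
qed

lemma weight_space_span:
  assumes "X *v v = of_real l *s v"
  shows "v \<in> vec.span {b. \<exists>i j. j \<le> i \<and> b \<in> chain i j \<and> wt i j = l}"
proof -
  have "v \<in> vec.span {b \<in> chains. wproj {l} *v b = b}"
  proof (rule mem_span_projection)
    show "wproj {l} *v b = b \<or> wproj {l} *v b = 0" if "b \<in> chains" for b
      using that by (auto simp: chains_def wproj_chain)
    show "wproj {l} *v v = v" using weight_proj_mat_1[OF assms] by simp
  qed (simp add: span_chains)
  also have "\<dots> \<subseteq> vec.span {b. \<exists>i j. j \<le> i \<and> b \<in> chain i j \<and> wt i j = l}"
  proof (rule vec.span_minimal[OF _ vec.subspace_span], safe)
    fix b assume b: "b \<in> chains" "wproj {l} *v b = b"
    then obtain i j where ij: "j \<le> i" "b \<in> chain i j" by (auto simp: chains_def)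
    show "b \<in> vec.span {b. \<exists>i j. j \<le> i \<and> b \<in> chain i j \<and> wt i j = l}"
    proof (cases "wt i j = l")
      case True
      then show ?thesis using ij by (intro vec.span_base) blast
    next
      case False
      then have "b = 0" using b(2) wproj_chain[OF ij(2), of "{l}"] by simp
      then show ?thesis by (simp add: vec.span_zero)
    qed
  qed
  finally show ?thesis .
qed

lemma lowering_injective:
  assumes v: "X *v v = of_real (of_nat K / 2) *s v" and z: "mpow F K *v v = 0"
  shows "v = 0"
proof -
  txt \<open>\<open>E\<^sup>K F\<^sup>K\<close> is diagonal on chains, with non-zero eigenvalues in weight \<open>K/2\<close>.\<close>
  define T where "T = mpow E K ** mpow F K"
  have T: "\<exists>t. T *v b = t *s b \<and> (K + j \<le> i \<longrightarrow> t \<noteq> 0)" if b: "b \<in> chain i j" for i j b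
  proof -
    obtain w where w: "b = mpow F j *v w" "E *v w = 0" "H *v w = of_nat i *s w"
      using b by (auto simp: chain_def)
    have "T *v b = (\<Prod>s<K. of_nat (Suc (j + s)) * (of_nat i - of_nat (j + s))) *s b"
      unfolding w(1) T_def chain_raise[OF w(2,3), of K j, symmetric]
      by (simp add: matrix_vector_mul_assoc mpow_add matrix_mul_assoc)
    then show ?thesis using raise_nonzero[of j K i] by (metis add.commute)
  qed
  have "vec.span {v. \<exists>l. T *v v = l *s v} = UNIV"
    using T by (intro span_eigenvectors) blast
  then obtain Q :: "complex^'n^'n" where Q: "\<And>l v. T *v v = l *s v \<Longrightarrow> Q *v v = (if l \<in> {0} then v else 0)"
    using spectral_projection_exists[of T "{0}"] by blast
  have "Q *v v = 0"
    using weight_space_span[OF v]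
  proof (induction rule: vec.span_induct_alt)
    case (step c b u)
    then obtain i j where b: "j \<le> i" "b \<in> chain i j" "wt i j = (of_nat K / 2 :: real)" by blast
    from b(3)[unfolded wt_def] have "real i = real (K + 2 * j)" by simp
    then have "K + j \<le> i" by linarith
    then obtain t where t: "T *v b = t *s b" "t \<noteq> 0" using T[OF b(2)] by blast
    have "Q *v b = 0" using Q[OF t(1)] t(2) by simp
    then show ?case by (simp add: vec.add vec.scale step.IH)
  qed simp
  moreover have "T *v v = 0 *s v" using z by (simp add: T_def flip: matrix_vector_mul_assoc)
  from Q[OF this] have "Q *v v = v" by simp
  ultimately show ?thesis by simp
qed

text \<open>If \<open>F^j w\<close> has weight \<open>-K/2\<close> then \<open>i + K = 2 j\<close>,
  hence \<open>K \<le> j\<close> because \<open>j \<le> i\<close>, and the preimage is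
  \<open>F^(j-K) w\<close>, which lies \<open>K\<close> steps higher in the same string.\<close>

lemma lowering_surjective:
  assumes v: "X *v v = of_real (- (of_nat K / 2)) *s v"
  shows "\<exists>u. X *v u = of_real (of_nat K / 2) *s u \<and> mpow F K *v u = v"
  using weight_space_span[OF v]
proof (induction rule: vec.span_induct_alt)
  case base
  show ?case by (rule exI[of _ 0]) simp
next
  case (step c b v)
  then obtain i j where b: "j \<le> i" "b \<in> chain i j" "wt i j = (- (of_nat K / 2) :: real)" by blast
  then have "real (i + K) = real (2 * j)" by (simp add: wt_def field_simps)
  then have Kj: "i + K = 2 * j" by linarith
  then have "K \<le> j" using b(1) by linarith
  obtain w where w: "b = mpow F j *v w" "E *v w = 0" "H *v w = of_nat i *s w"
    using b(2) by (auto simp: chain_def)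
  have c': "mpow F (j - K) *v w \<in> chain i (j - K)" using w by (auto simp: chain_def)
  have "real i + real K = 2 * real j" using Kj by linarith
  then have "wt i (j - K) = real K / 2"
    using \<open>K \<le> j\<close> by (simp add: wt_def of_nat_diff field_simps)
  then have "X *v (mpow F (j - K) *v w) = of_real (of_nat K / 2) *s (mpow F (j - K) *v w)"
    using chain_X[OF c'] by (simp only:)
  moreover have "mpow F K *v (mpow F (j - K) *v w) = b"
    using \<open>K \<le> j\<close> by (simp add: w(1) matrix_vector_mul_assoc flip: mpow_add)
  moreover obtain u where "X *v u = of_real (of_nat K / 2) *s u" "mpow F K *v u = v" using step.IH by blast
  ultimately have "X *v (c *s (mpow F (j - K) *v w) + u) = of_real (of_nat K / 2) *s (c *s (mpow F (j - K) *v w) + u)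
      \<and> mpow F K *v (c *s (mpow F (j - K) *v w) + u) = c *s b + v"
    by (simp add: vec.add vec.scale vec.scale_right_distrib mult.commute)
  then show ?case by blast
qed

section \<open>The Casimir operator and isotypic components\<close>

definition casimir :: "complex^'n^'n" where "casimir = F ** E + X ** X + X"

lemma casimir_v: "casimir *v v = F *v (E *v v) + X *v (X *v v) + X *v v"
  by (simp add: casimir_def matrix_vector_mult_add_rdistrib matrix_vector_mul_assoc)

lemma casimir_F: "casimir *v (F *v v) = F *v (casimir *v v)"
  unfolding casimir_v EFv XFv vec.add vec.diff vec.scale
  by (simp add: vec_eq_iff XFv vec.diff)

lemma casimir_E: "casimir *v (E *v v) = E *v (casimir *v v)"
  unfolding casimir_v XEv vec.add EFv
  by (simp add: vec_eq_iff XEv vec.add)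

lemma casimir_X: "casimir *v (X *v v) = X *v (casimir *v v)"
  unfolding casimir_v vec.add XFv XEv by (simp add: vec_eq_iff XFv XEv vec.add vec.diff)

lemma casimir_chain:
  assumes "b \<in> chain i j"
  shows "casimir *v b = of_real (of_nat i / 2 * (of_nat i / 2 + 1)) *s b"
proof -
  obtain w where w: "b = mpow F j *v w" "E *v w = 0" "H *v w = of_nat i *s w"
    using assms by (auto simp: chain_def)
  note X = highest_weight_X[OF w(2,3)]
  have c: "casimir *v w = of_real (of_nat i / 2 * (of_nat i / 2 + 1)) *s w"
    unfolding casimir_v w(2) X vec.scale by (simp add: vec_eq_iff algebra_simps)
  have "casimir *v (mpow F j *v w) = of_real (of_nat i / 2 * (of_nat i / 2 + 1)) *s (mpow F j *v w)"
  proof (induction j)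
    case (Suc j)
    show ?case unfolding mpow_apply_Suc casimir_F Suc vec.scale by (rule refl)
  qed (simp only: mpow.simps matrix_vector_mul_lid c)
  then show ?thesis by (simp only: w(1))
qed

lemma casimir_eq_iff: "a \<ge> 0 \<Longrightarrow> b \<ge> 0 \<Longrightarrow> a * (a + 1) = b * (b + 1) \<longleftrightarrow> a = (b::real)"
proof
  assume "a \<ge> 0" "b \<ge> 0" "a * (a + 1) = b * (b + 1)"
  then have "(a - b) * (a + b + 1) = 0" "a + b + 1 > 0" by (simp_all add: algebra_simps)
  then show "a = b" by auto
qed simp

text \<open>In an irreducible module the vectors on which the Casimir operator takes its value at
  the highest weight vector form a non-zero submodule, hence everything. The bound on
  \<open>l\<close> is recorded because \<open>l * (l + 1)\<close> determines \<open>l\<close> only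
  among non-negative numbers; it is conditional because the component of an impossible
  \<open>l\<close> is zero.\<close>

lemma isotypic_casimir:
  assumes "v \<in> isotypic F X E l"
  shows "casimir *v v = of_real (l * (l + 1)) *s v \<and> (v \<noteq> 0 \<longrightarrow> l \<ge> 0)"
proof -
  have *: "casimir *v u = of_real (l * (l + 1)) *s u \<and> l \<ge> 0"
    if S: "sl2_irreducible F X E S" "w \<in> S" "w \<noteq> 0" "E *v w = 0" "X *v w = of_real l *s w" and u: "u \<in> S" for S w u
  proof
    have w: "H *v w = of_real (2 * l) *s w" unfolding Hv S(5) by (simp add: vec.scale_scale)
    then obtain i where "of_real (2 * l) = (of_nat i :: complex)" using highest_weight_nat[OF S(4,3)] by blast
    then have "Re (of_real (2 * l)) = Re (of_nat i)" by (rule arg_cong)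
    then show "l \<ge> 0" by simp
    let ?T = "{u \<in> S. casimir *v u = of_real (l * (l + 1)) *s u}"
    have sub: "sl2_submodule F X E S" using S(1) by (simp add: sl2_irreducible_def)
    have "sl2_submodule F X E ?T"
      unfolding sl2_submodule_def
    proof (intro conjI ballI)
      show "vec.subspace ?T"
        using sub by (intro vec.subspaceI)
          (auto simp: sl2_submodule_def vec.add vec.scale vec.scale_right_distrib vec.subspace_0 vec.subspace_add vec.subspace_scale mult.commute)
    qed (use sub in \<open>simp_all add: sl2_submodule_def casimir_F casimir_E casimir_X vec.scale\<close>)
    moreover have "casimir *v w = of_real (l * (l + 1)) *s w"
      unfolding casimir_v S(4,5) vec.scale by (simp add: vec_eq_iff algebra_simps)
    then have "?T \<noteq> {0}" using S(2,3) by auto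
    moreover have "?T \<subseteq> S" by blast
    ultimately have "?T = S" using S(1) unfolding sl2_irreducible_def by blast
    then show "casimir *v u = of_real (l * (l + 1)) *s u" using u by blast
  qed
  show ?thesis using assms unfolding isotypic_def
  proof (induction rule: vec.span_induct_alt)
    case (step c b v)
    then have "casimir *v b = of_real (l * (l + 1)) *s b \<and> l \<ge> 0" using * by blast
    then show ?case using step.IH
      by (simp only: vec.add vec.scale vec.scale_right_distrib vec.scale_left_commute) simp
  qed simp
qed

text \<open>A non-zero submodule contains some \<open>u \<noteq> 0\<close> with
  \<open>E u = 0\<close>: apply \<open>E\<close> to any of its non-zero vectors as long as the
  result is not zero. The Casimir value forces \<open>u\<close> to have the highest weight, where
  the span contains only multiples of \<open>w\<close>.\<close>

lemma chain_span_irreducible: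
  assumes w: "E *v w = 0" "H *v w = of_nat i *s w" "w \<noteq> 0"
  shows "sl2_irreducible F X E (vec.span (range (\<lambda>j. mpow F j *v w)))" (is "sl2_irreducible F X E ?S")
proof -
  have c: "mpow F j *v w \<in> chain i j" for j using w by (auto simp: chain_def)
  have cS: "mpow F j *v w \<in> ?S" for j by (rule vec.span_base) (rule rangeI)
  have sub: "sl2_submodule F X E ?S"
    unfolding sl2_submodule_def
  proof (intro conjI ballI)
    fix v assume v: "v \<in> ?S"
    show "F *v v \<in> ?S"
    proof (rule span_stable[OF _ v], safe)
      show "F *v (mpow F j *v w) \<in> ?S" for j unfolding mpow_apply_Suc[symmetric] by (rule cS)
    qed
    show "X *v v \<in> ?S"
    proof (rule span_stable[OF _ v], safe)
      show "X *v (mpow F j *v w) \<in> ?S" for j unfolding chain_X[OF c] by (rule vec.span_scale[OF cS])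
    qed
    show "E *v v \<in> ?S"
    proof (rule span_stable[OF _ v], safe)
      show "E *v (mpow F j *v w) \<in> ?S" for j
      proof (cases j)
        case 0
        then show ?thesis by (simp add: w(1) vec.span_zero)
      next
        case (Suc j')
        show ?thesis unfolding Suc chain_E_step[OF w(1,2)] by (rule vec.span_scale[OF cS])
      qed
    qed
  qed (rule vec.subspace_span)
  have "T = ?S" if T: "sl2_submodule F X E T" "T \<subseteq> ?S" "T \<noteq> {0}" for T
  proof -
    have sT: "vec.subspace T" using T(1) by (simp add: sl2_submodule_def)
    then obtain t where t: "t \<in> T" "t \<noteq> 0" using T(3) vec.subspace_0 by blast
    interpret f: sl2_triple E "- X" F by (rule flip)
    obtain m where m: "mpow E m = 0" using f.F_nilpotent by blast
    have Tm: "mpow E r *v t \<in> T" for r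
    proof (induction r)
      case (Suc r)
      then show ?case unfolding mpow_apply_Suc using T(1) by (simp add: sl2_submodule_def)
    qed (simp add: t)
    define r where "r = (LEAST r. mpow E r *v t = 0)"
    have r0: "mpow E r *v t = 0" unfolding r_def by (rule LeastI[of _ m]) (simp add: m)
    then obtain r' where r': "r = Suc r'" using t(2) by (cases r) auto
    define u where "u = mpow E r' *v t"
    have u: "u \<noteq> 0" "E *v u = 0" "u \<in> T"
      using not_less_Least[of r' "\<lambda>r. mpow E r *v t = 0"] r0 Tm
      by (auto simp: u_def r' r_def[symmetric] mpow_apply_Suc simp del: mpow.simps)
    have "u \<in> ?S" using u(3) T(2) by blast
    then have "casimir *v u = of_real (of_nat i / 2 * (of_nat i / 2 + 1)) *s u"
    proof (induction rule: vec.span_induct_alt)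
      case (step a b v)
      then have "casimir *v b = of_real (of_nat i / 2 * (of_nat i / 2 + 1)) *s b" using casimir_chain c by blast
      then show ?case using step.IH
        by (simp only: vec.add vec.scale vec.scale_right_distrib vec.scale_left_commute)
    qed simp
    then have XX: "X *v (X *v u) + X *v u = of_real (of_nat i / 2 * (of_nat i / 2 + 1)) *s u"
      unfolding casimir_v u(2) by simp
    \<comment> \<open>The Casimir equation reads \<open>(H + i + 2) (H - i) u = 0\<close>. So
      \<open>H\<close> acts on \<open>y\<close> by \<open>-i - 2\<close>, while
      \<open>E y = 0\<close> admits only natural eigenvalues; hence \<open>y = 0\<close>.\<close>
    define y where "y = H *v u - of_nat i *s u"
    have "H *v y - (- of_nat i - 2) *s y = 4 *s (X *v (X *v u) + X *v u) - (of_nat i * (of_nat i + 2)) *s u"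
      unfolding y_def Hv vec.diff vec.scale by (simp add: vec_eq_iff algebra_simps)
    also have "\<dots> = 0" unfolding XX by (simp add: vec_eq_iff field_simps)
    finally have y1: "falling H [- of_nat i - 2] y = 0" by simp
    obtain m' where m': "\<And>v. F *v (E *v v) = 0 \<Longrightarrow> falling H (map of_nat (rev [0..<m'])) v = 0"
      using falling_ker_FE by blast
    have "E *v y = 0" using HEv[of u] u(2) by (simp add: y_def vec.diff vec.scale)
    then have y2: "falling H (map of_nat (rev [0..<m'])) y = 0" by (intro m') simp
    have "- of_nat i - 2 \<noteq> (of_nat a :: complex)" for a
    proof
      assume "- of_nat i - 2 = (of_nat a :: complex)"
      then have "Re (- of_nat i - 2) = Re (of_nat a)" by (rule arg_cong)
      then show False by simp
    qed
    then have "y = 0" by (intro falling_coprime_zero[OF y1 y2]) auto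
    then have "2 *s (X *v u) = of_nat i *s u" unfolding y_def Hv by simp
    also have "\<dots> = 2 *s (of_real (of_nat i / 2) *s u)" by (simp add: vec_eq_iff)
    finally have "X *v u = of_real (of_nat i / 2) *s u" by (rule vec.scale_left_imp_eq[rotated]) simp
    from weight_proj_mat_1[OF this, of "{of_nat i / 2}"] have pu: "wproj {of_nat i / 2} *v u = u" by simp
    have "u \<in> vec.span {b \<in> range (\<lambda>j. mpow F j *v w). wproj {of_nat i / 2} *v b = b}"
      using \<open>u \<in> ?S\<close> pu by (intro mem_span_projection) (auto simp: wproj_chain[OF c])
    also have "\<dots> \<subseteq> vec.span {w}"
    proof (rule vec.span_minimal[OF _ vec.subspace_span], safe)
      fix j assume "wproj {of_nat i / 2} *v (mpow F j *v w) = mpow F j *v w"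
      then have "j = 0 \<or> mpow F j *v w = 0" by (simp add: wproj_chain[OF c] wt_def split: if_splits)
      then show "mpow F j *v w \<in> vec.span {w}"
        by (auto simp: vec.span_zero intro: vec.span_base)
    qed
    finally obtain a where a: "u = a *s w" by (auto simp: vec.span_singleton)
    then have "a \<noteq> 0" using u(1) by auto
    then have "w = inverse a *s u" by (simp add: a)
    then have "w \<in> T" using u(3) sT vec.subspace_scale by blast
    then have "mpow F j *v w \<in> T" for j
    proof (induction j)
      case (Suc j)
      then show ?case unfolding mpow_apply_Suc using T(1) by (simp add: sl2_submodule_def)
    qed simp
    then have "?S \<subseteq> T" by (intro vec.span_minimal[OF _ sT]) auto
    then show ?thesis using T(2) by blast
  qed
  moreover have "?S \<noteq> {0}" using cS[of 0] w(3) by auto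
  ultimately show ?thesis using sub unfolding sl2_irreducible_def by blast
qed

lemma chain_isotypic:
  assumes "b \<in> chain i j"
  shows "b \<in> isotypic F X E (of_nat i / 2)"
proof -
  obtain w where w: "b = mpow F j *v w" "E *v w = 0" "H *v w = of_nat i *s w"
    using assms by (auto simp: chain_def)
  show ?thesis
  proof (cases "w = 0")
    case True
    then show ?thesis by (simp add: w(1) isotypic_def vec.span_zero)
  next
    case False
    note X = highest_weight_X[OF w(2,3)]
    have "mpow F 0 *v w \<in> vec.span (range (\<lambda>j. mpow F j *v w))" "b \<in> vec.span (range (\<lambda>j. mpow F j *v w))"
      unfolding w(1) by (rule vec.span_base, rule rangeI)+
    then show ?thesis
      using chain_span_irreducible[OF w(2,3) False] w(2) False X
      unfolding isotypic_def by (intro vec.span_base) auto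
  qed
qed

text \<open>Realised as the spectral projection of the Casimir operator at
  \<open>k * (k + 1)\<close>, which singles out \<open>k\<close> among non-negative highest weights.
  Uniqueness holds because every chain lies in an isotypic component.\<close>

lemma isotypic_proj_chain:
  assumes "k \<ge> 0" "b \<in> chain i j"
  shows "isotypic_proj F X E k *v b = (if of_nat i / 2 = k then b else 0)"
proof -
  let ?R = "\<lambda>Q. \<forall>j. \<forall>v \<in> isotypic F X E j. Q *v v = (if j = k then v else 0)"
  have "vec.span {v. \<exists>l. casimir *v v = l *s v} = UNIV"
    using casimir_chain by (intro span_eigenvectors) blast
  then obtain Q :: "complex^'n^'n" where Q: "\<And>l v. casimir *v v = l *s v \<Longrightarrow> Q *v v = (if l \<in> {of_real (k * (k + 1))} then v else 0)"
    using spectral_projection_exists[of casimir "{of_real (k * (k + 1))}"] by blast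
  have RQ: "?R Q"
  proof (intro allI ballI)
    fix l v assume v: "v \<in> isotypic F X E l"
    show "Q *v v = (if l = k then v else 0)"
    proof (cases "v = 0")
      case False
      then have l: "casimir *v v = of_real (l * (l + 1)) *s v" "l \<ge> 0" using isotypic_casimir[OF v] by auto
      have "of_real (l * (l + 1)) \<in> {of_real (k * (k + 1)) :: complex} \<longleftrightarrow> l = k"
        unfolding singleton_iff of_real_eq_iff using casimir_eq_iff l(2) assms(1) by blast
      then show ?thesis unfolding Q[OF l(1)] by simp
    qed simp
  qed
  moreover have "Q' = Q" if "?R Q'" for Q'
  proof (rule matrix_eq_on_chains)
    fix i j b assume "b \<in> chain i j"
    from chain_isotypic[OF this] have "Q' *v b = (if of_nat i / 2 = k then b else 0)" "Q *v b = (if of_nat i / 2 = k then b else 0)"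
      using that RQ by blast+
    then show "Q' *v b = Q *v b" by simp
  qed
  ultimately have "?R (isotypic_proj F X E k)"
    unfolding isotypic_proj_def by (rule theI)
  then show ?thesis using chain_isotypic[OF assms(2)] by blast
qed

end

text \<open>A basis-free trace of a missing block size. In the Jordan basis, a vector that occurs in
  \<open>y\<close> and survives \<open>A^m\<close> sits \<open>m\<close> places before the end of
  its chain. It could be the first of its chain only in a block of size \<open>m + 1\<close>, so it
  is an image under \<open>A\<close>.\<close>

lemma jordan_type_kernel_image:
  assumes A: "jordan_type A ps" and m: "Suc m \<notin> set ps" and y: "mpow A (Suc m) *v y = 0"
  shows "\<exists>z. mpow A m *v y = mpow A (Suc m) *v z"
proof -
  define S where "S = {(r, j). r < length ps \<and> j < ps ! r}"
  obtain b where b: "inj_on (\<lambda>(r, j). b r j) S" "vec.independent ((\<lambda>(r, j). b r j) ` S)"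
    "vec.span ((\<lambda>(r, j). b r j) ` S) = UNIV"
    "\<forall>(r, j) \<in> S. A *v b r j = (if Suc j < ps ! r then b r (Suc j) else 0)"
    using A unfolding jordan_type_def Let_def S_def[symmetric] by blast
  have "S \<subseteq> {..<length ps} \<times> {..<Max (set ps)}"
    by (auto simp: S_def) (meson List.finite_set Max_ge nth_mem order_less_le_trans)
  then have fS: "finite S" by (rule finite_subset) simp
  have A_pow: "mpow A n *v b r j = (if j + n < ps ! r then b r (j + n) else 0)" if "(r, j) \<in> S" for n r j
  proof (induction n)
    case 0
    then show ?case using that by (simp add: S_def)
  next
    case (Suc n)
    show ?case
    proof (cases "j + n < ps ! r")
      case True
      then have "(r, j + n) \<in> S" using that by (auto simp: S_def)
      then show ?thesis unfolding mpow_apply_Suc Suc using True b(4) by fastforce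
    next
      case False
      then show ?thesis unfolding mpow_apply_Suc Suc by simp
    qed
  qed
  obtain d where d: "y = (\<Sum>(r, j)\<in>S. d r j *s b r j)"
  proof -
    have "y \<in> range (\<lambda>c. \<Sum>v\<in>(\<lambda>(r, j). b r j) ` S. c v *s v)"
      using b(3) vec.span_finite[of "(\<lambda>(r, j). b r j) ` S"] fS by auto
    then obtain c where "y = (\<Sum>v\<in>(\<lambda>(r, j). b r j) ` S. c v *s v)" by blast
    then have "y = (\<Sum>(r, j)\<in>S. c (b r j) *s b r j)"
      unfolding sum.reindex[OF b(1)] by (simp add: case_prod_unfold)
    then show ?thesis using that[of "\<lambda>r j. c (b r j)"] by blast
  qed
  \<comment> \<open>The indices whose vectors survive \<open>A^(m+1)\<close>. The map
    \<open>g\<close> sends them injectively into the basis, so the coefficients of \<open>y\<close>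
    at these indices vanish.\<close>
  define S' where "S' = {(r, j) \<in> S. j + Suc m < ps ! r}"
  define g where "g = (\<lambda>(r, j). b r (j + Suc m))"
  have "S' \<subseteq> S" by (auto simp: S'_def)
  note S' = this finite_subset[OF this fS]
  have gS: "g ` S' \<subseteq> (\<lambda>(r, j). b r j) ` S"
  proof safe
    fix r j assume "(r, j) \<in> S'"
    then have "(r, j + Suc m) \<in> S" by (auto simp: S'_def S_def)
    then show "g (r, j) \<in> (\<lambda>(r, j). b r j) ` S" unfolding g_def by force
  qed
  have g_inj: "inj_on g S'"
  proof (rule inj_onI, safe)
    fix r j r' j' assume "(r, j) \<in> S'" "(r', j') \<in> S'" and eq: "g (r, j) = g (r', j')"
    then have in_S: "(r, j + Suc m) \<in> S" "(r', j' + Suc m) \<in> S" by (auto simp: S'_def S_def)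
    have "(r, j + Suc m) = (r', j' + Suc m)"
      by (rule inj_onD[OF b(1) _ in_S]) (use eq in \<open>simp add: g_def\<close>)
    then show "r = r'" "j = j'" by simp_all
  qed
  have "0 = (\<Sum>(r, j)\<in>S. d r j *s (mpow A (Suc m) *v b r j))"
    unfolding y[symmetric] d vec.sum by (simp add: case_prod_unfold vec.scale del: mpow.simps)
  also have "\<dots> = (\<Sum>p\<in>S. if p \<in> S' then d (fst p) (snd p) *s g p else 0)"
    by (intro sum.cong refl) (auto simp: A_pow S'_def g_def simp del: mpow.simps split: if_splits)
  also have "\<dots> = (\<Sum>p\<in>S'. d (fst p) (snd p) *s g p)"
    using S'(1) by (simp add: fS sum.If_cases Int_absorb1)
  also have "\<dots> = (\<Sum>v\<in>g ` S'. (case the_inv_into S' g v of (r, j) \<Rightarrow> d r j) *s v)"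
    unfolding sum.reindex[OF g_inj]
    by (intro sum.cong refl) (simp add: the_inv_into_f_f[OF g_inj] case_prod_unfold)
  finally have z: "(\<Sum>v\<in>g ` S'. (case the_inv_into S' g v of (r, j) \<Rightarrow> d r j) *s v) = 0" by simp
  have d0: "d r j = 0" if "(r, j) \<in> S'" for r j
    using vec.independentD[OF b(2) finite_imageI[OF S'(2)] gS z, of "g (r, j)"] that
    by (simp add: the_inv_into_f_f[OF g_inj])
  define z where "z = (\<Sum>(r, j)\<in>S. if j + m < ps ! r \<and> 1 \<le> j then d r j *s b r (j - 1) else 0)"
  have "mpow A (Suc m) *v z = (\<Sum>(r, j)\<in>S. mpow A (Suc m) *v (if j + m < ps ! r \<and> 1 \<le> j then d r j *s b r (j - 1) else 0))"
    unfolding z_def vec.sum by (simp add: case_prod_unfold)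
  also have "\<dots> = (\<Sum>(r, j)\<in>S. d r j *s (mpow A m *v b r j))"
  proof (intro sum.cong refl, clarify)
    fix r j assume S: "(r, j) \<in> S"
    show "mpow A (Suc m) *v (if j + m < ps ! r \<and> 1 \<le> j then d r j *s b r (j - 1) else 0) = d r j *s (mpow A m *v b r j)"
    proof (cases "j + m < ps ! r \<and> 1 \<le> j")
      case True
      have S1: "(r, j - 1) \<in> S" using S by (auto simp: S_def)
      have "j - 1 + Suc m = j + m" using True by simp
      then have "mpow A (Suc m) *v b r (j - 1) = b r (j + m)" using True A_pow[OF S1, of "Suc m"] by metis
      then show ?thesis using True by (simp add: vec.scale A_pow[OF S] del: mpow.simps)
    next
      case False
      have "d r j = 0 \<or> \<not> j + m < ps ! r"
      proof (rule ccontr)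
        assume *: "\<not> ?thesis"
        then have "j = 0" using False by auto
        moreover have "\<not> j + Suc m < ps ! r" using d0[of r j] * S by (auto simp: S'_def)
        ultimately have "ps ! r = Suc m" using * by simp
        then show False using m S by (auto simp: S_def set_conv_nth)
      qed
      then show ?thesis using False by (auto simp: A_pow[OF S] simp del: mpow.simps)
    qed
  qed
  also have "\<dots> = mpow A m *v y"
    unfolding d vec.sum by (simp add: case_prod_unfold vec.scale)
  finally show ?thesis by metis
qed

lemma ad_eigenvector_weight:
  fixes X A :: "complex^'n^'n"
  assumes "X ** A - A ** X = mat c ** A" "X *v v = \<mu> *s v"
  shows "X *v (A *v v) = (\<mu> + c) *s (A *v v)"
proof -
  have "X ** A = A ** X + mat c ** A" using assms(1) by (simp add: algebra_simps)
  then have "X *v (A *v v) = A *v (X *v v) + mat c *v (A *v v)"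
    by (simp only: matrix_vector_mul_assoc matrix_vector_mult_add_rdistrib)
  then show ?thesis unfolding assms(2) vec.scale mat_vector_mult
    by (simp only: vec.scale_left_distrib)
qed

section \<open>Jordan parts, parity and integrality of weights\<close>

context sl2_triple
begin

lemma chain_mpow_F: "b \<in> chain i j \<Longrightarrow> mpow F m *v b \<in> chain i (j + m)"
proof (induction m)
  case (Suc m)
  then show ?case unfolding mpow_apply_Suc using chain_F by force
qed simp

lemma mpow_F_wproj: "mpow F m ** wproj {l} = wproj {l - of_nat m} ** mpow F m"
proof (rule matrix_eq_on_chains)
  fix i j b assume b: "b \<in> chain i j"
  show "(mpow F m ** wproj {l}) *v b = (wproj {l - of_nat m} ** mpow F m) *v b"
    by (auto simp: wproj_chain[OF b] wproj_chain[OF chain_mpow_F[OF b]] wt_def simp flip: matrix_vector_mul_assoc)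
qed

lemma wproj_wproj: "wproj S *v (wproj T *v v) = wproj (S \<inter> T) *v v"
  by (simp only: matrix_vector_mul_assoc wproj_mult)

text \<open>Otherwise \<open>F^i w\<close> would equal \<open>F^(i+1) z\<close>. Since
  \<open>F^i w\<close> has weight \<open>-i/2\<close>, \<open>z\<close> may be replaced by its
  component of weight \<open>(i + 2)/2\<close>. That component is killed by \<open>F^(i+2)\<close>,
  which is injective in this weight, so \<open>F^i w = 0\<close>, against the injectivity of
  \<open>F^i\<close> in weight \<open>i/2\<close>.\<close>

lemma highest_weight_part:
  assumes J: "jordan_type F ps" and w: "E *v w = 0" "H *v w = of_nat i *s w" "w \<noteq> 0"
  shows "Suc i \<in> set ps"
proof (rule ccontr)
  assume "Suc i \<notin> set ps"
  have c0: "w \<in> chain i 0" using w by (auto simp: chain_def)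
  have Fw: "mpow F (Suc i) *v w = 0" using chain_zero[OF chain_mpow_F[OF c0, of "Suc i"]] by simp
  from jordan_type_kernel_image[OF J \<open>Suc i \<notin> set ps\<close> Fw]
  obtain z where z: "mpow F i *v w = mpow F (Suc i) *v z" by blast
  let ?l = "of_nat (Suc (Suc i)) / 2 :: real"
  define z' where "z' = wproj {?l} *v z"
  have "mpow F (Suc i) *v z' = wproj {?l - of_nat (Suc i)} *v (mpow F (Suc i) *v z)"
    unfolding z'_def matrix_vector_mul_assoc mpow_F_wproj by (rule refl)
  also have "\<dots> = mpow F i *v w"
    unfolding z[symmetric] using wproj_chain[OF chain_mpow_F[OF c0, of i]] by (simp add: wt_def field_simps)
  finally have z': "mpow F (Suc i) *v z' = mpow F i *v w" .
  have "mpow F (Suc (Suc i)) *v z' = 0"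
    unfolding mpow_apply_Suc[of F "Suc i"] z' mpow_apply_Suc[symmetric] by (rule Fw)
  moreover have "X *v z' = of_real ?l *s z'"
    by (rule wproj_eigenvector) (simp add: z'_def wproj_wproj)
  ultimately have "z' = 0" by (rule lowering_injective[rotated])
  then have "mpow F i *v w = 0" using z' by simp
  then show False using lowering_injective[OF highest_weight_X[OF w(1,2)]] w(3) by blast
qed

lemma weight_chain:
  assumes "X *v v = of_real l *s v" "v \<noteq> 0"
  shows "\<exists>i j b. j \<le> i \<and> b \<in> chain i j \<and> b \<noteq> 0 \<and> wt i j = l"
proof (rule ccontr)
  assume "\<not> ?thesis"
  then have "{b. \<exists>i j. j \<le> i \<and> b \<in> chain i j \<and> wt i j = l} \<subseteq> {0}" by blast
  from vec.span_mono[OF this] weight_space_span[OF assms(1)] assms(2) show False by auto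
qed

end

text \<open>With \<open>k_weight\<close>, all weights lie in \<open>k + Z\<close>. The other case,
  in which \<open>U\<close> is zero, is settled separately in the final proof.\<close>

locale graded_sl2_triple = sl2_triple +
  fixes ps :: "nat list" and k :: real
  assumes jordan: "jordan_type F ps"
    and parity: "\<forall>p\<in>set ps. \<forall>q\<in>set ps. even p \<longleftrightarrow> even q"
    and k_nonneg: "k \<ge> 0" and k_half: "2 * k \<in> \<nat>"
    and k_weight: "\<exists>v. v \<noteq> 0 \<and> X *v v = of_real k *s v"
begin

lemma chain_part:
  assumes "b \<in> chain i j" "b \<noteq> 0"
  shows "Suc i \<in> set ps"
proof -
  obtain w where w: "b = mpow F j *v w" "E *v w = 0" "H *v w = of_nat i *s w"
    using assms(1) by (auto simp: chain_def)
  then have "w \<noteq> 0" using assms(2) by auto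
  then show ?thesis using highest_weight_part[OF jordan w(2,3)] by blast
qed

text \<open>Each weight is \<open>i/2 - j\<close> with \<open>i + 1\<close> a Jordan part, and these
  \<open>i\<close> share their parity.\<close>

lemma weights_diff_int:
  assumes "X *v v = of_real l *s v" "v \<noteq> 0" "X *v v' = of_real l' *s v'" "v' \<noteq> 0"
  shows "l - l' \<in> \<int>"
proof -
  obtain i j b where 1: "b \<in> chain i j" "b \<noteq> 0" "wt i j = l" using weight_chain[OF assms(1,2)] by blast
  obtain i' j' b' where 2: "b' \<in> chain i' j'" "b' \<noteq> 0" "wt i' j' = l'" using weight_chain[OF assms(3,4)] by blast
  have "even (Suc i) = even (Suc i')" using chain_part[OF 1(1,2)] chain_part[OF 2(1,2)] parity by blast
  then have "even (int i - int i')" by simp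
  then obtain n where n: "int i - int i' = 2 * n" by (rule evenE)
  have "real_of_int (int i - int i') = real_of_int (2 * n)" by (simp only: n)
  then have "l - l' = of_int (n - int j + int j')"
    unfolding 1(3)[symmetric] 2(3)[symmetric] wt_def by (simp add: field_simps)
  then show ?thesis by simp
qed

text \<open>A crude bound for the absolute values of weights. It bounds the degrees of
  \<open>ad x\<close>, which lets the main induction start.\<close>

definition bound :: nat where "bound = Max (insert 0 (set ps))"

lemma weight_bound:
  assumes "X *v v = of_real l *s v" "v \<noteq> 0"
  shows "\<bar>l\<bar> \<le> of_nat bound"
proof -
  obtain i j b where 1: "j \<le> i" "b \<in> chain i j" "b \<noteq> 0" "wt i j = l" using weight_chain[OF assms] by blast
  have "Suc i \<le> bound" unfolding bound_def using chain_part[OF 1(2,3)] by (intro Max_ge) auto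
  then have "real i \<le> real bound" by simp
  moreover have "real j \<le> real i" using 1(1) by simp
  ultimately show ?thesis unfolding 1(4)[symmetric] wt_def by linarith
qed

text \<open>A non-zero \<open>A\<close> sends some chain vector to a non-zero weight vector, so
  \<open>d\<close> is a difference of two weights. In this way the parity condition becomes
  integrality of the grading of the Lie algebra.\<close>

lemma ad_eigenvector_degree:
  fixes d :: real
  assumes "X ** A - A ** X = mat (of_real d) ** A" "A \<noteq> 0"
  shows "\<exists>n::int. d = of_int n \<and> n \<le> 2 * int bound"
proof -
  obtain i j b where b: "b \<in> chain i j" "A *v b \<noteq> 0"
    using matrix_eq_on_chains[of A 0] assms(2) by auto
  have "X *v (A *v b) = of_real (wt i j + d) *s (A *v b)"
    using ad_eigenvector_weight[OF assms(1) chain_X[OF b(1)]] by (simp only: of_real_add)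
  moreover have "X *v b = of_real (wt i j) *s b" "b \<noteq> 0" using chain_X b by auto
  ultimately have "wt i j + d - wt i j \<in> \<int>" "\<bar>wt i j + d\<bar> \<le> of_nat bound" "\<bar>wt i j\<bar> \<le> of_nat bound"
    using weights_diff_int[of "A *v b" "wt i j + d" b "wt i j"] weight_bound b(2) by metis+
  then have "d \<in> \<int>" "d \<le> 2 * of_nat bound" by simp_all
  then obtain n where n: "d = of_int n" by (auto elim: Ints_cases)
  then have "real_of_int n \<le> real_of_int (2 * int bound)" using \<open>d \<le> 2 * of_nat bound\<close> by simp
  then show ?thesis using n by (auto simp only: of_int_le_iff)
qed

lemma chain_weight_int:
  assumes "b \<in> chain i j" "b \<noteq> 0"
  shows "\<exists>n::int. wt i j = k + of_int n"
proof -
  obtain v where v: "v \<noteq> 0" "X *v v = of_real k *s v" using k_weight by blast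
  have "wt i j - k \<in> \<int>" using weights_diff_int[OF chain_X[OF assms(1)] assms(2) v(2,1)] .
  then obtain n where "wt i j - k = of_int n" by (auto elim: Ints_cases)
  then show ?thesis by (intro exI[of _ n]) simp
qed

lemma matrix_eq_on_nonzero_chains:
  assumes "\<And>i j b n. j \<le> i \<Longrightarrow> b \<in> chain i j \<Longrightarrow> b \<noteq> 0 \<Longrightarrow> wt i j = k + of_int n \<Longrightarrow> A *v b = B *v b"
  shows "A = (B :: complex^'a^'a)"
proof (rule matrix_eq_on_chains)
  fix i j b assume b: "j \<le> i" "b \<in> chain i j"
  show "A *v b = B *v b"
    using assms[OF b] chain_weight_int[OF b(2)] by (cases "b = 0") auto
qed

section \<open>Truncation to the weights between -k and k\<close>

definition trunc :: "complex^'a^'a" where "trunc = wproj {-k..k}"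

definition Q_hw :: "complex^'a^'a" where "Q_hw = isotypic_proj F X E k"

lemma Q_hw_chain: "b \<in> chain i j \<Longrightarrow> Q_hw *v b = (if of_nat i / 2 = k then b else 0)"
  unfolding Q_hw_def by (rule isotypic_proj_chain[OF k_nonneg])

lemma trunc_chain: "b \<in> chain i j \<Longrightarrow> trunc *v b = (if \<bar>wt i j\<bar> \<le> k then b else 0)"
  unfolding trunc_def by (auto simp: wproj_chain)

lemma trunc_weight: "X *v y = of_real l *s y \<Longrightarrow> trunc *v y = (if \<bar>l\<bar> \<le> k then y else 0)"
  using weight_proj_mat_1[of y l "{-k..k}"] by (auto simp: trunc_def abs_le_iff)

lemma trunc_idem: "trunc ** trunc = trunc"
  unfolding trunc_def wproj_mult by simp

lemma wt_F: "wt i (Suc j) = wt i j - 1"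
  by (simp add: wt_def)

text \<open>Weights lie in \<open>k + Z\<close> and \<open>F\<close> lowers by 1, so the only way
  back into the truncated space leads from weight \<open>k + 1\<close> to \<open>k\<close>.\<close>

lemma trunc_F_complement: "trunc ** F ** (mat 1 - trunc) = wproj {k} ** F ** (mat 1 - trunc)"
proof (rule matrix_eq_on_nonzero_chains)
  fix i j b n assume b: "b \<in> chain i j" and n: "wt i j = k + real_of_int n"
  note c = trunc_chain[OF b] trunc_chain[OF chain_F[OF b]] wproj_chain[OF chain_F[OF b]]
  have "n = 1" if "\<not> \<bar>k + real_of_int n\<bar> \<le> k" "\<bar>k + real_of_int n - 1\<bar> \<le> k"
  proof -
    have "real_of_int n > 0" "real_of_int n \<le> 1" using that by linarith+
    then show ?thesis by linarith
  qed
  moreover have "\<bar>k + real_of_int n - 1\<bar> \<le> k" if "k + real_of_int n - 1 = k"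
    using that k_nonneg by linarith
  ultimately show "(trunc ** F ** (mat 1 - trunc)) *v b = (wproj {k} ** F ** (mat 1 - trunc)) *v b"
    by (auto simp: c wt_F n matrix_vector_mult_diff_rdistrib simp flip: matrix_vector_mul_assoc)
qed

text \<open>As \<open>2 * k\<close> is an integer, \<open>-k\<close> also lies in
  \<open>k + Z\<close>; unit steps therefore leave the truncated space only from weight exactly
  \<open>-k\<close>.\<close>

lemma complement_F_trunc: "(mat 1 - trunc) ** F ** trunc = (mat 1 - trunc) ** F ** wproj {-k}"
proof (rule matrix_eq_on_nonzero_chains)
  fix i j b n assume b: "b \<in> chain i j" and n: "wt i j = k + real_of_int n"
  note c = trunc_chain[OF b] trunc_chain[OF chain_F[OF b]] wproj_chain[OF b]
  obtain K where K: "2 * k = of_nat K" using k_half by (auto elim: Nats_cases)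
  have "k + real_of_int n = - k" if "\<not> \<bar>k + real_of_int n - 1\<bar> \<le> k" "\<bar>k + real_of_int n\<bar> \<le> k"
  proof -
    have "real_of_int n < 1 - of_nat K" "real_of_int n \<ge> - of_nat K" using that K by linarith+
    then have "n = - int K" by linarith
    then show ?thesis using K by simp
  qed
  moreover have "\<bar>k + real_of_int n\<bar> \<le> k" if "k + real_of_int n = - k"
    using that k_nonneg by linarith
  ultimately show "((mat 1 - trunc) ** F ** trunc) *v b = ((mat 1 - trunc) ** F ** wproj {-k}) *v b"
    by (auto simp: c wt_F n matrix_vector_mult_diff_rdistrib simp flip: matrix_vector_mul_assoc)
qed

text \<open>Weight \<open>-k\<close> is the bottom of a string of highest weight \<open>k\<close>.
  This is what the restriction to \<open>U\<close> on the source side provides.\<close>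

lemma F_bottom_Q_hw: "F ** wproj {-k} ** Q_hw = 0"
proof (rule matrix_eq_on_chains)
  fix i j b assume b: "j \<le> i" "b \<in> chain i j"
  have "F *v b = 0" if "real i / 2 = k" "wt i j = - k"
  proof -
    have "i < Suc j" using that by (simp add: wt_def)
    then show ?thesis using chain_zero[OF chain_F[OF b(2)]] by simp
  qed
  then show "(F ** wproj {-k} ** Q_hw) *v b = 0 *v b"
    by (auto simp: Q_hw_chain[OF b(2)] wproj_chain[OF b(2)] simp flip: matrix_vector_mul_assoc)
qed

text \<open>\<open>F\<close> preserves isotypic components, and the one of highest weight
  \<open>k\<close> lies inside the truncated space, so nothing coming from the complement has a part
  in it. This is the target-side use of \<open>U\<close>.\<close>

lemma Q_hw_trunc_F_complement: "Q_hw ** trunc ** F ** (mat 1 - trunc) = 0"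
proof -
  have "Q_hw ** wproj {k} ** F ** (mat 1 - trunc) = 0"
  proof (rule matrix_eq_on_chains)
    fix i j b assume b: "j \<le> i" "b \<in> chain i j"
    have "\<bar>wt i j\<bar> \<le> k" if "real i / 2 = k"
      using that b(1) unfolding wt_def by (simp add: abs_le_iff)
    then show "(Q_hw ** wproj {k} ** F ** (mat 1 - trunc)) *v b = 0 *v b"
      by (auto simp: Q_hw_chain[OF chain_F[OF b(2)]] wproj_chain[OF chain_F[OF b(2)]] trunc_chain[OF b(2)]
         matrix_vector_mult_diff_rdistrib simp flip: matrix_vector_mul_assoc)
  qed
  then show ?thesis using trunc_F_complement by (simp add: matrix_mul_assoc[symmetric])
qed

lemma ad_raise_chain:
  fixes d :: real
  assumes A: "X ** A - A ** X = mat (of_real d) ** A" and b: "b \<in> chain i j"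
  shows "wproj S *v (A *v b) = (if wt i j + d \<in> S then A *v b else 0)"
  using weight_proj_mat_1[of "A *v b" "wt i j + d" S] ad_eigenvector_weight[OF A chain_X[OF b]]
  by (simp only: of_real_add)

lemma raise_top:
  assumes A: "X ** A - A ** X = mat (of_real d) ** A" and "d > 0"
  shows "trunc ** A ** wproj {k} = 0"
proof (rule matrix_eq_on_chains)
  fix i j b assume b: "b \<in> chain i j"
  show "(trunc ** A ** wproj {k}) *v b = 0 *v b"
    using \<open>d > 0\<close> by (auto simp: trunc_def wproj_chain[OF b] ad_raise_chain[OF A b] simp flip: matrix_vector_mul_assoc)
qed

lemma raise_bottom:
  assumes A: "X ** A - A ** X = mat (of_real d) ** A" and "d > 0"
  shows "wproj {-k} ** A ** trunc = 0"
proof (rule matrix_eq_on_chains)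
  fix i j b assume b: "b \<in> chain i j"
  show "(wproj {-k} ** A ** trunc) *v b = 0 *v b"
    using \<open>d > 0\<close> by (auto simp: trunc_chain[OF b] ad_raise_chain[OF A b] simp flip: matrix_vector_mul_assoc)
qed

text \<open>The bracket vanishes because \<open>b\<close> is strictly raising and \<open>P b P = 0\<close>: on the truncated space
  \<open>b u - u b\<close> can only leave it through the top, and off it only enter through the bottom.\<close>

lemma truncated_commutator_zero:
  assumes b: "X ** b - b ** X = mat (of_real d) ** b" "d > 0" "trunc ** b ** trunc = 0"
    and u: "X ** u - u ** X = mat (of_real d') ** u" "trunc ** u ** trunc = u" and dd: "d + d' \<le> 0"
  shows "b ** u - u ** b = 0"
proof (rule matrix_eq_on_chains)
  fix i j v assume v: "v \<in> chain i j"
  define l where "l = wt i j"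
  have Xv: "X *v v = of_real l *s v" unfolding l_def by (rule chain_X[OF v])
  have Xu: "X *v (u *v y) = of_real (m + d') *s (u *v y)" if "X *v y = of_real m *s y" for y m
    using ad_eigenvector_weight[OF u(1) that] by (simp only: of_real_add)
  have Xb: "X *v (b *v y) = of_real (m + d) *s (b *v y)" if "X *v y = of_real m *s y" for y m
    using ad_eigenvector_weight[OF b(1) that] by (simp only: of_real_add)
  have uu: "u *v (trunc *v y) = u *v y" "trunc *v (u *v y) = u *v y" for y
    unfolding matrix_vector_mul_assoc using u(2) trunc_idem by (metis matrix_mul_assoc)+
  have bb: "trunc *v (b *v (trunc *v y)) = 0" for y
    unfolding matrix_vector_mul_assoc using b(3) by (simp add: matrix_mul_assoc)
  have "b *v (u *v v) = u *v (b *v v)"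
  proof (cases "\<bar>l\<bar> \<le> k")
    case True
    have "u *v (b *v v) = u *v (trunc *v (b *v (trunc *v v)))" using True by (simp add: uu trunc_weight[OF Xv])
    then have ubv: "u *v (b *v v) = 0" by (simp add: bb)
    have "b *v (u *v v) = 0"
    proof (cases "\<bar>l + d'\<bar> \<le> k")
      case True2: True
      have "\<bar>l + d' + d\<bar> \<le> k" using True True2 b(2) dd by linarith
      then have "b *v (u *v v) = trunc *v (b *v (trunc *v (u *v v)))" by (simp add: uu trunc_weight[OF Xb[OF Xu[OF Xv]]])
      then show ?thesis by (simp add: bb)
    next
      case False
      then have "u *v v = 0" using uu(2)[of v] trunc_weight[OF Xu[OF Xv]] by simp
      then show ?thesis by simp
    qed
    then show ?thesis using ubv by simp
  next
    case False
    then have uv: "u *v v = 0" using uu(1)[of v] trunc_weight[OF Xv] by simp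
    have "u *v (b *v v) = 0"
    proof (cases "\<bar>l + d\<bar> \<le> k")
      case True
      then have "\<not> \<bar>l + d + d'\<bar> \<le> k" using False b(2) dd by linarith
      then show ?thesis using uu(2)[of "b *v v"] trunc_weight[OF Xu[OF Xb[OF Xv]]] by simp
    next
      case False
      then show ?thesis using uu(1)[of "b *v v"] trunc_weight[OF Xb[OF Xv]] by simp
    qed
    then show ?thesis using uv by simp
  qed
  then show "(b ** u - u ** b) *v v = 0 *v v"
    by (simp add: matrix_vector_mult_diff_rdistrib flip: matrix_vector_mul_assoc)
qed

definition F_trunc :: "complex^'a^'a" where "F_trunc = trunc ** F ** trunc"

lemma trunc_X: "trunc ** X = X ** trunc"
  unfolding trunc_def by (rule wproj_X)

lemma ad_trunc:
  assumes "X ** A - A ** X = mat c ** A"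
  shows "X ** (trunc ** A ** trunc) - (trunc ** A ** trunc) ** X = mat c ** (trunc ** A ** trunc)"
proof -
  have "X ** (trunc ** A ** trunc) = trunc ** (X ** A) ** trunc"
    by (simp add: matrix_mul_assoc trunc_X)
  moreover have "(trunc ** A ** trunc) ** X = trunc ** (A ** X) ** trunc"
    by (simp add: trunc_X flip: matrix_mul_assoc)
  ultimately have "X ** (trunc ** A ** trunc) - (trunc ** A ** trunc) ** X = trunc ** (mat c ** A) ** trunc"
    unfolding assms[symmetric] by (simp add: matrix_ring_simps)
  also have "\<dots> = mat c ** (trunc ** A ** trunc)"
    by (simp add: matrix_eq mat_vector_mult vec.scale flip: matrix_vector_mul_assoc)
  finally show ?thesis .
qed

lemma X_F: "X ** F - F ** X = mat (of_real (- 1)) ** F"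
  unfolding XF by (simp add: matrix_eq mat_vector_mult matrix_minus_vector flip: matrix_vector_mul_assoc)

text \<open>\<open>F_trunc\<close> has degree -1 for \<open>ad X\<close>, hence is nilpotent, and -1
  is not an eigenvalue of it.\<close>

lemma one_plus_F_trunc_inverse:
  "\<exists>R. R ** (mat 1 + F_trunc) = mat 1 \<and> (mat 1 + F_trunc) ** R = mat 1"
proof -
  have "X ** F_trunc - F_trunc ** X = (- 1) *\<^sub>R F_trunc"
    unfolding F_trunc_def ad_trunc[OF X_F]
    by (simp add: matrix_eq mat_vector_mult matrix_minus_vector flip: matrix_vector_mul_assoc)
  from nilpotent_if_ad_eigenvector[OF this] obtain m where m: "mpow F_trunc m = 0" by auto
  have "v = 0" if "(mat 1 + F_trunc) *v v = 0" for v
  proof -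
    have "v + F_trunc *v v = 0" using that by (simp add: matrix_vector_mult_add_rdistrib)
    then have v: "F_trunc *v v = - v" by (metis add.inverse_inverse add_eq_0_iff)
    have "mpow F_trunc n *v v = (- 1) ^ n *s v" for n
    proof (induction n)
      case (Suc n)
      show ?case unfolding mpow_apply_Suc Suc vec.scale v by simp
    qed simp
    from this[of m] show ?thesis using m by simp
  qed
  then have "inj ((*v) (mat 1 + F_trunc))"
    by (subst vec.inj_iff_eq_0) blast
  then obtain R where "R ** (mat 1 + F_trunc) = mat 1"
    using matrix_left_invertible_injective by blast
  then show ?thesis using matrix_left_right_inverse by blast
qed

text \<open>\<open>S\<close> inverts \<open>trunc + F_trunc\<close> on the truncated space. Its
  corner from weight \<open>k\<close> to weight \<open>-k\<close> is \<open>(-1)^K F^K\<close> with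
  \<open>K = 2 k\<close>, an isomorphism, and \<open>L0\<close> inverts this corner. It recovers a
  vector of weight \<open>k\<close> from the bottom component of its image under \<open>S\<close>,
  and it also serves to invert the middle block.\<close>

lemma truncated_inverse:
  "\<exists>S L0. S ** (trunc + F_trunc) = trunc \<and> (trunc + F_trunc) ** S = trunc \<and> wproj {k} ** L0 ** wproj {-k} = L0
     \<and> L0 ** S ** wproj {k} = wproj {k} \<and> wproj {-k} ** S ** L0 = wproj {-k}"
proof -
  obtain R where R: "R ** (mat 1 + F_trunc) = mat 1" "(mat 1 + F_trunc) ** R = mat 1"
    using one_plus_F_trunc_inverse by blast
  define S where "S = R ** trunc"
  have tF: "trunc + F_trunc = (mat 1 + F_trunc) ** trunc" "trunc + F_trunc = trunc ** (mat 1 + F_trunc)"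
    by (simp_all add: F_trunc_def matrix_ring_simps trunc_idem) (simp add: trunc_idem flip: matrix_mul_assoc)
  have "S ** (trunc + F_trunc) = R ** ((trunc ** trunc) ** (mat 1 + F_trunc))"
    unfolding S_def tF(2) by (simp only: matrix_mul_assoc)
  also have "\<dots> = R ** ((mat 1 + F_trunc) ** trunc)" unfolding trunc_idem tF(2)[symmetric] tF(1)[symmetric] by (rule refl)
  also have "\<dots> = trunc" by (simp add: matrix_mul_assoc R(1))
  finally have S1: "S ** (trunc + F_trunc) = trunc" .
  have "(trunc + F_trunc) ** S = trunc ** ((mat 1 + F_trunc) ** R) ** trunc"
    unfolding S_def tF(2) by (simp only: matrix_mul_assoc)
  then have S2: "(trunc + F_trunc) ** S = trunc" by (simp add: R(2) trunc_idem)
  obtain K where K: "2 * k = of_nat K" using k_half by (auto elim: Nats_cases)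
  then have k: "k = of_nat K / 2" by simp
  have XF': "X *v (mpow F n *v y) = of_real (m - of_nat n) *s (mpow F n *v y)" if "X *v y = of_real m *s y" for y m n
  proof (induction n)
    case (Suc n)
    show ?case unfolding mpow_apply_Suc XFv Suc vec.scale by (simp add: vec_eq_iff algebra_simps)
  qed (simp add: that)
  have W: "wproj {-k} *v (S *v h) = (- 1) ^ K *s (mpow F K *v h)" if h: "X *v h = of_real k *s h" for h
  proof -
    \<comment> \<open>Partial sums of the Neumann series for \<open>(1 + F_trunc)^(-1) h\<close>.
      Between weights \<open>k\<close> and \<open>-k\<close> the truncation does not interfere; it
      ends the series after \<open>K\<close> steps.\<close>
    define s where "s = (\<lambda>m. \<Sum>j\<le>m. (- 1) ^ j *s (mpow F j *v h))"
    have trF: "trunc *v (mpow F n *v h) = (if n \<le> K then mpow F n *v h else 0)" for n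
      unfolding trunc_weight[OF XF'[OF h]] using k by (auto simp: abs_le_iff)
    have FF: "F_trunc *v (mpow F n *v h) = (if Suc n \<le> K then mpow F (Suc n) *v h else 0)" for n
    proof -
      have "F_trunc *v (mpow F n *v h) = trunc *v (F *v (trunc *v (mpow F n *v h)))"
        by (simp add: F_trunc_def flip: matrix_vector_mul_assoc)
      also have "\<dots> = (if Suc n \<le> K then mpow F (Suc n) *v h else 0)"
        unfolding trF using trF[of "Suc n"] by (auto simp: mpow_apply_Suc simp del: mpow.simps)
      finally show ?thesis .
    qed
    have "(mat 1 + F_trunc) *v s m = h + (- 1) ^ m *s (F_trunc *v (mpow F m *v h))" if "m \<le> K" for m
      using that
    proof (induction m)
      case 0
      show ?case by (simp add: s_def matrix_vector_mult_add_rdistrib)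
    next
      case (Suc m)
      have "s (Suc m) = s m + (- 1) ^ Suc m *s (mpow F (Suc m) *v h)" by (simp add: s_def)
      then have "(mat 1 + F_trunc) *v s (Suc m)
          = (h + (- 1) ^ m *s (F_trunc *v (mpow F m *v h))) + ((- 1) ^ Suc m *s (mpow F (Suc m) *v h)
             + (- 1) ^ Suc m *s (F_trunc *v (mpow F (Suc m) *v h)))"
        using Suc by (simp only: vec.add vec.scale matrix_vector_mult_add_rdistrib matrix_vector_mul_lid
          vec.scale_right_distrib Suc_leD)
      also have "F_trunc *v (mpow F m *v h) = mpow F (Suc m) *v h" using FF[of m] Suc.prems by simp
      finally show ?case by (simp del: mpow.simps)
    qed
    from this[of K] have "(mat 1 + F_trunc) *v s K = h" unfolding FF by simp
    then have "R *v h = s K" using R(1) by (metis matrix_vector_mul_assoc matrix_vector_mul_lid)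
    moreover have "S *v h = R *v h" using trunc_weight[OF h] k_nonneg by (simp add: S_def flip: matrix_vector_mul_assoc)
    moreover have "wproj {-k} *v s K = (\<Sum>j\<le>K. if j = K then (- 1) ^ K *s (mpow F K *v h) else 0)"
      unfolding s_def vec.sum vec.scale
    proof (intro sum.cong refl)
      fix j
      have "wproj {-k} *v (mpow F j *v h) = (if k - of_nat j \<in> {-k} then mpow F j *v h else 0)"
        by (rule weight_proj_mat_1[OF XF'[OF h]])
      also have "\<dots> = (if j = K then mpow F j *v h else 0)" using K by auto
      finally show "(- 1) ^ j *s (wproj {-k} *v (mpow F j *v h)) = (if j = K then (- 1) ^ K *s (mpow F K *v h) else 0)"
        by simp
    qed
    ultimately show ?thesis by simp
  qed
  define V where "V = {h. X *v h = of_real k *s h}"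
  have sV: "vec.subspace V" unfolding V_def
    by (rule vec.subspaceI) (simp_all add: vec.add vec.scale vec.scale_right_distrib mult.commute)
  define f where "f = (*v) (wproj {-k} ** S)"
  have lf: "Vector_Spaces.linear (*s) (*s) f" unfolding f_def by (rule matrix_vector_mul_linear_gen)
  have fV: "f h = (- 1) ^ K *s (mpow F K *v h)" if "h \<in> V" for h
    using W that by (simp add: f_def V_def flip: matrix_vector_mul_assoc)
  have "inj_on f V"
  proof (rule inj_onI)
    fix a b assume ab: "a \<in> V" "b \<in> V" "f a = f b"
    have abV: "a - b \<in> V" using ab sV by (intro vec.subspace_diff)
    have "f (a - b) = 0" using ab(3) by (simp add: f_def vec.diff)
    then have "mpow F K *v (a - b) = 0" unfolding fV[OF abV] by (simp only: vec.scale_eq_0_iff) simp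
    moreover have "X *v (a - b) = of_real (of_nat K / 2) *s (a - b)" using abV k by (simp add: V_def)
    ultimately have "a - b = 0" by (rule lowering_injective[rotated])
    then show "a = b" by simp
  qed
  \<comment> \<open>Injectivity gives a left inverse; \<open>lowering_surjective\<close> makes
    \<open>L0\<close> an inverse on the other side as well.\<close>
  then obtain g where g: "Vector_Spaces.linear (*s) (*s) g" "\<forall>v\<in>V. g (f v) = v"
    using vec.linear_exists_left_inverse_on[OF lf sV] by blast
  define L0 where "L0 = wproj {k} ** matrix g ** wproj {-k}"
  have wV: "wproj {k} *v h = h" if "h \<in> V" for h
    using weight_proj_mat_1[of h k "{k}"] that by (simp add: V_def)
  have Vw: "wproj {k} *v y \<in> V" for y
    unfolding V_def mem_Collect_eq by (rule wproj_eigenvector) (simp add: wproj_wproj)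
  have L0f: "L0 *v y = wproj {k} *v (g (wproj {-k} *v y))" for y
    unfolding L0_def matrix_vector_mul_assoc[symmetric] matrix_works[OF g(1)] by (rule refl)
  have "wproj {k} ** L0 ** wproj {-k} = L0"
    unfolding L0_def by (simp add: matrix_mul_assoc wproj_mult) (simp add: wproj_mult flip: matrix_mul_assoc)
  moreover have "L0 ** S ** wproj {k} = wproj {k}"
  proof -
    have "L0 *v (S *v (wproj {k} *v y)) = wproj {k} *v y" for y
    proof -
      have "L0 *v (S *v (wproj {k} *v y)) = wproj {k} *v (g (f (wproj {k} *v y)))"
        unfolding L0f f_def by (simp only: matrix_vector_mul_assoc matrix_mul_assoc)
      then show ?thesis using g(2) Vw[of y] wV[OF Vw[of y]] by simp
    qed
    then show ?thesis by (simp add: matrix_eq flip: matrix_vector_mul_assoc)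
  qed
  moreover have "wproj {-k} ** S ** L0 = wproj {-k}"
  proof -
    have "f (L0 *v y) = wproj {-k} *v y" for y
    proof -
      have "X *v (wproj {-k} *v y) = of_real (-k) *s (wproj {-k} *v y)"
        by (rule wproj_eigenvector) (simp add: wproj_wproj)
      then obtain u where u: "X *v u = of_real (of_nat K / 2) *s u" "mpow F K *v u = wproj {-k} *v y"
        using lowering_surjective[of "wproj {-k} *v y" K] k by auto
      have "u \<in> V" using u(1) unfolding V_def k[symmetric] by blast
      then have uV: "(- 1) ^ K *s u \<in> V" by (rule vec.subspace_scale[OF sV])
      have fu: "f ((- 1) ^ K *s u) = wproj {-k} *v y"
        unfolding fV[OF uV] vec.scale u(2) by (simp flip: power_add power_mult_distrib mult_2)
      then have "g (wproj {-k} *v y) = (- 1) ^ K *s u" using g(2) uV by metis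
      then have "L0 *v y = (- 1) ^ K *s u" unfolding L0f using wV[OF uV] by simp
      then show ?thesis using fu by simp
    qed
    then show ?thesis by (simp add: matrix_eq f_def flip: matrix_vector_mul_assoc)
  qed
  ultimately show ?thesis using S1 S2 by blast
qed

end

section \<open>Matrices over the enveloping algebra\<close>

lemma scalar_commute: "scalar c * p = p * scalar c"
proof -
  have p: "p = (\<Sum>l\<in>Poly_Mapping.keys p. Poly_Mapping.single l (Poly_Mapping.lookup p l))"
    by (rule poly_mapping_eqI) (simp add: lookup_sum lookup_single when_def in_keys_iff)
  have s: "scalar c = Poly_Mapping.single 0 c" by (simp add: scalar_def zero_list_def)
  show ?thesis
    by (subst (1 2) p) (simp add: sum_distrib_left sum_distrib_right s mult_single mult.commute)
qed

lemma uea_scalar_commute: "uea_scalar c * y = y * uea_scalar c"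
  by transfer (simp add: scalar_commute uea_ideal_zero)

lemma uea_scalar_0: "uea_scalar 0 = 0"
  by transfer (simp add: scalar_def uea_ideal_zero)

lemma uea_scalar_add: "uea_scalar (c + d) = uea_scalar c + uea_scalar d"
  by transfer (simp add: scalar_def single_add uea_ideal_zero)

lemma uea_scalar_mult: "uea_scalar (c * d) = uea_scalar c * uea_scalar d"
  by transfer (simp add: scalar_def zero_list_def[symmetric] mult_single uea_ideal_zero)

lemma uea_scalar_uminus: "uea_scalar (- c) = - uea_scalar c"
  using uea_scalar_add[of c "- c"] by (simp add: uea_scalar_0 eq_neg_iff_add_eq_0 add.commute)

lemma uea_scalar_sum: "uea_scalar (\<Sum>i\<in>S. g i) = (\<Sum>i\<in>S. uea_scalar (g i))"
  by (induction S rule: infinite_finite_induct) (simp_all add: uea_scalar_0 uea_scalar_add)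

lemma uea_of_add: "uea_of (a + b) = uea_of a + uea_of b"
  by transfer (use rel_add in \<open>simp add: diff_diff_eq\<close>)

lemma uea_of_scale: "uea_of (c *\<^sub>C a) = uea_scalar c * uea_of a"
  by transfer (rule rel_scale)

lemma uea_of_lie: "uea_of (lie a b) = uea_of a * uea_of b - uea_of b * uea_of a"
proof -
  have "uea_of a * uea_of b - uea_of b * uea_of a = uea_of (lie a b)" by transfer (rule rel_lie)
  then show ?thesis by simp
qed

lemma uea_of_0: "uea_of 0 = 0"
  using uea_of_add[of 0 0] by simp

lemma uea_of_sum: "uea_of (\<Sum>i\<in>S. g i) = (\<Sum>i\<in>S. uea_of (g i))"
  by (induction S rule: infinite_finite_induct) (simp_all add: uea_of_0 uea_of_add)

definition smat :: "complex^'n^'m \<Rightarrow> ('g::complex_lie_algebra uea)^'n^'m" where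
  "smat A = (\<chi> r s. uea_scalar (A $ r $ s))"

lemma smat_nth: "smat A $ r $ s = uea_scalar (A $ r $ s)"
  by (simp add: smat_def)

lemma smat_mult: "smat (A ** B) = smat A ** smat B"
  by (simp add: vec_eq_iff smat_nth matrix_matrix_mult_def uea_scalar_sum uea_scalar_mult)

lemma smat_add: "smat (A + B) = smat A + smat B"
  by (simp add: vec_eq_iff smat_nth uea_scalar_add)

lemma smat_uminus: "smat (- A) = - smat A"
  by (simp add: vec_eq_iff smat_nth uea_scalar_uminus)

lemma smat_diff: "smat (A - B) = smat A - smat B"
  using smat_add[of A "- B"] by (simp add: smat_uminus)

lemma smat_0: "smat 0 = 0"
  by (simp add: vec_eq_iff smat_nth uea_scalar_0)

lemma smat_sum: "smat (\<Sum>i\<in>S. g i) = (\<Sum>i\<in>S. smat (g i))"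
  by (induction S rule: infinite_finite_induct) (simp_all add: smat_0 smat_add)

lemma smat_mat: "smat (mat c) = mat (uea_scalar c)"
  by (simp add: vec_eq_iff smat_nth mat_def uea_scalar_0)

lemma mat_mult_nth: "(mat y ** M) $ r $ s = y * M $ r $ s"
  by (simp add: matrix_matrix_mult_def mat_def if_distrib if_distribR cong: if_cong)

lemma mult_mat_nth: "(M ** mat y) $ r $ s = M $ r $ s * y"
  by (simp add: matrix_matrix_mult_def mat_def if_distrib if_distribR cong: if_cong)

lemma mat_smat_commute: "mat y ** smat A = smat A ** mat y"
  by (simp add: vec_eq_iff mat_mult_nth mult_mat_nth smat_nth uea_scalar_commute)

lemma mat_mult: "mat (y * z) = mat y ** (mat z :: 'a::semiring_1^'n^'n)"
  by (simp add: vec_eq_iff mat_mult_nth) (simp add: mat_def)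

lemma mat_add: "mat (y + z) = mat y + (mat z :: 'a::semiring_1^'n^'n)"
  by (simp add: vec_eq_iff mat_def)

lemma mat_diff: "mat (y - z) = mat y - (mat z :: 'a::ring_1^'n^'n)"
  by (simp add: vec_eq_iff mat_def)

lemma mat_sum: "mat (\<Sum>i\<in>S. g i) = (\<Sum>i\<in>S. (mat (g i) :: 'a::semiring_1^'n^'n))"
  by (induction S rule: infinite_finite_induct) (simp_all add: mat_add)

section \<open>Left ideals and congruence of matrices\<close>

lemma left_ideal_mult: "p \<in> left_ideal S \<Longrightarrow> y * p \<in> left_ideal S"
  by (induction rule: left_ideal.induct) (auto simp: distrib_left simp flip: mult.assoc intro: left_ideal.intros)

lemma left_ideal_add: "p \<in> left_ideal S \<Longrightarrow> q \<in> left_ideal S \<Longrightarrow> p + q \<in> left_ideal S"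
  by (induction rule: left_ideal.induct) (auto simp: add.assoc intro: left_ideal.intros)

lemma left_ideal_uminus: "p \<in> left_ideal S \<Longrightarrow> - p \<in> left_ideal S"
  using left_ideal_mult[of p S "- 1"] by simp

lemma left_ideal_diff: "p \<in> left_ideal S \<Longrightarrow> q \<in> left_ideal S \<Longrightarrow> p - q \<in> left_ideal S"
  using left_ideal_add[of p S "- q"] left_ideal_uminus by force

lemma left_ideal_sum: "(\<And>i. i \<in> I \<Longrightarrow> g i \<in> left_ideal S) \<Longrightarrow> (\<Sum>i\<in>I. g i) \<in> left_ideal S"
  by (induction I rule: infinite_finite_induct) (auto intro: left_ideal.intros left_ideal_add)

lemma left_ideal_generator: "s \<in> S \<Longrightarrow> s \<in> left_ideal S"
  using left_ideal.intros(2)[of s S 0 1] left_ideal.intros(1)[of S] by simp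

text \<open>\<open>S\<close> is a generating set, not the ideal. Only multiplication from the left
  respects this congruence, which dictates the order of factors in all later computations.\<close>

definition left_cong :: "'a::ring_1 set \<Rightarrow> 'a^'n^'m \<Rightarrow> 'a^'n^'m \<Rightarrow> bool" where
  "left_cong S M N \<longleftrightarrow> (\<forall>r s. M $ r $ s - N $ r $ s \<in> left_ideal S)"

lemma left_cong_refl: "left_cong S M M"
  by (simp add: left_cong_def left_ideal.intros)

lemma left_cong_sym: "left_cong S M N \<Longrightarrow> left_cong S N M"
  unfolding left_cong_def by (metis left_ideal_uminus minus_diff_eq)

lemma left_cong_trans [trans]: "left_cong S M N \<Longrightarrow> left_cong S N K \<Longrightarrow> left_cong S M K"
  unfolding left_cong_def
proof (intro allI)
  fix r s
  assume "\<forall>r s. M $ r $ s - N $ r $ s \<in> left_ideal S" "\<forall>r s. N $ r $ s - K $ r $ s \<in> left_ideal S"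
  then have "(M $ r $ s - N $ r $ s) + (N $ r $ s - K $ r $ s) \<in> left_ideal S" by (intro left_ideal_add) auto
  then show "M $ r $ s - K $ r $ s \<in> left_ideal S" by simp
qed

lemma left_cong_add: "left_cong S M N \<Longrightarrow> left_cong S M' N' \<Longrightarrow> left_cong S (M + M') (N + N')"
  by (simp add: left_cong_def add_diff_add left_ideal_add)

lemma left_cong_uminus: "left_cong S M N \<Longrightarrow> left_cong S (- M) (- N)"
  unfolding left_cong_def by (metis left_ideal_uminus minus_diff_eq minus_diff_minus vector_uminus_component)

lemma left_cong_diff: "left_cong S M N \<Longrightarrow> left_cong S M' N' \<Longrightarrow> left_cong S (M - M') (N - N')"
  using left_cong_add[of S M N "- M'" "- N'"] left_cong_uminus[of S M' N'] by simp

lemma left_cong_sum: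
  "(\<And>i. i \<in> I \<Longrightarrow> left_cong S (g i) (h i)) \<Longrightarrow> left_cong S (\<Sum>i\<in>I. g i) (\<Sum>i\<in>I. h i)"
  by (induction I rule: infinite_finite_induct) (auto intro: left_cong_refl left_cong_add)

lemma left_cong_mult: "left_cong S M N \<Longrightarrow> left_cong S (K ** M) (K ** N)"
  unfolding left_cong_def
  by (auto simp: matrix_matrix_mult_def sum_subtractf[symmetric] right_diff_distrib[symmetric]
      intro!: left_ideal_sum left_ideal_mult)

lemma left_cong_diff_zero_iff: "left_cong S M N \<longleftrightarrow> left_cong S (M - N) 0"
  by (simp add: left_cong_def)

section \<open>Truncation and dual bases\<close>

lemma trace_mat_mult: "trace (mat c ** A) = c * trace (A :: 'a::semiring_1^'n^'n)"
  by (simp add: trace_def mat_mult_nth sum_distrib_left)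

lemma mat_mult_vector: "(mat c ** A) *v v = c *s (A *v (v :: 'a::comm_semiring_1^'n))"
  by (simp add: mat_vector_mult flip: matrix_vector_mul_assoc)

lemma mat_commute: "mat c ** A = A ** mat (c :: 'a::comm_semiring_1)"
  by (simp add: vec_eq_iff mat_mult_nth mult_mat_nth mult.commute)

text \<open>The classical type enters through \<open>closed\<close>, so that gl, so, sp and the
  admissible cases of sl are treated uniformly.\<close>

locale truncated_lax = graded_sl2_triple "\<phi> f" "\<phi> x" "\<phi> e" ps k
  for \<phi> :: "'g::complex_lie_algebra \<Rightarrow> complex^'n^'n" and f x e ps k +
  fixes c :: complex and B :: "'g \<Rightarrow> 'g \<Rightarrow> complex"
    and I :: "'i set" and u u' :: "'i \<Rightarrow> 'g" and \<delta> :: "'i \<Rightarrow> real"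
  assumes rep: "faithful_rep \<phi>" and form: "B a b = c * trace (\<phi> a ** \<phi> b)"
    and closed: "trunc ** \<phi> a ** trunc \<in> range \<phi>"
    and dual: "dual_eigenbases B (range (compress \<phi> trunc)) (compress \<phi> trunc x) I u u' \<delta>"
begin

lemma inj: "inj \<phi>" and phi_add: "\<phi> (a + b) = \<phi> a + \<phi> b" and phi_scale: "\<phi> (z *\<^sub>C a) = mat z ** \<phi> a"
  and phi_lie: "\<phi> (lie a b) = \<phi> a ** \<phi> b - \<phi> b ** \<phi> a"
  using rep by (simp_all add: faithful_rep_def)

lemma phi_0: "\<phi> 0 = 0"
  using phi_add[of 0 0] by simp

lemma phi_minus: "\<phi> (- a) = - \<phi> a"
  using phi_add[of a "- a"] by (simp add: phi_0 eq_neg_iff_add_eq_0 add.commute)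

lemma phi_diff: "\<phi> (a - b) = \<phi> a - \<phi> b"
  using phi_add[of a "- b"] by (simp add: phi_minus)

lemma phi_sum: "\<phi> (\<Sum>i\<in>S. g i) = (\<Sum>i\<in>S. \<phi> (g i))"
  by (induction S rule: infinite_finite_induct) (simp_all add: phi_0 phi_add)

lemma phi_eqD: "\<phi> a = \<phi> b \<Longrightarrow> a = b"
  using inj by (rule injD)

abbreviation cut :: "'g \<Rightarrow> 'g" where "cut \<equiv> compress \<phi> trunc"

lemma phi_cut: "\<phi> (cut a) = trunc ** \<phi> a ** trunc"
  unfolding compress_def using closed by (rule f_inv_into_f)

lemma trunc_trunc: "trunc ** (trunc ** A) = trunc ** A" "(A ** trunc) ** trunc = A ** trunc"
  by (simp_all add: matrix_mul_assoc trunc_idem) (simp add: trunc_idem flip: matrix_mul_assoc)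

lemma trunc_absorb:
  assumes "trunc ** A ** trunc = A"
  shows "trunc ** A = A" "A ** trunc = A"
proof -
  have "trunc ** (trunc ** A ** trunc) = trunc ** A ** trunc"
    by (simp only: matrix_mul_assoc trunc_idem)
  then show "trunc ** A = A" unfolding assms .
  have "trunc ** A ** trunc ** trunc = trunc ** A ** trunc" by (rule trunc_trunc)
  then show "A ** trunc = A" unfolding assms .
qed

lemma cut_cut: "cut (cut a) = cut a"
  by (rule phi_eqD) (simp only: phi_cut trunc_trunc matrix_mul_assoc[symmetric] trunc_idem)

lemma cut_add: "cut (a + b) = cut a + cut b"
  by (rule phi_eqD) (simp add: phi_cut phi_add matrix_ring_simps)

lemma cut_diff: "cut (a - b) = cut a - cut b"
  using cut_add[of "a - b" b] by (simp add: algebra_simps)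

lemma cut_scale: "cut (z *\<^sub>C a) = z *\<^sub>C cut a"
  by (rule phi_eqD) (simp add: phi_cut phi_scale matrix_eq mat_vector_mult vec.scale flip: matrix_vector_mul_assoc)

lemma cut_sum: "cut (\<Sum>i\<in>S. g i) = (\<Sum>i\<in>S. cut (g i))"
proof -
  have "cut 0 = 0" using cut_add[of 0 0] by simp
  then show ?thesis by (induction S rule: infinite_finite_induct) (simp_all add: cut_add)
qed

lemma cut_lie_x: "cut (lie x a) = lie x (cut a)"
proof (rule phi_eqD)
  have "trunc ** (\<phi> x ** \<phi> a) ** trunc = \<phi> x ** (trunc ** \<phi> a ** trunc)"
    by (simp add: matrix_mul_assoc trunc_X)
  moreover have "trunc ** (\<phi> a ** \<phi> x) ** trunc = (trunc ** \<phi> a ** trunc) ** \<phi> x"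
    by (simp add: trunc_X flip: matrix_mul_assoc)
  ultimately show "\<phi> (cut (lie x a)) = \<phi> (lie x (cut a))"
    by (simp only: phi_cut phi_lie matrix_sub_ldistrib matrix_sub_rdistrib)
qed

lemma mem_range_cut: "y \<in> range cut \<longleftrightarrow> cut y = y"
  using cut_cut by (metis rangeE rangeI)

lemma B_add_left: "B (a + b) y = B a y + B b y"
  by (simp add: form phi_add matrix_ring_simps trace_add distrib_left)

lemma B_commute: "B a b = B b a"
  unfolding form by (rule arg_cong[OF trace_mul_sym])

lemma B_scale_left: "B (z *\<^sub>C a) y = z * B a y"
  by (simp add: form phi_scale trace_mat_mult flip: matrix_mul_assoc)

lemma B_0_left: "B 0 y = 0"
  using B_add_left[of 0 0 y] by simp

lemma B_0_right: "B y 0 = 0"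
  by (simp add: B_commute[of y 0] B_0_left)

lemma B_sum_left: "B (\<Sum>i\<in>S. g i) y = (\<Sum>i\<in>S. B (g i) y)"
  by (induction S rule: infinite_finite_induct) (simp_all add: B_0_left B_add_left)

lemma B_diff_left: "B (a - b) y = B a y - B b y"
  using B_add_left[of "a - b" b y] by simp

lemma B_scale_right: "B y (z *\<^sub>C a) = z * B y a"
  by (metis B_commute B_scale_left)

lemma B_lie: "B (lie a b) y = B a (lie b y)"
proof -
  have "trace (\<phi> b ** \<phi> a ** \<phi> y) = trace (\<phi> a ** \<phi> y ** \<phi> b)"
    by (metis matrix_mul_assoc trace_mul_sym)
  then show ?thesis by (simp add: form phi_lie matrix_ring_simps trace_sub)
qed

text \<open>Cyclicity of the trace. It turns the numbers \<open>B f (u i)\<close> into the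
  coordinates of the truncated \<open>f\<close> in the dual basis.\<close>

lemma B_cut: "B (cut a) b = B a (cut b)"
proof -
  have "trace (trunc ** \<phi> a ** trunc ** \<phi> b) = trace (\<phi> a ** (trunc ** \<phi> b ** trunc))"
    by (metis matrix_mul_assoc trace_mul_sym)
  then show ?thesis by (simp add: form phi_cut)
qed

lemma I_finite: "finite I" and u_inj: "inj_on u I"
  and u_span: "clie.span (u ` I) = range cut"
  and u_eigen_cut: "i \<in> I \<Longrightarrow> lie (cut x) (u i) = complex_of_real (\<delta> i) *\<^sub>C u i"
  and u'_mem: "i \<in> I \<Longrightarrow> u' i \<in> range cut"
  and u_dual: "i \<in> I \<Longrightarrow> j \<in> I \<Longrightarrow> B (u i) (u' j) = (if i = j then 1 else 0)"
  using dual unfolding dual_eigenbases_def by blast+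

lemma cut_u: "i \<in> I \<Longrightarrow> cut (u i) = u i"
  unfolding mem_range_cut[symmetric] u_span[symmetric] by (rule clie.span_base) (rule imageI)

lemma cut_u': "i \<in> I \<Longrightarrow> cut (u' i) = u' i"
  unfolding mem_range_cut[symmetric] by (rule u'_mem)

lemma trunc_u: "i \<in> I \<Longrightarrow> trunc ** \<phi> (u i) ** trunc = \<phi> (u i)"
  and trunc_u': "i \<in> I \<Longrightarrow> trunc ** \<phi> (u' i) ** trunc = \<phi> (u' i)"
  using phi_cut[of "u i"] phi_cut[of "u' i"] by (simp_all add: cut_u cut_u')

lemma expand_u: "cut y = y \<Longrightarrow> y = (\<Sum>i\<in>I. B y (u' i) *\<^sub>C u i)"
proof -
  assume "cut y = y"
  then have "y \<in> clie.span (u ` I)" unfolding u_span mem_range_cut .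
  then obtain q where "y = (\<Sum>v\<in>u ` I. q v *\<^sub>C v)"
    using clie.span_finite[of "u ` I"] I_finite by auto
  then have y: "y = (\<Sum>i\<in>I. q (u i) *\<^sub>C u i)" unfolding sum.reindex[OF u_inj] by simp
  have "B y (u' j) = q (u j)" if "j \<in> I" for j
  proof -
    have "B y (u' j) = (\<Sum>i\<in>I. if i = j then q (u i) else 0)"
      unfolding y B_sum_left B_scale_left using that by (intro sum.cong refl) (simp add: u_dual)
    then show ?thesis using that I_finite by simp
  qed
  then show ?thesis by (subst y) simp
qed

text \<open>Spanning is given for \<open>u\<close> and has to be deduced for \<open>u'\<close>. The
  remainder \<open>z\<close> is orthogonal to all \<open>u j\<close>, hence to every
  \<open>u' i\<close>, which is a combination of the \<open>u j\<close>; and these pairings are the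
  coordinates of \<open>z\<close> in the basis \<open>u\<close>.\<close>

lemma expand_u': "cut y = y \<Longrightarrow> y = (\<Sum>i\<in>I. B y (u i) *\<^sub>C u' i)"
proof -
  assume y: "cut y = y"
  define z where "z = y - (\<Sum>i\<in>I. B y (u i) *\<^sub>C u' i)"
  have cz: "cut z = z" by (simp add: z_def cut_diff cut_sum cut_scale y cut_u')
  have Bz: "B z (u j) = 0" if "j \<in> I" for j
  proof -
    have "B (u' i) (u j) = (if i = j then 1 else 0)" if "i \<in> I" for i
      using u_dual[OF \<open>j \<in> I\<close> that] B_commute by auto
    then have "(\<Sum>i\<in>I. B y (u i) * B (u' i) (u j)) = (\<Sum>i\<in>I. if i = j then B y (u i) else 0)"
      by (intro sum.cong refl) simp
    then show ?thesis using that I_finite by (simp add: z_def B_diff_left B_sum_left B_scale_left)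
  qed
  have "B z (u' i) = 0" if "i \<in> I" for i
  proof -
    have "B (\<Sum>j\<in>I. B (u' i) (u' j) *\<^sub>C u j) z = 0"
      unfolding B_sum_left B_scale_left using Bz B_commute by (intro sum.neutral) auto
    then show ?thesis using expand_u[OF cut_u'[OF that]] B_commute by metis
  qed
  then have "z = 0" using expand_u[OF cz] by simp
  then show ?thesis by (simp add: z_def)
qed

text \<open>The hypothesis grades the truncated algebra by \<open>cut x\<close>. As \<open>x\<close>
  commutes with the truncation and \<open>u i\<close> lives on the truncated space, \<open>x\<close>
  gives the same bracket.\<close>

lemma u_eigen: "i \<in> I \<Longrightarrow> lie x (u i) = complex_of_real (\<delta> i) *\<^sub>C u i"
proof -
  assume i: "i \<in> I"
  note U = trunc_absorb[OF trunc_u[OF i]]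
  have "trunc ** \<phi> x ** trunc ** \<phi> (u i) = \<phi> x ** (trunc ** (trunc ** \<phi> (u i)))"
    by (simp only: trunc_X matrix_mul_assoc)
  moreover have "\<phi> (u i) ** (trunc ** \<phi> x ** trunc) = ((\<phi> (u i) ** trunc) ** trunc) ** \<phi> x"
    by (simp only: trunc_X[symmetric] matrix_mul_assoc[symmetric])
  ultimately have "\<phi> (lie x (u i)) = \<phi> (lie (cut x) (u i))"
    by (simp only: phi_lie phi_cut U)
  then show ?thesis using u_eigen_cut[OF i] phi_eqD by metis
qed

lemma ad_degree: "lie x a = of_real d *\<^sub>C a \<Longrightarrow> \<phi> x ** \<phi> a - \<phi> a ** \<phi> x = mat (of_real d) ** \<phi> a"
  by (simp add: phi_scale flip: phi_lie)

lemma degree_int: "lie x a = of_real d *\<^sub>C a \<Longrightarrow> a \<noteq> 0 \<Longrightarrow> \<exists>n::int. d = of_int n \<and> n \<le> 2 * int bound"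
  using ad_eigenvector_degree[OF ad_degree] phi_eqD phi_0 by metis

definition d :: "'i \<Rightarrow> int" where "d i = \<lfloor>\<delta> i\<rfloor>"

lemma \<delta>_int: "i \<in> I \<Longrightarrow> \<delta> i = of_int (d i)"
proof -
  assume i: "i \<in> I"
  have "u i \<noteq> 0" using u_dual[OF i i] B_0_left by auto
  then show ?thesis using degree_int[OF u_eigen[OF i]] by (auto simp: d_def)
qed

lemma B_degree:
  assumes "lie x a = of_real p *\<^sub>C a" "lie x b = of_real q *\<^sub>C b" "B a b \<noteq> 0"
  shows "p + q = 0"
proof -
  have "B (lie a x) b = B a (lie x b)" by (rule B_lie)
  moreover have "lie a x = - lie x a"
    by (rule phi_eqD) (simp add: phi_lie phi_minus)
  ultimately have "- (of_real p * B a b) = of_real q * B a b"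
    using assms(1,2) B_diff_left[of 0 "lie x a" b] by (simp add: B_scale_left B_scale_right B_0_left)
  then have "(of_real p + of_real q) * B a b = (0::complex)" by (simp add: algebra_simps add_eq_0_iff)
  then have "of_real (p + q) = (0::complex)" using assms(3) by simp
  then show ?thesis by (simp only: of_real_eq_0_iff)
qed

lemma lie_degree:
  assumes "lie x a = of_real p *\<^sub>C a" "lie x b = of_real q *\<^sub>C b"
  shows "lie x (lie a b) = of_real (p + q) *\<^sub>C lie a b"
proof -
  have "lie x (lie a b) = lie (lie x a) b + lie a (lie x b)"
    by (rule phi_eqD) (simp add: phi_lie phi_add matrix_ring_simps)
  then show ?thesis by (simp add: assms lie_scaleC_left lie_scaleC_right scaleC_add_left)
qed

lemma cut_degree:
  assumes "lie x a = of_real p *\<^sub>C a"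
  shows "lie x (cut a) = of_real p *\<^sub>C cut a"
  unfolding cut_lie_x[symmetric] assms cut_scale by (rule refl)

lemma f_degree: "lie x f = of_real (- 1) *\<^sub>C f"
  by (rule phi_eqD) (use X_F in \<open>simp only: phi_lie phi_scale\<close>)

lemma u'_degree: "i \<in> I \<Longrightarrow> lie x (u' i) = of_real (- \<delta> i) *\<^sub>C u' i"
proof -
  assume i: "i \<in> I"
  let ?y = "lie x (u' i) + of_real (\<delta> i) *\<^sub>C u' i"
  have c: "cut ?y = ?y" by (simp add: cut_add cut_scale cut_lie_x cut_u'[OF i])
  have "B ?y (u j) = 0" if j: "j \<in> I" for j
  proof -
    have "B (lie x (u' i)) (u j) = B (lie (u j) x) (u' i)" by (metis B_lie B_commute)
    also have "lie (u j) x = (- of_real (\<delta> j)) *\<^sub>C u j"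
    proof (rule phi_eqD)
      have "\<phi> (lie (u j) x) = - \<phi> (lie x (u j))" by (simp add: phi_lie)
      then show "\<phi> (lie (u j) x) = \<phi> ((- of_real (\<delta> j)) *\<^sub>C u j)"
        unfolding u_eigen[OF j] phi_scale by (simp add: matrix_eq mat_mult_vector matrix_minus_vector)
    qed
    also have "B ((- of_real (\<delta> j)) *\<^sub>C u j) (u' i) = - of_real (\<delta> j) * B (u j) (u' i)"
      by (rule B_scale_left)
    finally show ?thesis
      using u_dual[OF j i] B_commute[of "u' i" "u j"] by (auto simp: B_add_left B_scale_left)
  qed
  then have "?y = 0" using expand_u'[OF c] by simp
  then have "lie x (u' i) = - (of_real (\<delta> i) *\<^sub>C u' i)" by (simp add: eq_neg_iff_add_eq_0)
  then show ?thesis by simp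
qed

text \<open>The two expansions have the same coefficients up to sign and transposition: this is the
  invariance of the Casimir tensor \<open>\<Sum> u i \<otimes> u' i\<close>. Both rest on the range
  of \<open>cut\<close> being closed under brackets.\<close>

lemma lie_u_coefficients:
  assumes g: "cut g = g" "i \<in> I"
  shows "lie g (u i) = (\<Sum>j\<in>I. B (lie g (u i)) (u' j) *\<^sub>C u j)"
    and "lie g (u' i) = (\<Sum>j\<in>I. - B (lie g (u j)) (u' i) *\<^sub>C u' j)"
proof -
  have cl: "cut (lie g y) = lie g y" if "cut y = y" for y
  proof (rule phi_eqD)
    have "trunc ** \<phi> g ** trunc = \<phi> g" "trunc ** \<phi> y ** trunc = \<phi> y"
      using phi_cut[of g] phi_cut[of y] unfolding g(1) that by simp_all
    note g' = trunc_absorb[OF this(1)] and y' = trunc_absorb[OF this(2)]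
    have "trunc ** (\<phi> g ** \<phi> y) ** trunc = \<phi> g ** \<phi> y"
      by (simp add: matrix_mul_assoc g') (simp add: y' flip: matrix_mul_assoc)
    moreover have "trunc ** (\<phi> y ** \<phi> g) ** trunc = \<phi> y ** \<phi> g"
      by (simp add: matrix_mul_assoc y') (simp add: g' flip: matrix_mul_assoc)
    ultimately show "\<phi> (cut (lie g y)) = \<phi> (lie g y)"
      by (simp add: phi_cut phi_lie matrix_sub_ldistrib matrix_sub_rdistrib)
  qed
  show "lie g (u i) = (\<Sum>j\<in>I. B (lie g (u i)) (u' j) *\<^sub>C u j)"
    by (rule expand_u[OF cl[OF cut_u[OF g(2)]]])
  have "lie g (u' i) = (\<Sum>j\<in>I. B (lie g (u' i)) (u j) *\<^sub>C u' j)"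
    by (rule expand_u'[OF cl[OF cut_u'[OF g(2)]]])
  moreover have "B (lie g (u' i)) (u j) = - B (lie g (u j)) (u' i)" for j
  proof -
    have "lie (u' i) g = - lie g (u' i)" by (rule phi_eqD) (simp add: phi_lie phi_minus)
    then have "B (lie g (u' i)) (u j) = - B (lie (u' i) g) (u j)"
      using B_diff_left[of 0 "lie (u' i) g" "u j"] by (simp add: B_0_left)
    also have "B (lie (u' i) g) (u j) = B (lie g (u j)) (u' i)" by (metis B_lie B_commute)
    finally show ?thesis .
  qed
  ultimately show "lie g (u' i) = (\<Sum>j\<in>I. - B (lie g (u j)) (u' i) *\<^sub>C u' j)" by simp
qed

end

section \<open>Invariance of the solutions of the Lax equation\<close>

text \<open>The coefficients are indexed by integers and vanish in negative degrees, so that no shift of the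
  index is truncated.\<close>

locale lax_solution = truncated_lax \<phi> f x e ps k c B I u u' \<delta>
  for \<phi> :: "'g::complex_lie_algebra \<Rightarrow> complex^'n^'n" and f x e ps k c B
    and I :: "'i set" and u u' \<delta> +
  fixes D :: "complex^'n^'n" and \<psi> \<Lambda> :: "int \<Rightarrow> ('g uea)^'n^'n"
  assumes D_def: "D = shift_matrix \<phi> I u u' \<delta>"
    and lax_equation: "smat (trunc + F_trunc) ** \<psi> m
        + (\<Sum>i\<in>{i\<in>I. d i \<le> 0}. mat (uea_of (u i)) ** smat (\<phi> (u' i)) ** \<psi> (m - (2 - 2 * d i)))
        + smat D ** \<psi> (m - 2) = \<Lambda> m"
    and \<psi>_neg: "m < 0 \<Longrightarrow> \<psi> m = 0"
    and \<Lambda>_top: "smat (wproj {k}) ** \<Lambda> m = \<Lambda> m"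
    and \<psi>_bottom: "smat (wproj {-k}) ** \<psi> m = (if m = 0 then smat (wproj {-k} ** Q_hw) else 0)"
    and \<psi>_trunc: "smat trunc ** \<psi> m = \<psi> m"
begin

definition gens :: "'g uea set" where
  "gens = {uea_of m - uea_scalar (B f m) | m. m \<in> ad_ge x 1}"

abbreviation cong (infix "\<approx>" 50) where "M \<approx> N \<equiv> left_cong gens M N"

abbreviation hat :: "'g \<Rightarrow> ('g uea)^'n^'n" where "hat a \<equiv> mat (uea_of a)"

definition shifted :: "'g \<Rightarrow> ('g uea)^'n^'n" where
  "shifted a = mat (uea_of a - uea_scalar (B f a))"

definition I0 :: "'i set" where "I0 = {i \<in> I. d i \<le> 0}"

abbreviation homog :: "int \<Rightarrow> 'g \<Rightarrow> bool" where
  "homog n a \<equiv> lie x a = of_real (of_int n) *\<^sub>C a"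

text \<open>The path that leaves the truncated space by \<open>a\<close> and returns by
  \<open>f\<close>, which the truncations of \<open>a\<close> and \<open>f\<close> do not
  see.\<close>

abbreviation detour :: "'g \<Rightarrow> complex^'n^'n" where
  "detour a \<equiv> trunc ** \<phi> f ** (mat 1 - trunc) ** \<phi> a ** trunc"

text \<open>The exponent of \<open>z^(-1/2)\<close> that accompanies \<open>u i\<close> in
  \<open>Y\<close>: there \<open>z^(\<delta> - 1)\<close> is
  \<open>(z^(-1/2))^(2 - 2 \<delta>)\<close>.\<close>

abbreviation p :: "'i \<Rightarrow> int" where "p i \<equiv> 2 - 2 * d i"

definition claim :: "'g \<Rightarrow> int \<Rightarrow> int \<Rightarrow> bool" where
  "claim a n m \<longleftrightarrow> shifted a ** \<psi> m + smat (trunc ** \<phi> a ** trunc) ** \<psi> (m - 2 * n) \<approx> 0"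

text \<open>The induction hypothesis. It ranges over all \<open>a\<close> and \<open>n\<close>,
  since the step for one \<open>a\<close> calls the claim for brackets with \<open>a\<close> and for
  basis elements \<open>u i\<close> of other degrees.\<close>

definition claims_below :: "int \<Rightarrow> bool" where
  "claims_below t \<longleftrightarrow>
    (\<forall>a n m. 1 \<le> n \<longrightarrow> homog n a \<longrightarrow> m - 2 * n < t \<longrightarrow> claim a n m)"

lemma claims_belowD:
  "claims_below t \<Longrightarrow> 1 \<le> n \<Longrightarrow> homog n a \<Longrightarrow> m - 2 * n < t \<Longrightarrow> claim a n m"
  unfolding claims_below_def by blast

text \<open>The bracket of \<open>y\<close> with the coefficients of \<open>Y\<close>, applied to
  the column; the constant matrices in \<open>Y\<close> contribute nothing.\<close>

abbreviation bracket_sum :: "'g \<Rightarrow> int \<Rightarrow> ('g uea)^'n^'n" where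
  "bracket_sum y m \<equiv> \<Sum>j\<in>I0. hat (lie y (u j)) ** smat (\<phi> (u' j)) ** \<psi> (m - p j)"

lemma shifted_eq: "shifted a = hat a - smat (mat (B f a))"
  by (simp add: shifted_def mat_diff smat_mat)

lemma shifted_smat: "shifted a ** smat M = smat M ** shifted a"
  unfolding shifted_def by (rule mat_smat_commute)

lemma smat_shifted: "smat M ** (shifted a ** N) = shifted a ** (smat M ** N)"
  by (simp only: matrix_mul_assoc shifted_smat)

lemma smat_smat: "smat M ** (smat M' ** N) = smat (M ** M') ** N"
  by (simp only: matrix_mul_assoc smat_mult)

lemma I0_subset: "I0 \<subseteq> I"
  by (auto simp: I0_def)

lemma f_degree_int:
  assumes "homog n a" "n \<noteq> 1"
  shows "B f a = 0"
proof (rule ccontr)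
  assume "B f a \<noteq> 0"
  from B_degree[OF f_degree assms(1) this] show False using assms(2) by simp
qed

lemma u_degree: "i \<in> I \<Longrightarrow> lie x (u i) = of_real (of_int (d i)) *\<^sub>C u i"
  using u_eigen \<delta>_int by simp

lemma u'_degree_int: "i \<in> I \<Longrightarrow> lie x (u' i) = of_real (of_int (- d i)) *\<^sub>C u' i"
  using u'_degree \<delta>_int by simp

lemma claim_hat:
  assumes "claim a n m"
  shows "hat a ** \<psi> m \<approx> smat (mat (B f a)) ** \<psi> m - smat (trunc ** \<phi> a ** trunc) ** \<psi> (m - 2 * n)"
  using assms unfolding claim_def shifted_eq
  by (subst left_cong_diff_zero_iff) (simp add: matrix_sub_rdistrib algebra_simps)

lemma expand_truncated: 
  assumes "cut y = y"
  shows "(\<Sum>i\<in>I. mat (B y (u i)) ** \<phi> (u' i)) = \<phi> y"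
  by (subst (2) expand_u'[OF assms]) (simp add: phi_sum phi_scale)

text \<open>Brackets of positive degree act by the character, and invariance of \<open>B\<close>
  turns the sum of \<open>B f (lie b (u j))\<close> times \<open>u' j\<close> into the truncation of
  \<open>[f, b]\<close>. One path in it is the detour; another leaves through weight
  \<open>-k\<close> and vanishes on \<open>U\<close>.\<close>

lemma commutator_outside:
  assumes IH: "claims_below t"
    and b: "1 \<le> n" "homog n b" "trunc ** \<phi> b ** trunc = 0" and t: "m - 2 * n = t"
  shows "bracket_sum b m \<approx> smat (detour b) ** \<psi> t"
proof -
  have deg: "lie x (lie b (u j)) = of_real (of_int (n + d j)) *\<^sub>C lie b (u j)" if "j \<in> I" for j
    using lie_degree[OF b(2) u_degree[OF that]] by simp
  have step: "hat (lie b (u j)) ** smat (\<phi> (u' j)) ** \<psi> (m - p j)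
      \<approx> smat (mat (B f (lie b (u j))) ** \<phi> (u' j)) ** \<psi> t" if j: "j \<in> I0" for j
  proof -
    have jI: "j \<in> I" using j by (simp add: I0_def)
    show ?thesis
    proof (cases "1 \<le> n + d j")
      case False
      have "\<phi> b ** \<phi> (u j) - \<phi> (u j) ** \<phi> b = 0"
        using b False by (intro truncated_commutator_zero[OF ad_degree[OF b(2)] _ _ ad_degree[OF u_degree[OF jI]] trunc_u[OF jI]]) auto
      then have "lie b (u j) = 0" by (intro phi_eqD) (simp add: phi_lie phi_0)
      then show ?thesis by (simp add: B_0_right uea_of_0 smat_0 left_cong_refl)
    next
      case True
      have "trunc ** (\<phi> b ** \<phi> (u j)) ** trunc = (trunc ** \<phi> b ** trunc) ** \<phi> (u j) ** trunc"
        by (subst trunc_absorb(1)[OF trunc_u[OF jI], symmetric]) (simp only: matrix_mul_assoc)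
      moreover have "trunc ** (\<phi> (u j) ** \<phi> b) ** trunc = trunc ** \<phi> (u j) ** (trunc ** \<phi> b ** trunc)"
        by (subst trunc_absorb(2)[OF trunc_u[OF jI], symmetric]) (simp only: matrix_mul_assoc)
      ultimately have z: "trunc ** \<phi> (lie b (u j)) ** trunc = 0"
        by (simp add: phi_lie b(3) matrix_ring_simps)
      \<comment> \<open>The claim is used at index difference \<open>t - 2\<close>, whatever
        \<open>j\<close> is; its second term drops out because the bracket has zero
        truncation.\<close>
      have "hat (lie b (u j)) ** \<psi> (m - p j) \<approx> smat (mat (B f (lie b (u j)))) ** \<psi> (m - p j)"
        using claim_hat[OF claims_belowD[OF IH True deg[OF jI], of "m - p j"]] t unfolding z by (simp add: smat_0)
      \<comment> \<open>\<open>f\<close> has degree -1 and pairs only with degree 1; in that case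
        \<open>m - p j\<close> is exactly \<open>t\<close>.\<close>
      also have "\<dots> = smat (mat (B f (lie b (u j)))) ** \<psi> t"
      proof (cases "n + d j = 1")
        case True
        then have "m - p j = t" using t by simp
        then show ?thesis by simp
      next
        case False
        then show ?thesis using f_degree_int[OF deg[OF jI]] by (simp add: smat_0)
      qed
      finally have "smat (\<phi> (u' j)) ** (hat (lie b (u j)) ** \<psi> (m - p j))
          \<approx> smat (\<phi> (u' j)) ** (smat (mat (B f (lie b (u j)))) ** \<psi> t)" by (rule left_cong_mult)
      then show ?thesis by (simp add: matrix_mul_assoc mat_smat_commute mat_commute smat_mult)
    qed
  qed
  let ?y = "cut (lie f b)"
  have "(\<Sum>j\<in>I0. smat (mat (B f (lie b (u j))) ** \<phi> (u' j)) ** \<psi> t)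
      = smat (\<Sum>j\<in>I0. mat (B f (lie b (u j))) ** \<phi> (u' j)) ** \<psi> t"
    by (simp only: smat_sum matrix_sum_left)
  also have "(\<Sum>j\<in>I0. mat (B f (lie b (u j))) ** \<phi> (u' j)) = (\<Sum>j\<in>I. mat (B f (lie b (u j))) ** \<phi> (u' j))"
  proof (rule sum.mono_neutral_left[OF I_finite I0_subset], clarify)
    fix j assume j: "j \<in> I" "j \<notin> I0"
    then have "n + d j \<noteq> 1" using b(1) by (simp add: I0_def)
    then show "mat (B f (lie b (u j))) ** \<phi> (u' j) = 0" using f_degree_int[OF deg[OF j(1)]] by simp
  qed
  also have "\<dots> = (\<Sum>j\<in>I. mat (B ?y (u j)) ** \<phi> (u' j))"
    by (intro sum.cong refl) (simp add: B_cut cut_u B_lie)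
  also have "\<dots> = \<phi> ?y" by (rule expand_truncated[OF cut_cut])
  also have "smat (\<phi> ?y) ** \<psi> t = smat (detour b) ** \<psi> t"
  proof -
    \<comment> \<open>Insert \<open>1 = trunc + (1 - trunc)\<close> between \<open>f\<close> and
      \<open>b\<close> in both products; the two parts that contain the truncation of
      \<open>b\<close> vanish.\<close>
    have y: "\<phi> ?y = detour b
        - trunc ** \<phi> b ** ((mat 1 - trunc) ** \<phi> f ** trunc) + trunc ** \<phi> f ** (trunc ** \<phi> b ** trunc) - (trunc ** \<phi> b ** trunc) ** \<phi> f ** trunc"
      unfolding phi_cut phi_lie by (simp add: matrix_ring_simps)
    have "\<phi> ?y = detour b
        - trunc ** \<phi> b ** (mat 1 - trunc) ** (\<phi> f ** wproj {-k})"
      unfolding y b(3) complement_F_trunc by (simp add: matrix_mul_assoc)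
    moreover have "smat (trunc ** \<phi> b ** (mat 1 - trunc) ** (\<phi> f ** wproj {-k})) ** \<psi> t = 0"
    proof -
      have "smat (\<phi> f ** wproj {-k}) ** \<psi> t = smat (\<phi> f) ** (smat (wproj {-k}) ** \<psi> t)"
        by (simp only: smat_mult matrix_mul_assoc)
      also have "\<dots> = 0" unfolding \<psi>_bottom
        using F_bottom_Q_hw by (simp add: smat_0 matrix_mul_assoc flip: smat_mult)
      finally have z: "smat (\<phi> f ** wproj {-k}) ** \<psi> t = 0" .
      have "smat (trunc ** \<phi> b ** (mat 1 - trunc) ** (\<phi> f ** wproj {-k})) ** \<psi> t
          = smat (trunc ** \<phi> b ** (mat 1 - trunc)) ** (smat (\<phi> f ** wproj {-k}) ** \<psi> t)"
        by (simp only: smat_mult matrix_mul_assoc)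
      then show ?thesis by (simp only: z times0_right)
    qed
    ultimately show ?thesis by (simp add: smat_diff matrix_sub_rdistrib)
  qed
  finally have rhs: "(\<Sum>j\<in>I0. smat (mat (B f (lie b (u j))) ** \<phi> (u' j)) ** \<psi> t)
      = smat (detour b) ** \<psi> t" .
  show ?thesis unfolding rhs[symmetric] by (rule left_cong_sum) (rule step)
qed

text \<open>Each bracket is expanded in the \<open>u i\<close>, with \<open>C\<close> the matrix of
  \<open>ad g\<close>. The \<open>u i\<close> of degree at most 0 stay, and their coefficients
  regroup to commutators of \<open>u' i\<close> with \<open>g\<close>. Those of positive degree are
  evaluated by induction: the character part sums to \<open>[F_trunc, g]\<close>, the remaining part
  to \<open>[D, g]\<close>.\<close>

lemma commutator_inside:
  assumes IH: "claims_below t"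
    and g: "1 \<le> n" "homog n g" "cut g = g" and t: "m - 2 * n = t"
  shows "bracket_sum g m \<approx> (\<Sum>i\<in>I0. hat (u i) ** smat (\<phi> (u' i) ** \<phi> g - \<phi> g ** \<phi> (u' i)) ** \<psi> (t - p i))
        + smat (F_trunc ** \<phi> g - \<phi> g ** F_trunc) ** \<psi> t + smat (D ** \<phi> g - \<phi> g ** D) ** \<psi> (t - 2)"
proof -
  define C where "C = (\<lambda>j i. B (lie g (u j)) (u' i))"
  let ?V = "\<lambda>j i. mat (C j i) ** \<phi> (u' j)"
  have C_zero: "C j i = 0 \<or> d i = d j + n" if "i \<in> I" "j \<in> I" for i j
  proof (rule ccontr)
    assume *: "\<not> ?thesis"
    have "of_int n + of_int (d j) + of_int (- d i) = (0::real)"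
      using * by (intro B_degree[OF lie_degree[OF g(2) u_degree[OF that(2)]] u'_degree_int[OF that(1)]]) (simp add: C_def)
    then have "real_of_int (n + d j - d i) = of_int 0" by simp
    then have "n + d j - d i = 0" by (simp only: of_int_eq_iff)
    then show False using * by simp
  qed
  have lie_u: "lie g (u j) = (\<Sum>i\<in>I. C j i *\<^sub>C u i)" if "j \<in> I" for j
    using lie_u_coefficients(1)[OF g(3) that] by (simp add: C_def)
  have lie_u': "(\<Sum>j\<in>I. ?V j i) = \<phi> (u' i) ** \<phi> g - \<phi> g ** \<phi> (u' i)" if "i \<in> I" for i
  proof -
    have "\<phi> (lie g (u' i)) = - (\<Sum>j\<in>I. ?V j i)"
      by (subst lie_u_coefficients(2)[OF g(3) that])
        (simp add: phi_sum phi_minus phi_scale C_def sum_negf)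
    then show ?thesis by (simp add: phi_lie algebra_simps add_eq_0_iff)
  qed
  have lhs: "bracket_sum g m
      = (\<Sum>j\<in>I0. \<Sum>i\<in>I. hat (u i) ** smat (?V j i) ** \<psi> (m - p j))"
  proof (rule sum.cong[OF refl])
    fix j assume "j \<in> I0"
    then have "j \<in> I" using I0_subset by blast
    have "hat (lie g (u j)) = (\<Sum>i\<in>I. hat (u i) ** smat (mat (C j i)))"
      unfolding lie_u[OF \<open>j \<in> I\<close>]
      by (simp add: uea_of_sum uea_of_scale mat_sum mat_mult smat_mat[symmetric] mat_smat_commute)
    then show "hat (lie g (u j)) ** smat (\<phi> (u' j)) ** \<psi> (m - p j)
        = (\<Sum>i\<in>I. hat (u i) ** smat (?V j i) ** \<psi> (m - p j))"
      by (simp only: matrix_sum_left smat_mult matrix_mul_assoc)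
  qed
  have term_low: "hat (u i) ** smat (?V j i) ** \<psi> (m - p j)
      = hat (u i) ** smat (?V j i) ** \<psi> (t - p i)" if "i \<in> I" "j \<in> I" for i j
  proof (cases "C j i = 0")
    case False
    then have "m - p j = t - p i" using C_zero[OF that] t by simp
    then show ?thesis by (simp only:)
  qed (simp add: smat_0)
  have low: "(\<Sum>i\<in>I0. \<Sum>j\<in>I0. hat (u i) ** smat (?V j i) ** \<psi> (m - p j))
      = (\<Sum>i\<in>I0. hat (u i) ** smat (\<phi> (u' i) ** \<phi> g - \<phi> g ** \<phi> (u' i)) ** \<psi> (t - p i))"
  proof (rule sum.cong[OF refl])
    fix i assume i: "i \<in> I0"
    then have iI: "i \<in> I" using I0_subset by blast
    have "(\<Sum>j\<in>I0. hat (u i) ** smat (?V j i) ** \<psi> (m - p j))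
        = (\<Sum>j\<in>I0. hat (u i) ** smat (?V j i) ** \<psi> (t - p i))"
      using I0_subset by (intro sum.cong refl term_low iI) blast
    \<comment> \<open>Enlarging the range adds only zeros: for \<open>j\<close> of positive degree a
      non-zero \<open>C j i\<close> would give \<open>d i = d j + n > 0\<close>, against
      \<open>i \<in> I0\<close>.\<close>
    also have "\<dots> = (\<Sum>j\<in>I. hat (u i) ** smat (?V j i) ** \<psi> (t - p i))"
    proof (rule sum.mono_neutral_left[OF I_finite I0_subset], clarify)
      fix j assume j: "j \<in> I" "j \<notin> I0"
      then have "d i \<noteq> d j + n" using i g(1) by (simp add: I0_def)
      then show "hat (u i) ** smat (?V j i) ** \<psi> (t - p i) = 0"
        using C_zero[OF iI j(1)] by (simp add: smat_0)
    qed
    also have "\<dots> = hat (u i) ** smat (\<Sum>j\<in>I. ?V j i) ** \<psi> (t - p i)"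
      by (simp only: smat_sum matrix_sum_left matrix_sum_right)
    finally show "(\<Sum>j\<in>I0. hat (u i) ** smat (?V j i) ** \<psi> (m - p j))
        = hat (u i) ** smat (\<phi> (u' i) ** \<phi> g - \<phi> g ** \<phi> (u' i)) ** \<psi> (t - p i)"
      by (simp only: lie_u'[OF iI])
  qed
  have term_high: "hat (u i) ** smat (?V j i) ** \<psi> (m - p j)
      \<approx> smat (mat (B f (u i)) ** (?V j i)) ** \<psi> t - smat (?V j i ** \<phi> (u i)) ** \<psi> (t - 2)"
    if i: "i \<in> I - I0" and j: "j \<in> I0" for i j
  proof (cases "C j i = 0")
    case True
    then show ?thesis by (simp add: smat_0 left_cong_refl)
  next
    case False
    have iI: "i \<in> I" and jI: "j \<in> I" using i j I0_subset by auto
    have dij: "d i = d j + n" using C_zero[OF iI jI] False by blast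
    have di: "1 \<le> d i" using i by (auto simp: I0_def)
    let ?m = "m - p j"
    \<comment> \<open>Below \<open>t\<close>, so the claim is available for \<open>u i\<close>; the
      drop by 2 is the factor \<open>z^(-1)\<close> that stands at \<open>D\<close>.\<close>
    have m2: "?m - 2 * d i = t - 2" using t dij by simp
    have "hat (u i) ** \<psi> ?m \<approx> smat (mat (B f (u i))) ** \<psi> ?m - smat (\<phi> (u i)) ** \<psi> (t - 2)"
      using claim_hat[OF claims_belowD[OF IH di u_degree[OF iI], of ?m]] unfolding m2 trunc_u[OF iI] by simp
    also have "smat (mat (B f (u i))) ** \<psi> ?m = smat (mat (B f (u i))) ** \<psi> t"
    proof (cases "d i = 1")
      case True
      then have "?m = t" using m2 by simp
      then show ?thesis by (simp only:)
    next
      case False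
      then show ?thesis using f_degree_int[OF u_degree[OF iI]] by (simp add: smat_0)
    qed
    finally have "smat (?V j i) ** (hat (u i) ** \<psi> ?m)
        \<approx> smat (?V j i) ** (smat (mat (B f (u i))) ** \<psi> t - smat (\<phi> (u i)) ** \<psi> (t - 2))"
      by (rule left_cong_mult)
    moreover have "smat (?V j i) ** (hat (u i) ** \<psi> ?m)
        = hat (u i) ** smat (?V j i) ** \<psi> ?m"
      by (simp only: matrix_mul_assoc mat_smat_commute)
    moreover have "smat (?V j i) ** (smat (mat (B f (u i))) ** \<psi> t - smat (\<phi> (u i)) ** \<psi> (t - 2))
        = smat (mat (B f (u i)) ** (?V j i)) ** \<psi> t - smat (?V j i ** \<phi> (u i)) ** \<psi> (t - 2)"
      unfolding mat_commute[of "B f (u i)"] by (simp only: matrix_sub_ldistrib smat_mult matrix_mul_assoc)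
    ultimately show ?thesis by simp
  qed
  have F: "(\<Sum>i\<in>I - I0. \<Sum>j\<in>I0. mat (B f (u i)) ** (?V j i)) = F_trunc ** \<phi> g - \<phi> g ** F_trunc"
  proof -
    have fu: "B f (u i) = 0 \<or> d i = 1" if "i \<in> I" for i
      using f_degree_int[OF u_degree[OF that]] by blast
    have "(\<Sum>i\<in>I - I0. \<Sum>j\<in>I0. mat (B f (u i)) ** (?V j i))
        = (\<Sum>i\<in>I - I0. \<Sum>j\<in>I. mat (B f (u i)) ** (?V j i))"
    proof (rule sum.cong[OF refl], rule sum.mono_neutral_left[OF I_finite I0_subset], rule ballI)
      fix i j assume i: "i \<in> I - I0" and j: "j \<in> I - I0"
      then have "B f (u i) = 0 \<or> C j i = 0" using fu[of i] C_zero[of i j] g(1) by (auto simp: I0_def)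
      then show "mat (B f (u i)) ** (?V j i) = 0" by auto
    qed
    also have "\<dots> = (\<Sum>i\<in>I. \<Sum>j\<in>I. mat (B f (u i)) ** (?V j i))"
    proof (rule sum.mono_neutral_left[OF I_finite Diff_subset], rule ballI)
      fix i assume i: "i \<in> I - (I - I0)"
      then have "B f (u i) = 0" using fu[of i] by (auto simp: I0_def)
      then show "(\<Sum>j\<in>I. mat (B f (u i)) ** (?V j i)) = 0" by simp
    qed
    also have "\<dots> = (\<Sum>i\<in>I. mat (B f (u i)) ** (\<phi> (u' i) ** \<phi> g - \<phi> g ** \<phi> (u' i)))"
      by (intro sum.cong refl) (simp add: lie_u' flip: matrix_sum_right)
    also have "\<dots> = (\<Sum>i\<in>I. mat (B f (u i)) ** \<phi> (u' i)) ** \<phi> g - \<phi> g ** (\<Sum>i\<in>I. mat (B f (u i)) ** \<phi> (u' i))"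
    proof -
      have "mat (B f (u i)) ** (\<phi> (u' i) ** \<phi> g - \<phi> g ** \<phi> (u' i))
          = mat (B f (u i)) ** \<phi> (u' i) ** \<phi> g - \<phi> g ** (mat (B f (u i)) ** \<phi> (u' i))" for i
        unfolding matrix_sub_ldistrib matrix_mul_assoc mat_commute[of "B f (u i)" "\<phi> g"] by (rule refl)
      then show ?thesis by (simp only: matrix_sum_left matrix_sum_right sum_subtractf)
    qed
    also have "(\<Sum>i\<in>I. mat (B f (u i)) ** \<phi> (u' i)) = \<phi> (cut f)"
      unfolding expand_truncated[OF cut_cut, of f, symmetric]
      by (intro sum.cong refl) (simp add: B_cut cut_u)
    also have "\<phi> (cut f) = F_trunc" unfolding phi_cut F_trunc_def by (rule refl)
    finally show ?thesis .
  qed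
  txt \<open>By invariance of the Casimir tensor the terms with both degrees positive cancel in \<open>[D, g]\<close>.\<close>
  have high_D: "- (\<Sum>i\<in>I - I0. \<Sum>j\<in>I0. ?V j i ** \<phi> (u i)) = D ** \<phi> g - \<phi> g ** D"
  proof -
    have "{i \<in> I. \<delta> i \<ge> 1} = I - I0" using \<delta>_int by (auto simp: I0_def)
    then have D: "D = - (\<Sum>i\<in>I - I0. \<phi> (u' i) ** \<phi> (u i))" by (simp add: D_def shift_matrix_def)
    have "\<phi> g ** D - D ** \<phi> g = (\<Sum>i\<in>I - I0. \<phi> (u' i) ** \<phi> (u i) ** \<phi> g - \<phi> g ** (\<phi> (u' i) ** \<phi> (u i)))"
      unfolding D by (simp add: matrix_sum_left matrix_sum_right matrix_minus_left matrix_minus_right sum_subtractf)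
    also have "\<dots> = (\<Sum>i\<in>I - I0. (\<phi> (u' i) ** \<phi> g - \<phi> g ** \<phi> (u' i)) ** \<phi> (u i) - \<phi> (u' i) ** \<phi> (lie g (u i)))"
      by (intro sum.cong refl) (simp add: phi_lie matrix_ring_simps)
    also have "\<dots> = (\<Sum>i\<in>I - I0. \<Sum>j\<in>I. ?V j i ** \<phi> (u i))
        - (\<Sum>j\<in>I - I0. \<Sum>i\<in>I. ?V j i ** \<phi> (u i))"
    proof -
      have "(\<phi> (u' i) ** \<phi> g - \<phi> g ** \<phi> (u' i)) ** \<phi> (u i) = (\<Sum>j\<in>I. ?V j i ** \<phi> (u i))" if "i \<in> I" for i
        unfolding lie_u'[OF that, symmetric] by (rule matrix_sum_left)
      moreover have "\<phi> (u' j) ** \<phi> (lie g (u j)) = (\<Sum>i\<in>I. ?V j i ** \<phi> (u i))" if "j \<in> I" for j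
      proof -
        have "\<phi> (u' j) ** (mat (C j i) ** \<phi> (u i)) = ?V j i ** \<phi> (u i)" for i
          by (simp only: matrix_mul_assoc mat_commute[of "C j i" "\<phi> (u' j)"])
        then show ?thesis unfolding lie_u[OF that] phi_sum phi_scale matrix_sum_right by simp
      qed
      ultimately show ?thesis by (simp add: sum_subtractf cong: sum.cong_simp)
    qed
    also have "(\<Sum>j\<in>I - I0. \<Sum>i\<in>I. ?V j i ** \<phi> (u i))
        = (\<Sum>j\<in>I - I0. \<Sum>i\<in>I - I0. ?V j i ** \<phi> (u i))"
    proof (rule sum.cong[OF refl], rule sum.mono_neutral_right[OF I_finite Diff_subset], rule ballI)
      fix j i assume j: "j \<in> I - I0" and i: "i \<in> I - (I - I0)"
      then have "C j i = 0" using C_zero[of i j] g(1) by (auto simp: I0_def)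
      then show "?V j i ** \<phi> (u i) = 0" by simp
    qed
    also have "\<dots> = (\<Sum>i\<in>I - I0. \<Sum>j\<in>I - I0. ?V j i ** \<phi> (u i))" by (rule sum.swap)
    also have "(\<Sum>i\<in>I - I0. \<Sum>j\<in>I. ?V j i ** \<phi> (u i)) - \<dots>
        = (\<Sum>i\<in>I - I0. \<Sum>j\<in>I0. ?V j i ** \<phi> (u i))"
      by (simp add: sum.subset_diff[OF I0_subset I_finite] sum.distrib)
    finally show ?thesis by (metis minus_diff_eq)
  qed
  have "(\<Sum>i\<in>I - I0. \<Sum>j\<in>I0. hat (u i) ** smat (?V j i) ** \<psi> (m - p j))
      \<approx> (\<Sum>i\<in>I - I0. \<Sum>j\<in>I0. smat (mat (B f (u i)) ** (?V j i)) ** \<psi> t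
          - smat (?V j i ** \<phi> (u i)) ** \<psi> (t - 2))"
    by (intro left_cong_sum term_high)
  also have "\<dots> = smat (\<Sum>i\<in>I - I0. \<Sum>j\<in>I0. mat (B f (u i)) ** (?V j i)) ** \<psi> t
      + smat (- (\<Sum>i\<in>I - I0. \<Sum>j\<in>I0. ?V j i ** \<phi> (u i))) ** \<psi> (t - 2)"
    by (simp only: sum_subtractf smat_sum smat_uminus matrix_sum_left matrix_minus_left add_uminus_conv_diff)
  finally have high: "(\<Sum>i\<in>I - I0. \<Sum>j\<in>I0. hat (u i) ** smat (?V j i) ** \<psi> (m - p j))
      \<approx> smat (F_trunc ** \<phi> g - \<phi> g ** F_trunc) ** \<psi> t + smat (D ** \<phi> g - \<phi> g ** D) ** \<psi> (t - 2)"
    unfolding F high_D .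
  have split: "bracket_sum g m
      = (\<Sum>i\<in>I0. hat (u i) ** smat (\<phi> (u' i) ** \<phi> g - \<phi> g ** \<phi> (u' i)) ** \<psi> (t - p i))
        + (\<Sum>i\<in>I - I0. \<Sum>j\<in>I0. hat (u i) ** smat (?V j i) ** \<psi> (m - p j))"
    unfolding lhs low[symmetric] sum.subset_diff[OF I0_subset I_finite] sum.distrib
    by (rule trans[OF arg_cong2[where f = "(+)", OF sum.swap sum.swap] add.commute])
  show ?thesis unfolding split add.assoc by (rule left_cong_add[OF left_cong_refl high])
qed

lemma cut_part:
  assumes "homog n a"
  shows "homog n (cut a)"
    and "homog n (a - cut a)"
    and "trunc ** \<phi> (a - cut a) ** trunc = 0"
proof -
  show 1: "homog n (cut a)" by (rule cut_degree[OF assms])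
  have "lie x (a - cut a) = lie x a - lie x (cut a)"
    by (rule phi_eqD) (simp add: phi_lie phi_diff matrix_ring_simps)
  then show "homog n (a - cut a)"
    by (simp add: assms 1 clie.scale_right_diff_distrib)
  show "trunc ** \<phi> (a - cut a) ** trunc = 0"
    using phi_cut[of "a - cut a"] by (simp add: cut_diff cut_cut phi_0)
qed

lemma commutator:
  assumes IH: "claims_below t"
    and a: "1 \<le> n" "homog n a" and t: "m - 2 * n = t"
  shows "bracket_sum a m \<approx> (\<Sum>i\<in>I0. hat (u i) ** smat (\<phi> (u' i) ** \<phi> (cut a) - \<phi> (cut a) ** \<phi> (u' i)) ** \<psi> (t - p i))
        + smat (F_trunc ** \<phi> (cut a) - \<phi> (cut a) ** F_trunc) ** \<psi> t
        + smat (D ** \<phi> (cut a) - \<phi> (cut a) ** D) ** \<psi> (t - 2)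
        + smat (detour a) ** \<psi> t"
proof -
  let ?b = "a - cut a"
  have R: "detour ?b = detour a"
  proof -
    have "(mat 1 - trunc) ** (trunc ** \<phi> a ** trunc) = 0"
      by (simp add: matrix_sub_rdistrib matrix_mul_assoc trunc_idem)
    then have "(mat 1 - trunc) ** \<phi> ?b = (mat 1 - trunc) ** \<phi> a"
      by (simp add: phi_diff phi_cut matrix_sub_ldistrib)
    then show ?thesis by (simp only: matrix_mul_assoc[symmetric])
  qed
  have split: "hat (lie a y) = hat (lie (cut a) y) + hat (lie ?b y)" for y
  proof -
    have "lie a y = lie (cut a) y + lie ?b y"
      by (rule phi_eqD) (simp add: phi_lie phi_add phi_diff matrix_ring_simps)
    then show ?thesis by (simp add: uea_of_add mat_add)
  qed
  have sum: "bracket_sum a m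
      = bracket_sum (cut a) m + bracket_sum ?b m"
    unfolding sum.distrib[symmetric] matrix_add_rdistrib[symmetric] split[symmetric] by (rule refl)
  have inside: "bracket_sum (cut a) m
      \<approx> (\<Sum>i\<in>I0. hat (u i) ** smat (\<phi> (u' i) ** \<phi> (cut a) - \<phi> (cut a) ** \<phi> (u' i)) ** \<psi> (t - p i))
        + smat (F_trunc ** \<phi> (cut a) - \<phi> (cut a) ** F_trunc) ** \<psi> t
        + smat (D ** \<phi> (cut a) - \<phi> (cut a) ** D) ** \<psi> (t - 2)"
    by (rule commutator_inside[OF IH a(1) cut_part(1)[OF a(2)] cut_cut t])
  have outside: "bracket_sum ?b m
      \<approx> smat (detour ?b) ** \<psi> t"
    by (rule commutator_outside[OF IH a(1) cut_part(2,3)[OF a(2)] t])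
  show ?thesis unfolding sum R[symmetric] by (rule left_cong_add[OF inside outside])
qed

text \<open>\<open>E\<close> and \<open>H\<close> are the errors in the two congruences. Since
  \<open>(trunc + F_trunc) E\<close> is congruent to \<open>H\<close>, also \<open>E\<close> is
  congruent to \<open>S H\<close>. The bottom component of \<open>E\<close> is congruent to zero and
  \<open>H\<close> has weight \<open>k\<close>, so applying \<open>L0\<close> shows that
  \<open>H\<close>, and then \<open>E\<close>, is congruent to zero.\<close>

lemma induction_step:
  assumes IH: "claims_below t"
    and a: "1 \<le> n" "homog n a" and t: "m - 2 * n = t"
  shows "claim a n m \<and> shifted a ** \<Lambda> m \<approx> smat (detour a) ** \<psi> t"
proof -
  define A where "A = \<phi> (cut a)"
  have "trunc ** A ** trunc = A" using phi_cut[of "cut a"] unfolding A_def cut_cut by (rule sym)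
  note A = trunc_absorb[OF this] phi_cut[of a, folded A_def]
  define R where "R = detour a"
  define E where "E = shifted a ** \<psi> m + smat A ** \<psi> t"
  define H where "H = shifted a ** \<Lambda> m - smat R ** \<psi> t"
  have IHa: "shifted a ** \<psi> m' \<approx> - (smat A ** \<psi> (m' - 2 * n))" if "m' < m" for m'
  proof -
    have "claim a n m'" using that t by (intro claims_belowD[OF IH a]) simp
    then show ?thesis unfolding claim_def A(3) by (subst left_cong_diff_zero_iff) simp
  qed
  have step: "smat (trunc + F_trunc) ** E \<approx> H"
  proof -
    define Y1 where "Y1 = (\<lambda>m. \<Sum>i\<in>I0. hat (u i) ** smat (\<phi> (u' i)) ** \<psi> (m - p i))"
    have eq: "smat (trunc + F_trunc) ** \<psi> m + Y1 m + smat D ** \<psi> (m - 2) = \<Lambda> m" for m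
      using lax_equation[of m] by (simp only: Y1_def I0_def)
    have sum_part: "shifted a ** Y1 m \<approx> bracket_sum a m
        - (\<Sum>i\<in>I0. hat (u i) ** smat (\<phi> (u' i) ** A) ** \<psi> (t - p i))"
    proof -
      have "shifted a ** (hat (u j) ** smat (\<phi> (u' j)) ** \<psi> (m - p j))
          \<approx> hat (lie a (u j)) ** smat (\<phi> (u' j)) ** \<psi> (m - p j)
            - hat (u j) ** smat (\<phi> (u' j) ** A) ** \<psi> (t - p j)" if j: "j \<in> I0" for j
      proof -
        let ?m = "m - p j"
        have "shifted a ** hat (u j) = hat (lie a (u j)) + hat (u j) ** shifted a"
          unfolding shifted_def by (simp add: uea_of_lie algebra_simps uea_scalar_commute flip: mat_mult mat_add)
        then have "shifted a ** (hat (u j) ** smat (\<phi> (u' j)) ** \<psi> ?m)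
            = hat (lie a (u j)) ** smat (\<phi> (u' j)) ** \<psi> ?m + hat (u j) ** (shifted a ** smat (\<phi> (u' j))) ** \<psi> ?m"
          by (simp only: matrix_mul_assoc matrix_add_rdistrib)
        also have "hat (u j) ** (shifted a ** smat (\<phi> (u' j))) ** \<psi> ?m
            = (hat (u j) ** smat (\<phi> (u' j))) ** (shifted a ** \<psi> ?m)"
          by (simp only: shifted_smat matrix_mul_assoc)
        also have "hat (lie a (u j)) ** smat (\<phi> (u' j)) ** \<psi> ?m + \<dots>
            \<approx> hat (lie a (u j)) ** smat (\<phi> (u' j)) ** \<psi> ?m + (hat (u j) ** smat (\<phi> (u' j))) ** (- (smat A ** \<psi> (?m - 2 * n)))"
          using j by (intro left_cong_add left_cong_refl left_cong_mult IHa) (simp add: I0_def)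
        also have "?m - 2 * n = t - p j" using t by simp
        finally show ?thesis by (simp add: smat_mult matrix_minus_right matrix_mul_assoc)
      qed
      then show ?thesis unfolding Y1_def matrix_sum_right sum_subtractf[symmetric] by (rule left_cong_sum)
    qed
    have D_part: "shifted a ** (smat D ** \<psi> (m - 2)) \<approx> - (smat (D ** A) ** \<psi> (t - 2))"
    proof -
      have "shifted a ** (smat D ** \<psi> (m - 2)) = smat D ** (shifted a ** \<psi> (m - 2))"
        by (simp only: matrix_mul_assoc shifted_smat)
      also have "\<dots> \<approx> smat D ** (- (smat A ** \<psi> (m - 2 - 2 * n)))" by (intro left_cong_mult IHa) simp
      also have "m - 2 - 2 * n = t - 2" using t by simp
      finally show ?thesis by (simp add: smat_mult matrix_minus_right matrix_mul_assoc)
    qed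
    have "smat (trunc + F_trunc) ** E = shifted a ** (smat (trunc + F_trunc) ** \<psi> m) + smat ((trunc + F_trunc) ** A) ** \<psi> t"
      by (simp only: E_def matrix_add_ldistrib smat_mult matrix_mul_assoc shifted_smat)
    also have "smat (trunc + F_trunc) ** \<psi> m = \<Lambda> m - Y1 m - smat D ** \<psi> (m - 2)" unfolding eq[of m, symmetric] by simp
    also have "shifted a ** \<dots> + smat ((trunc + F_trunc) ** A) ** \<psi> t
        = shifted a ** \<Lambda> m - shifted a ** Y1 m - shifted a ** (smat D ** \<psi> (m - 2)) + smat ((trunc + F_trunc) ** A) ** \<psi> t"
      by (simp only: matrix_sub_ldistrib)
    also have "\<dots> \<approx> shifted a ** \<Lambda> m
        - (((\<Sum>i\<in>I0. hat (u i) ** smat (\<phi> (u' i) ** A - A ** \<phi> (u' i)) ** \<psi> (t - p i))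
            + smat (F_trunc ** A - A ** F_trunc) ** \<psi> t + smat (D ** A - A ** D) ** \<psi> (t - 2) + smat R ** \<psi> t)
           - (\<Sum>i\<in>I0. hat (u i) ** smat (\<phi> (u' i) ** A) ** \<psi> (t - p i)))
        - (- (smat (D ** A) ** \<psi> (t - 2))) + smat ((trunc + F_trunc) ** A) ** \<psi> t"
      unfolding R_def A_def
      by (intro left_cong_add left_cong_diff left_cong_refl D_part[unfolded A_def]
          left_cong_trans[OF sum_part[unfolded A_def]] commutator[OF IH a t])
    \<comment> \<open>What remains besides \<open>H\<close> is \<open>A\<close> times the left-hand
      side of the Lax equation at index \<open>t\<close>.\<close>
    also have "\<dots> = H + smat A ** \<Lambda> t"
    proof -
      have "smat A ** Y1 t = (\<Sum>i\<in>I0. hat (u i) ** smat (A ** \<phi> (u' i)) ** \<psi> (t - p i))"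
        unfolding Y1_def matrix_sum_right
      proof (rule sum.cong[OF refl])
        fix i
        show "smat A ** (hat (u i) ** smat (\<phi> (u' i)) ** \<psi> (t - p i))
            = hat (u i) ** smat (A ** \<phi> (u' i)) ** \<psi> (t - p i)"
          by (simp only: matrix_mul_assoc mat_smat_commute[symmetric] smat_mult)
      qed
      then have 1: "smat A ** \<Lambda> t = smat A ** smat (trunc + F_trunc) ** \<psi> t
          + (\<Sum>i\<in>I0. hat (u i) ** smat (A ** \<phi> (u' i)) ** \<psi> (t - p i)) + smat A ** smat D ** \<psi> (t - 2)"
        unfolding eq[of t, symmetric] by (simp only: matrix_add_ldistrib matrix_mul_assoc)
      have 2: "(trunc + F_trunc) ** A - (F_trunc ** A - A ** F_trunc) = A ** (trunc + F_trunc)"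
        by (simp add: matrix_ring_simps A(1,2))
      have 3: "smat ((trunc + F_trunc) ** A) ** \<psi> t - smat (F_trunc ** A - A ** F_trunc) ** \<psi> t = smat A ** smat (trunc + F_trunc) ** \<psi> t"
        unfolding matrix_sub_rdistrib[symmetric] smat_diff[symmetric] 2 smat_mult[of A "trunc + F_trunc"]
        by (rule refl)
      have 5: "smat (D ** A - A ** D) ** \<psi> (t - 2) = smat (D ** A) ** \<psi> (t - 2) - smat A ** smat D ** \<psi> (t - 2)"
        by (simp only: smat_diff matrix_sub_rdistrib smat_mult[of A D])
      have 4: "(\<Sum>i\<in>I0. hat (u i) ** smat (\<phi> (u' i) ** A - A ** \<phi> (u' i)) ** \<psi> (t - p i))
          = (\<Sum>i\<in>I0. hat (u i) ** smat (\<phi> (u' i) ** A) ** \<psi> (t - p i))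
            - (\<Sum>i\<in>I0. hat (u i) ** smat (A ** \<phi> (u' i)) ** \<psi> (t - p i))"
        by (simp only: smat_diff matrix_sub_ldistrib matrix_sub_rdistrib sum_subtractf)
      show ?thesis unfolding 1 3[symmetric] 4 5 H_def by (simp add: algebra_simps)
    qed
    \<comment> \<open>\<open>\<Lambda> t\<close> has weight \<open>k\<close>, and \<open>A\<close>
      raises it out of the truncated space.\<close>
    also have "smat A ** \<Lambda> t = 0"
    proof -
      have "A ** wproj {k} = trunc ** \<phi> a ** wproj {k}"
        unfolding A(3) trunc_def using k_nonneg by (simp add: wproj_mult flip: matrix_mul_assoc)
      also have "\<dots> = 0" using a(1) by (intro raise_top[OF ad_degree[OF a(2)]]) simp
      finally have "smat A ** (smat (wproj {k}) ** \<Lambda> t) = 0"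
        by (simp add: matrix_mul_assoc smat_0 flip: smat_mult)
      then show ?thesis by (simp only: \<Lambda>_top)
    qed
    finally show ?thesis by simp
  qed
  obtain S L0 where S: "S ** (trunc + F_trunc) = trunc" and L0: "wproj {k} ** L0 ** wproj {-k} = L0"
    "L0 ** S ** wproj {k} = wproj {k}"
    using truncated_inverse by blast
  have EP: "smat trunc ** E = E"
    unfolding E_def matrix_add_ldistrib smat_shifted smat_smat A(1) \<psi>_trunc by (rule refl)
  have HT: "smat (wproj {k}) ** H = H"
  proof -
    have R: "wproj {k} ** R = R"
      unfolding R_def trunc_F_complement by (simp add: matrix_mul_assoc wproj_mult)
    show ?thesis unfolding H_def matrix_sub_ldistrib smat_shifted smat_smat \<Lambda>_top R by (rule refl)
  qed
  have "smat S ** (smat (trunc + F_trunc) ** E) \<approx> smat S ** H" using step by (rule left_cong_mult)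
  then have E: "E \<approx> smat S ** H" unfolding smat_smat S EP .
  \<comment> \<open>\<open>A\<close> cannot reach weight \<open>-k\<close>, and the bottom component
    of \<open>\<psi> m\<close> is a constant matrix. The generator \<open>a - B f a\<close> commutes
    with constants and lies in the left ideal.\<close>
  have bottom: "smat (wproj {-k}) ** E \<approx> 0"
  proof -
    have "wproj {-k} ** A = wproj {-k} ** \<phi> a ** trunc"
      unfolding A(3) trunc_def using k_nonneg by (simp add: matrix_mul_assoc wproj_mult)
    also have "\<dots> = 0" using a(1) by (intro raise_bottom[OF ad_degree[OF a(2)]]) simp
    finally have z: "wproj {-k} ** A = 0" .
    have "smat (wproj {-k}) ** E = shifted a ** (smat (wproj {-k}) ** \<psi> m)"
      unfolding E_def matrix_add_ldistrib smat_shifted smat_smat z smat_0 by simp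
    also have "\<dots> \<approx> 0"
    proof -
      have "a \<in> ad_ge x 1"
        unfolding ad_ge_def using a by (intro clie.span_base) (auto intro!: exI[of _ "of_int n"])
      then have "uea_of a - uea_scalar (B f a) \<in> left_ideal gens"
        by (intro left_ideal_generator) (auto simp: gens_def)
      then have "shifted a ** smat M \<approx> 0" for M :: "complex^'n^'n"
        unfolding left_cong_def shifted_def by (simp add: mat_mult_nth smat_nth uea_scalar_commute[symmetric] left_ideal_mult)
      then show ?thesis unfolding \<psi>_bottom by (simp add: left_cong_refl)
    qed
    finally show ?thesis .
  qed
  have "smat (L0 ** wproj {-k}) ** E \<approx> smat (L0 ** wproj {-k}) ** (smat S ** H)"
    using E by (rule left_cong_mult)
  also have "\<dots> = H"
  proof -
    have "L0 ** wproj {-k} = L0"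
      by (subst (1 2) L0(1)[symmetric]) (simp add: wproj_mult flip: matrix_mul_assoc)
    then have "smat (L0 ** wproj {-k}) ** (smat S ** H) = smat (L0 ** S ** wproj {k}) ** H"
      by (simp only: smat_mult HT flip: matrix_mul_assoc)
    then show ?thesis by (simp only: L0(2) HT)
  qed
  finally have "smat (L0 ** wproj {-k}) ** E \<approx> H" .
  moreover have "smat L0 ** (smat (wproj {-k}) ** E) \<approx> smat L0 ** 0" using bottom by (rule left_cong_mult)
  then have "smat (L0 ** wproj {-k}) ** E \<approx> 0" by (simp add: smat_mult matrix_mul_assoc)
  ultimately have H0: "H \<approx> 0" by (metis left_cong_sym left_cong_trans)
  have "smat S ** H \<approx> smat S ** 0" using H0 by (rule left_cong_mult)
  then have "E \<approx> 0" using E by (simp add: left_cong_trans)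
  then have "claim a n m" unfolding claim_def E_def A(3) t .
  moreover have "shifted a ** \<Lambda> m \<approx> smat R ** \<psi> t"
    using H0 unfolding H_def by (subst left_cong_diff_zero_iff)
  ultimately show ?thesis unfolding R_def by blast
qed

lemma claim_holds:
  assumes "1 \<le> n" "homog n a"
  shows "claim a n m"
proof -
  \<comment> \<open>A non-zero \<open>a\<close> has degree \<open>n \<le> 2 * bound\<close>, so
    \<open>m - 2 * n < -b\<close> forces \<open>m < 0\<close>, and then both columns in the claim
    vanish.\<close>
  define b where "b = 4 * int bound + 1"
  have main: "claims_below (int s - b)" for s
  proof (induction s)
    case 0
    show ?case unfolding claims_below_def
    proof (intro allI impI)
      fix a n m
      assume a: "1 \<le> n" "homog n a" "m - 2 * n < int 0 - b"
      show "claim a n m"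
      proof (cases "a = 0")
        case True
        then show ?thesis
          by (simp add: B_0_right claim_def shifted_def phi_0 smat_0 uea_of_0 uea_scalar_0 left_cong_refl)
      next
        case False
        then obtain n' :: int where "real_of_int n = of_int n'" "n' \<le> 2 * int bound"
          using degree_int[OF a(2)] by blast
        then have "n \<le> 2 * int bound" by simp
        then have "m < 0" using a(3) by (simp add: b_def)
        then show ?thesis using a(1) by (simp add: claim_def \<psi>_neg left_cong_refl)
      qed
    qed
  next
    case (Suc s)
    show ?case unfolding claims_below_def
    proof (intro allI impI)
      fix a n m
      assume a: "1 \<le> n" "homog n a" "m - 2 * n < int (Suc s) - b"
      have "claims_below (m - 2 * n)"
        using Suc a(3) unfolding claims_below_def by force
      from induction_step[OF this a(1,2) refl] show "claim a n m" by blast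
    qed
  qed
  show ?thesis by (rule claims_belowD[OF main assms, of m "nat (m - 2 * n + b + 1)"]) simp
qed

lemma \<Lambda>_commutator:
  assumes "1 \<le> n" "homog n a"
  shows "shifted a ** (smat Q_hw ** \<Lambda> m) \<approx> 0"
proof -
  have "shifted a ** \<Lambda> m \<approx> smat (detour a) ** \<psi> (m - 2 * n)"
    using induction_step[OF _ assms refl] claim_holds unfolding claims_below_def by blast
  then have "smat Q_hw ** (shifted a ** \<Lambda> m)
      \<approx> smat Q_hw ** (smat (detour a) ** \<psi> (m - 2 * n))"
    by (rule left_cong_mult)
  also have "\<dots> = smat (Q_hw ** trunc ** \<phi> f ** (mat 1 - trunc) ** \<phi> a ** trunc) ** \<psi> (m - 2 * n)"
    by (simp only: matrix_mul_assoc smat_mult)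
  also have "\<dots> = 0" unfolding Q_hw_trunc_F_complement by (simp add: smat_0)
  finally show ?thesis by (simp add: matrix_mul_assoc shifted_smat)
qed

end

section \<open>Matrices of power series\<close>

definition mcoeff :: "nat \<Rightarrow> ('a::zero fps)^'n^'m \<Rightarrow> 'a^'n^'m" where
  "mcoeff m M = (\<chi> r s. fps_nth (M $ r $ s) m)"

lemma mcoeff_nth: "mcoeff m M $ r $ s = fps_nth (M $ r $ s) m"
  by (simp add: mcoeff_def)

lemma mcoeff_eqI: "(\<And>m. mcoeff m M = mcoeff m N) \<Longrightarrow> M = N"
  by (simp add: vec_eq_iff mcoeff_nth fps_eq_iff)

lemma mcoeff_add: "mcoeff m (M + N) = mcoeff m M + (mcoeff m N :: 'a::monoid_add^'n^'m)"
  by (simp add: vec_eq_iff mcoeff_nth)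

lemma mcoeff_diff: "mcoeff m (M - N) = mcoeff m M - (mcoeff m N :: 'a::group_add^'n^'m)"
  by (simp add: vec_eq_iff mcoeff_nth)

lemma mcoeff_0: "mcoeff m 0 = 0"
  by (simp add: vec_eq_iff mcoeff_nth)

lemma mcoeff_sum: "mcoeff m (\<Sum>i\<in>S. g i) = (\<Sum>i\<in>S. (mcoeff m (g i) :: 'a::comm_monoid_add^'n^'m))"
  by (induction S rule: infinite_finite_induct) (simp_all add: mcoeff_0 mcoeff_add)

lemma mcoeff_mult: "mcoeff m (M ** N) = (\<Sum>i=0..m. mcoeff i M ** (mcoeff (m - i) N :: 'a::semiring_1^'n^'k))"
proof -
  have "(mcoeff m (M ** N)) $ r $ s = (\<Sum>i=0..m. (mcoeff i M ** mcoeff (m - i) N) $ r $ s)" for r s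
  proof -
    have "(mcoeff m (M ** N)) $ r $ s = (\<Sum>p\<in>UNIV. \<Sum>i=0..m. fps_nth (M $ r $ p) i * fps_nth (N $ p $ s) (m - i))"
      by (simp add: mcoeff_nth matrix_matrix_mult_def fps_sum_nth fps_mult_nth)
    also have "\<dots> = (\<Sum>i=0..m. \<Sum>p\<in>UNIV. fps_nth (M $ r $ p) i * fps_nth (N $ p $ s) (m - i))"
      by (rule sum.swap)
    finally show ?thesis by (simp add: matrix_matrix_mult_def mcoeff_nth)
  qed
  then show ?thesis by (simp add: vec_eq_iff)
qed

text \<open>The recursion for the right inverse of a power series with constant term 1, solved
  degree by degree; \<open>a 0\<close> is taken to be 1.\<close>

fun right_inverse_coeff :: "(nat \<Rightarrow> 'a::ring_1^'n^'n) \<Rightarrow> nat \<Rightarrow> 'a^'n^'n" where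
  "right_inverse_coeff a 0 = mat 1"
| "right_inverse_coeff a (Suc m) = - (\<Sum>i\<in>{..m}. a (Suc i) ** right_inverse_coeff a (m - i))"

lemma mcoeff_mat_1: "mcoeff m (mat 1 :: ('a::semiring_1 fps)^'n^'n) = (if m = 0 then mat 1 else 0)"
  by (auto simp: vec_eq_iff mcoeff_nth mat_def)

lemma unipotent_right_inverse:
  fixes A :: "('a::ring_1 fps)^'n^'n"
  assumes "mcoeff 0 A = mat 1"
  shows "\<exists>B. A ** B = mat 1 \<and> mcoeff 0 B = mat 1"
proof -
  define b where "b = right_inverse_coeff (\<lambda>m. mcoeff m A)"
  define B :: "('a fps)^'n^'n" where "B = (\<chi> r s. Abs_fps (\<lambda>m. b m $ r $ s))"
  have B: "mcoeff m B = b m" for m by (simp add: vec_eq_iff mcoeff_nth B_def)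
  have "mcoeff m (A ** B) = mcoeff m (mat 1)" for m
  proof (cases m)
    case 0
    then show ?thesis by (simp add: mcoeff_mult B b_def assms mcoeff_mat_1)
  next
    case (Suc l)
    have "mcoeff m (A ** B) = b (Suc l) + (\<Sum>i\<in>{Suc 0..Suc l}. mcoeff i A ** b (Suc l - i))"
      unfolding mcoeff_mult B Suc by (simp add: sum.atLeast_Suc_atMost assms)
    also have "(\<Sum>i\<in>{Suc 0..Suc l}. mcoeff i A ** b (Suc l - i)) = (\<Sum>i\<in>{..l}. mcoeff (Suc i) A ** b (l - i))"
      unfolding sum.shift_bounds_cl_Suc_ivl atMost_atLeast0 by simp
    finally show ?thesis by (simp add: Suc b_def mcoeff_mat_1)
  qed
  then have "A ** B = mat 1" by (rule mcoeff_eqI)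
  moreover have "mcoeff 0 B = mat 1" by (simp add: B b_def)
  ultimately show ?thesis by blast
qed

text \<open>A right inverse \<open>B\<close> again has constant term 1 and hence a right inverse of
  its own, which must be \<open>A\<close>.\<close>

lemma unipotent_inverse:
  fixes A :: "('a::ring_1 fps)^'n^'n"
  assumes "mcoeff 0 A = mat 1"
  shows "\<exists>B. A ** B = mat 1 \<and> B ** A = mat 1"
proof -
  obtain B where B: "A ** B = mat 1" "mcoeff 0 B = mat 1" using unipotent_right_inverse[OF assms] by blast
  obtain C where C: "B ** C = mat 1" using unipotent_right_inverse[OF B(2)] by blast
  have "A = A ** (B ** C)" by (simp add: C)
  also have "\<dots> = C" by (simp add: matrix_mul_assoc B(1))
  finally show ?thesis using B(1) C by blast
qed

lemma cmat_nth: "cmat A $ r $ s = fps_const (uea_scalar (A $ r $ s))"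
  by (simp add: cmat_def)

lemma mcoeff_cmat: "mcoeff m (cmat A) = (if m = 0 then smat A else 0)"
  by (simp add: vec_eq_iff mcoeff_nth cmat_nth smat_nth)

lemma mcoeff_cmat_mult: "mcoeff m (cmat A ** M) = smat A ** mcoeff m M"
  unfolding mcoeff_mult by (simp add: sum.atLeast_Suc_atMost mcoeff_cmat)

lemma mcoeff_mult_cmat: "mcoeff m (M ** cmat A) = mcoeff m M ** smat A"
proof -
  have "mcoeff m (M ** cmat A) = (\<Sum>i=0..m. if i = m then mcoeff m M ** smat A else 0)"
    unfolding mcoeff_mult by (intro sum.cong refl) (auto simp: mcoeff_cmat)
  then show ?thesis by simp
qed

lemma cmat_mult: "cmat (A ** B) = cmat A ** cmat B"
  by (rule mcoeff_eqI) (simp add: mcoeff_cmat_mult mcoeff_cmat smat_mult)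

lemma cmat_add: "cmat (A + B) = cmat A + cmat B"
  by (rule mcoeff_eqI) (simp add: mcoeff_add mcoeff_cmat smat_add)

lemma cmat_0: "cmat 0 = 0"
  by (rule mcoeff_eqI) (simp add: mcoeff_0 mcoeff_cmat smat_0)

lemma mat_cmat_commute: "mat y ** cmat A = cmat A ** mat y"
proof -
  have "y * fps_const (uea_scalar z) = fps_const (uea_scalar z) * y" for z
    by (simp add: fps_eq_iff uea_scalar_commute)
  then show ?thesis by (simp add: vec_eq_iff mat_mult_nth mult_mat_nth cmat_nth)
qed

lemma mcoeff_monomial_mult:
  "mcoeff m (mat (fps_X ^ e * fps_const y) ** M) = (if m < e then 0 else mat y ** mcoeff (m - e) M)"
  by (simp add: vec_eq_iff mcoeff_nth mat_mult_nth mult.assoc fps_X_power_mult_nth)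

lemma (in graded_sl2_triple) middle_block_inverse:
  "\<exists>n0. wproj {-k<..k} ** n0 = n0 \<and> n0 ** wproj {-k..<k} = n0 \<and>
     (wproj {-k..<k} ** (trunc + F_trunc) ** wproj {-k<..k}) ** n0 = wproj {-k..<k} \<and>
     n0 ** (wproj {-k..<k} ** (trunc + F_trunc) ** wproj {-k<..k}) = wproj {-k<..k}"
proof -
  let ?l = "wproj {-k..<k}" and ?g = "wproj {-k<..k}" and ?y = "trunc + F_trunc"
  obtain S L0 where S: "S ** ?y = trunc" "?y ** S = trunc"
    and L0: "wproj {k} ** L0 ** wproj {-k} = L0" "L0 ** S ** wproj {k} = wproj {k}" "wproj {-k} ** S ** L0 = wproj {-k}"
    using truncated_inverse by blast
  have tk: "trunc ** wproj {k} = wproj {k}" "wproj {-k} ** trunc = wproj {-k}"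
    unfolding trunc_def using k_nonneg by (simp_all add: wproj_mult)
  have yt: "?y ** trunc = ?y" "trunc ** ?y = ?y"
    by (simp_all add: F_trunc_def matrix_ring_simps trunc_idem) (simp add: trunc_idem flip: matrix_mul_assoc)
  define S' where "S' = trunc ** S ** trunc"
  have S'1: "S' ** ?y = trunc" "?y ** S' = trunc"
  proof -
    have "S' ** ?y = trunc ** (S ** (trunc ** ?y))" by (simp only: S'_def matrix_mul_assoc)
    then show "S' ** ?y = trunc" by (simp only: yt S trunc_idem)
    have "?y ** S' = ((?y ** trunc) ** S) ** trunc" by (simp only: S'_def matrix_mul_assoc)
    then show "?y ** S' = trunc" by (simp only: yt S trunc_idem)
  qed
  have S't: "trunc ** S' = S'" "S' ** trunc = S'"
    unfolding S'_def by (simp_all add: matrix_mul_assoc trunc_idem) (simp add: trunc_idem flip: matrix_mul_assoc)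
  have L0k: "wproj {k} ** L0 = L0" "L0 ** wproj {-k} = L0"
    by (subst (1 2) L0(1)[symmetric], simp add: matrix_mul_assoc wproj_mult)
      (subst (1 2) L0(1)[symmetric], simp add: wproj_mult flip: matrix_mul_assoc)
  have L0t: "L0 ** trunc = L0" "trunc ** L0 = L0"
  proof -
    have "L0 ** trunc = L0 ** (wproj {-k} ** trunc)" by (simp only: matrix_mul_assoc L0k)
    then show "L0 ** trunc = L0" by (simp only: tk L0k)
    have "trunc ** L0 = (trunc ** wproj {k}) ** L0" by (simp only: matrix_mul_assoc[symmetric] L0k)
    then show "trunc ** L0 = L0" by (simp only: tk L0k)
  qed
  have L0S: "L0 ** S' ** wproj {k} = wproj {k}" "wproj {-k} ** S' ** L0 = wproj {-k}"
  proof -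
    have "L0 ** S' ** wproj {k} = (L0 ** trunc) ** S ** (trunc ** wproj {k})" by (simp only: S'_def matrix_mul_assoc)
    then show "L0 ** S' ** wproj {k} = wproj {k}" by (simp only: tk L0t L0)
    have "wproj {-k} ** S' ** L0 = (wproj {-k} ** trunc) ** S ** (trunc ** L0)" by (simp only: S'_def matrix_mul_assoc)
    then show "wproj {-k} ** S' ** L0 = wproj {-k}" by (simp only: tk L0t L0)
  qed
  have lg: "trunc = ?l + wproj {k}" "trunc = ?g + wproj {-k}"
  proof -
    have "{-k..k} = {-k..<k} \<union> {k}" "{-k..k} = {-k<..k} \<union> {-k}" using k_nonneg by auto
    then show "trunc = ?l + wproj {k}" "trunc = ?g + wproj {-k}"
      unfolding trunc_def by (simp_all only: wproj_union[symmetric] disjoint_iff) (auto simp: wproj_union[symmetric])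
  qed
  txt \<open>Block inversion: \<open>S'\<close> inverts the whole operator, and \<open>L0\<close> inverts the block of \<open>S'\<close> opposite to
    the middle block.\<close>
  define n0 where "n0 = S' - S' ** L0 ** S'"
  have gn: "?g ** n0 = n0"
  proof -
    have "wproj {-k} ** n0 = wproj {-k} ** S' - (wproj {-k} ** S' ** L0) ** S'"
      by (simp only: n0_def matrix_sub_ldistrib matrix_mul_assoc)
    then have "wproj {-k} ** n0 = 0" by (simp add: L0S)
    moreover have "trunc ** n0 = n0" by (simp add: n0_def matrix_sub_ldistrib matrix_mul_assoc S't)
    ultimately show ?thesis unfolding lg(2) by (simp add: matrix_add_rdistrib)
  qed
  have nl: "n0 ** ?l = n0"
  proof -
    have "n0 ** wproj {k} = S' ** wproj {k} - S' ** (L0 ** S' ** wproj {k})"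
      by (simp only: n0_def matrix_sub_rdistrib matrix_mul_assoc)
    then have "n0 ** wproj {k} = 0" by (simp add: L0S)
    moreover have "n0 ** trunc = n0"
      by (simp add: n0_def matrix_sub_rdistrib S't flip: matrix_mul_assoc)
    ultimately show ?thesis unfolding lg(1) by (simp add: matrix_add_ldistrib)
  qed
  have "(?l ** ?y ** ?g) ** n0 = ?l ** (?y ** (?g ** n0))" by (simp only: matrix_mul_assoc)
  also have "\<dots> = ?l ** ((?y ** S') - (?y ** S') ** L0 ** S')"
    unfolding gn by (simp only: n0_def matrix_sub_ldistrib matrix_mul_assoc)
  also have "\<dots> = ?l ** trunc - ?l ** wproj {k} ** L0 ** S'"
    unfolding S'1 by (simp only: matrix_sub_ldistrib matrix_mul_assoc[symmetric] L0k)
      (simp only: matrix_mul_assoc L0t)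
  also have "\<dots> = ?l"
  proof -
    have "{-k..<k} \<inter> {-k..k} = {-k..<k}" by auto
    then show ?thesis by (simp add: trunc_def wproj_mult wproj_empty)
  qed
  finally have 1: "(?l ** ?y ** ?g) ** n0 = ?l" .
  have "n0 ** (?l ** ?y ** ?g) = ((n0 ** ?l) ** ?y) ** ?g" by (simp only: matrix_mul_assoc)
  also have "\<dots> = ((S' ** ?y) - S' ** L0 ** (S' ** ?y)) ** ?g"
    unfolding nl by (simp only: n0_def matrix_sub_rdistrib matrix_mul_assoc)
  also have "\<dots> = trunc ** ?g - S' ** (L0 ** trunc) ** ?g"
    unfolding S'1 by (simp only: matrix_sub_rdistrib matrix_mul_assoc)
  also have "\<dots> = trunc ** ?g - S' ** L0 ** (wproj {-k} ** ?g)"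
    unfolding L0t by (simp only: matrix_mul_assoc L0k flip: matrix_mul_assoc[of S' L0 "wproj {-k}"])
  also have "\<dots> = ?g"
  proof -
    have "{-k..k} \<inter> {-k<..k} = {-k<..k}" by auto
    then show ?thesis by (simp add: trunc_def wproj_mult wproj_empty)
  qed
  finally show ?thesis using 1 gn nl by blast
qed

section \<open>The Lax type operator\<close>

context truncated_lax
begin

definition Y :: "('g uea fps)^'n^'n" where "Y = lax_Y \<phi> trunc (cut f) I u u' \<delta>"

definition Dk :: "complex^'n^'n" where "Dk = shift_matrix \<phi> I u u' \<delta>"

lemma floor_degree: "i \<in> I \<Longrightarrow> nat \<lfloor>2 - 2 * \<delta> i\<rfloor> = nat (2 - 2 * d i)"
proof -
  assume "i \<in> I"
  then have "2 - 2 * \<delta> i = of_int (2 - 2 * d i)" using \<delta>_int by simp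
  then show ?thesis by (simp only: floor_of_int)
qed

lemma low_degree_set: "{i \<in> I. \<delta> i \<le> 1/2} = {i \<in> I. d i \<le> 0}"
proof -
  have "\<delta> i \<le> 1/2 \<longleftrightarrow> d i \<le> 0" if "i \<in> I" for i
    unfolding \<delta>_int[OF that] by linarith
  then show ?thesis by blast
qed

lemma Y_eq: "Y = cmat (trunc + F_trunc)
    + (\<Sum>i\<in>{i\<in>I. d i \<le> 0}. mat (fps_X ^ nat (2 - 2 * d i) * fps_const (uea_of (u i))) ** cmat (\<phi> (u' i)))
    + mat (fps_X ^ 2 * fps_const 1) ** cmat Dk"
proof -
  have "(\<Sum>i\<in>{i\<in>I. d i \<le> 0}. mat (fps_X ^ nat \<lfloor>2 - 2 * \<delta> i\<rfloor> * fps_const (uea_of (u i))) ** cmat (\<phi> (u' i)))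
      = (\<Sum>i\<in>{i\<in>I. d i \<le> 0}. mat (fps_X ^ nat (2 - 2 * d i) * fps_const (uea_of (u i))) ** (cmat (\<phi> (u' i)) :: ('g uea fps)^'n^'n))"
    by (intro sum.cong refl) (simp add: floor_degree)
  then show ?thesis unfolding Y_def lax_Y_def Dk_def[symmetric] phi_cut F_trunc_def[symmetric] low_degree_set
    by (simp add: cmat_add)
qed

lemma trunc_Y: "cmat trunc ** Y = Y"
proof -
  have 1: "trunc ** (trunc + F_trunc) = trunc + F_trunc"
    by (simp add: F_trunc_def matrix_ring_simps trunc_idem)
  have 2: "trunc ** \<phi> (u' i) = \<phi> (u' i)" if "i \<in> I" for i
    by (rule trunc_absorb(1)[OF trunc_u'[OF that]])
  have 3: "trunc ** Dk = Dk"
  proof -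
    have "trunc ** (\<phi> (u' i) ** \<phi> (u i)) = \<phi> (u' i) ** \<phi> (u i)" if "i \<in> I" for i
      by (simp add: matrix_mul_assoc 2[OF that])
    then show ?thesis unfolding Dk_def shift_matrix_def matrix_minus_right matrix_sum_right
      by (intro arg_cong[of _ _ uminus] sum.cong refl) simp
  qed
  have 4: "cmat trunc ** (mat y ** cmat A) = mat y ** cmat (trunc ** A)" for y and A :: "complex^'n^'n"
    by (simp only: matrix_mul_assoc mat_cmat_commute[symmetric] cmat_mult)
  have 5: "(\<Sum>i\<in>{i\<in>I. d i \<le> 0}. mat (fps_X ^ nat (2 - 2 * d i) * fps_const (uea_of (u i))) ** cmat (trunc ** \<phi> (u' i)))
     = (\<Sum>i\<in>{i\<in>I. d i \<le> 0}. mat (fps_X ^ nat (2 - 2 * d i) * fps_const (uea_of (u i))) ** (cmat (\<phi> (u' i)) :: ('g uea fps)^'n^'n))"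
    by (intro sum.cong refl) (simp add: 2)
  show ?thesis unfolding Y_eq matrix_add_ldistrib matrix_sum_right 4 5 3 cmat_mult[symmetric] 1[unfolded matrix_add_ldistrib] by (rule refl)
qed

lemma mcoeff_Y_mult:
  fixes M :: "('g uea fps)^'n^'n" and \<psi> :: "int \<Rightarrow> ('g uea)^'n^'n"
  assumes \<psi>: "\<And>m. \<psi> m = (if m < 0 then 0 else mcoeff (nat m) M)"
  shows "mcoeff m (Y ** M) = smat (trunc + F_trunc) ** \<psi> (int m)
        + (\<Sum>i\<in>{i\<in>I. d i \<le> 0}. mat (uea_of (u i)) ** smat (\<phi> (u' i)) ** \<psi> (int m - (2 - 2 * d i)))
        + smat Dk ** \<psi> (int m - 2)"
proof -
  have mono: "mcoeff m (mat (fps_X ^ nat e * fps_const y) ** cmat A ** M) = mat y ** smat A ** \<psi> (int m - e)"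
    if "0 \<le> e" for e :: int and y and A :: "complex^'n^'n"
  proof -
    have "mcoeff m (mat (fps_X ^ nat e * fps_const y) ** (cmat A ** M))
        = (if m < nat e then 0 else mat y ** (smat A ** mcoeff (m - nat e) M))"
      by (simp only: mcoeff_monomial_mult mcoeff_cmat_mult)
    also have "\<dots> = mat y ** (smat A ** \<psi> (int m - e))"
      using that by (auto simp: \<psi> nat_diff_distrib zless_nat_eq_int_zless)
    finally show ?thesis by (simp only: matrix_mul_assoc)
  qed
  have "mcoeff m (Y ** M) = mcoeff m (cmat (trunc + F_trunc) ** M)
      + (\<Sum>i\<in>{i\<in>I. d i \<le> 0}. mcoeff m (mat (fps_X ^ nat (2 - 2 * d i) * fps_const (uea_of (u i))) ** cmat (\<phi> (u' i)) ** M))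
      + mcoeff m (mat (fps_X ^ nat 2 * fps_const 1) ** cmat Dk ** M)"
    unfolding Y_eq matrix_add_rdistrib matrix_sum_left mcoeff_add mcoeff_sum by simp
  also have "mcoeff m (cmat (trunc + F_trunc) ** M) = smat (trunc + F_trunc) ** \<psi> (int m)"
    by (simp add: mcoeff_cmat_mult \<psi>)
  also have "mcoeff m (mat (fps_X ^ nat 2 * fps_const 1) ** cmat Dk ** M) = smat Dk ** \<psi> (int m - 2)"
    by (subst mono) simp_all
  also have "(\<Sum>i\<in>{i\<in>I. d i \<le> 0}. mcoeff m (mat (fps_X ^ nat (2 - 2 * d i) * fps_const (uea_of (u i))) ** cmat (\<phi> (u' i)) ** M))
      = (\<Sum>i\<in>{i\<in>I. d i \<le> 0}. mat (uea_of (u i)) ** smat (\<phi> (u' i)) ** \<psi> (int m - (2 - 2 * d i)))"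
    by (intro sum.cong refl mono) simp
  finally show ?thesis .
qed

lemma mcoeff_0_Y: "mcoeff 0 Y = smat (trunc + F_trunc)"
  using mcoeff_Y_mult[of "\<lambda>m. if m < 0 then 0 else mcoeff (nat m) (mat 1)" "mat 1" 0]
  by (simp add: mcoeff_mat_1)

text \<open>Weight \<open>k\<close> occurs by \<open>k_weight\<close>, and the truncation admits
  none above it. The finite grid of values \<open>wt i l\<close> supplies the finiteness required by
  \<open>Max\<close>.\<close>

lemma max_weight:
  "Max {j :: real. \<exists>v. v \<noteq> 0 \<and> trunc *v v = v \<and> \<phi> (cut x) *v v = complex_of_real j *s v} = k"
proof -
  have X: "\<phi> (cut x) *v v = \<phi> x *v v" if "trunc *v v = v" for v
  proof -
    have "\<phi> (cut x) *v v = \<phi> x *v (trunc *v (trunc *v v))"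
      unfolding phi_cut trunc_X matrix_vector_mul_assoc by (simp only: matrix_mul_assoc)
    then show ?thesis by (simp only: that)
  qed
  let ?A = "{j :: real. \<exists>v. v \<noteq> 0 \<and> trunc *v v = v \<and> \<phi> (cut x) *v v = complex_of_real j *s v}"
  have le: "j \<le> k" and mem: "j \<in> (\<lambda>(i, l). wt i l) ` ({..bound} \<times> {..bound})" if j: "j \<in> ?A" for j
  proof -
    obtain v where v: "v \<noteq> 0" "trunc *v v = v" "\<phi> x *v v = complex_of_real j *s v" using j X by force
    then show "j \<le> k" using trunc_weight[OF v(3)] by (auto split: if_splits)
    obtain i l b where b: "l \<le> i" "b \<in> chain i l" "b \<noteq> 0" "wt i l = j" using weight_chain[OF v(3,1)] by blast
    have "Suc i \<le> bound" unfolding bound_def using chain_part[OF b(2,3)] by (intro Max_ge) auto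
    then show "j \<in> (\<lambda>(i, l). wt i l) ` ({..bound} \<times> {..bound})" using b(1,4) by force
  qed
  have "?A \<subseteq> (\<lambda>(i, l). wt i l) ` ({..bound} \<times> {..bound})" using mem by blast
  then have "finite ?A" by (rule finite_subset) simp
  moreover obtain v where v: "v \<noteq> 0" "\<phi> x *v v = of_real k *s v" using k_weight by blast
  then have "k \<in> ?A" using trunc_weight[OF v(2)] X[of v] k_nonneg by force
  ultimately show ?thesis using le by (intro Max_eqI)
qed

lemma weight_proj_cut: "weight_proj trunc (\<phi> (cut x)) S = wproj (S \<inter> {-k..k})"
  unfolding phi_cut by (rule weight_proj_truncated[OF trunc_def])

definition L :: "('g uea fps)^'n^'n" where
  "L = lax_op \<phi> trunc (cut f) (cut x) I u u' \<delta>"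

text \<open>Block elimination: \<open>\<Psi>\<close> is chosen so that the rows of
  \<open>Y \<Psi>\<close> of weight below \<open>k\<close> vanish, and the row of weight
  \<open>k\<close> is then the Schur complement \<open>L\<close>. Before that, the definite
  description of the inverse \<open>N\<close> inside \<open>lax_op\<close> has to be
  resolved.\<close>

lemma lax_column:
  "\<exists>\<Psi>. Y ** \<Psi> = L \<and> cmat (wproj {-k}) ** \<Psi> = cmat (wproj {-k}) \<and> cmat trunc ** \<Psi> = \<Psi>
     \<and> cmat (wproj {k}) ** L = L"
proof -
  let ?l = "cmat (wproj {-k..<k}) :: ('g uea fps)^'n^'n" and ?g = "cmat (wproj {-k<..k}) :: ('g uea fps)^'n^'n"
  let ?t = "cmat (wproj {k}) :: ('g uea fps)^'n^'n" and ?b = "cmat (wproj {-k}) :: ('g uea fps)^'n^'n"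
  have ll: "?l ** ?l = ?l" and gg: "?g ** ?g = ?g" and bg: "?b ** ?g = 0" and tt: "?t ** ?t = ?t"
    and bb: "?b ** ?b = ?b"
    by (simp_all add: wproj_mult wproj_empty cmat_0 flip: cmat_mult)
  have tg: "cmat trunc ** ?g = ?g" and tb: "cmat trunc ** ?b = ?b"
  proof -
    have "{-k..k} \<inter> {-k<..k} = {-k<..k}" "{-k..k} \<inter> {-k} = {-k}" using k_nonneg by auto
    then show "cmat trunc ** ?g = ?g" "cmat trunc ** ?b = ?b"
      by (simp_all add: trunc_def wproj_mult flip: cmat_mult)
  qed
  have lt: "cmat trunc = ?l + ?t"
  proof -
    have u: "{-k..k} = {-k..<k} \<union> {k}" using k_nonneg by auto
    have "wproj ({-k..<k} \<union> {k}) = wproj {-k..<k} + wproj {k}" by (rule wproj_union) simp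
    then show ?thesis unfolding trunc_def u cmat_add[symmetric] by (rule arg_cong)
  qed
  obtain n0 where n0: "wproj {-k<..k} ** n0 = n0" "n0 ** wproj {-k..<k} = n0"
     "(wproj {-k..<k} ** (trunc + F_trunc) ** wproj {-k<..k}) ** n0 = wproj {-k..<k}"
     "n0 ** (wproj {-k..<k} ** (trunc + F_trunc) ** wproj {-k<..k}) = wproj {-k<..k}"
    using middle_block_inverse by blast
  define b0 where "b0 = wproj {-k..<k} ** (trunc + F_trunc) ** wproj {-k<..k}"
  define n :: "('g uea fps)^'n^'n" where "n = cmat n0"
  define Yb where "Yb = ?l ** Y ** ?g"
  \<comment> \<open>\<open>Z\<close> has no constant term, so \<open>1 + n Z\<close> and
    \<open>1 + Z n\<close> are invertible; the inverse of \<open>Yb\<close> is a unipotent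
    correction of the inverse \<open>n\<close> of its constant part.\<close>
  define Z where "Z = Yb - cmat b0"
  have gn: "?g ** n = n" and nl: "n ** ?l = n" and b0n: "cmat b0 ** n = ?l" and nb0: "n ** cmat b0 = ?g"
    unfolding n_def b0_def using n0 by (simp_all flip: cmat_mult)
  have b0: "?l ** cmat b0 = cmat b0" "cmat b0 ** ?g = cmat b0"
    unfolding b0_def by (simp_all add: wproj_mult matrix_mul_assoc flip: cmat_mult)
      (simp add: wproj_mult flip: matrix_mul_assoc)
  have lYb: "?l ** Yb = Yb" and Ybg: "Yb ** ?g = Yb"
    unfolding Yb_def by (simp_all add: matrix_mul_assoc ll) (simp add: gg flip: matrix_mul_assoc)
  have lZ: "?l ** Z = Z" and Zg: "Z ** ?g = Z"
    by (simp_all add: Z_def matrix_sub_ldistrib matrix_sub_rdistrib lYb Ybg b0)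
  have Z0: "mcoeff 0 Z = 0"
    unfolding Z_def Yb_def mcoeff_diff mcoeff_mult_cmat mcoeff_cmat_mult mcoeff_0_Y mcoeff_cmat b0_def
    by (simp add: smat_mult)
  obtain Q1 where Q1: "(mat 1 + n ** Z) ** Q1 = mat 1" "Q1 ** (mat 1 + n ** Z) = mat 1"
    using unipotent_inverse[of "mat 1 + n ** Z"] by (auto simp: mcoeff_add mcoeff_mat_1 n_def mcoeff_cmat_mult Z0)
  obtain Q2 where Q2: "(mat 1 + Z ** n) ** Q2 = mat 1" "Q2 ** (mat 1 + Z ** n) = mat 1"
    using unipotent_inverse[of "mat 1 + Z ** n"] by (auto simp: mcoeff_add mcoeff_mat_1 n_def mcoeff_mult_cmat Z0)
  define N where "N = Q1 ** n"
  \<comment> \<open>The two forms of \<open>N\<close> serve the two sides: \<open>Q1 ** n\<close>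
    gives \<open>N ** Yb\<close>, and \<open>n ** Q2\<close> gives \<open>Yb ** N\<close>.\<close>
  have N2: "N = n ** Q2"
  proof -
    have "(mat 1 + n ** Z) ** n = n ** (mat 1 + Z ** n)" by (simp add: matrix_ring_simps)
    then have "Q1 ** ((mat 1 + n ** Z) ** n) ** Q2 = Q1 ** (n ** (mat 1 + Z ** n)) ** Q2" by simp
    then have "(Q1 ** (mat 1 + n ** Z)) ** (n ** Q2) = (Q1 ** n) ** ((mat 1 + Z ** n) ** Q2)" by (simp only: matrix_mul_assoc)
    then show ?thesis by (simp add: Q1 Q2 N_def)
  qed
  have gN: "?g ** N = N" unfolding N2 by (simp add: matrix_mul_assoc gn)
  have Nl: "N ** ?l = N" unfolding N_def by (simp add: nl flip: matrix_mul_assoc)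
  have Yb: "Yb = cmat b0 + Z" by (simp add: Z_def)
  have NY: "N ** Yb = ?g"
  proof -
    have "n ** Yb = ?g + n ** Z" unfolding Yb matrix_add_ldistrib nb0 by (rule refl)
    also have "\<dots> = (mat 1 + n ** Z) ** ?g" by (simp add: matrix_add_rdistrib Zg flip: matrix_mul_assoc)
    finally have "N ** Yb = Q1 ** ((mat 1 + n ** Z) ** ?g)" by (simp add: N_def flip: matrix_mul_assoc)
    then show ?thesis by (simp add: matrix_mul_assoc Q1)
  qed
  have YN: "Yb ** N = ?l"
  proof -
    have "Yb ** n = ?l + Z ** n" unfolding Yb matrix_add_rdistrib b0n by (rule refl)
    also have "\<dots> = ?l ** (mat 1 + Z ** n)" by (simp add: matrix_add_ldistrib lZ matrix_mul_assoc)
    finally have "Yb ** N = ?l ** (mat 1 + Z ** n) ** Q2" by (simp add: N2 matrix_mul_assoc)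
    then show ?thesis by (simp add: Q2 flip: matrix_mul_assoc)
  qed
  have the_N: "(THE N. ?g ** N ** ?l = N \<and> Yb ** N = ?l \<and> N ** Yb = ?g) = N"
  proof (rule the_equality)
    show "?g ** N ** ?l = N \<and> Yb ** N = ?l \<and> N ** Yb = ?g" by (simp add: gN Nl YN NY)
    fix M assume M: "?g ** M ** ?l = M \<and> Yb ** M = ?l \<and> M ** Yb = ?g"
    then have M': "?g ** M ** ?l = M" by blast
    have "?g ** M ** ?l ** ?l = ?g ** M ** ?l" by (simp only: ll flip: matrix_mul_assoc)
    then have "M = M ** ?l" unfolding M' by (rule sym)
    also have "\<dots> = M ** Yb ** N" by (simp only: YN flip: matrix_mul_assoc)
    also have "\<dots> = N" using M gN by simp
    finally show "M = N" .
  qed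
  have sets: "{k} \<inter> {-k..k} = {k}" "{-k} \<inter> {-k..k} = {-k}" "{-k<..} \<inter> {-k..k} = {-k<..k}" "{..<k} \<inter> {-k..k} = {-k..<k}"
    using k_nonneg by auto
  have L: "L = ?t ** Y ** ?b - (?t ** Y ** ?g) ** N ** (?l ** Y ** ?b)"
    unfolding L_def lax_op_def max_weight Let_def weight_proj_cut sets Y_def[symmetric] Yb_def[symmetric] the_N
    by (rule refl)
  define \<Psi> where "\<Psi> = ?b - N ** (?l ** Y ** ?b)"
  have t\<Psi>: "?t ** Y ** \<Psi> = L"
  proof -
    have "?t ** Y ** N = ?t ** Y ** ?g ** N" by (simp only: gN flip: matrix_mul_assoc)
    then show ?thesis unfolding \<Psi>_def L matrix_sub_ldistrib by (simp only: matrix_mul_assoc)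
  qed
  have l\<Psi>: "?l ** Y ** \<Psi> = 0"
  proof -
    have "?l ** Y ** N = Yb ** N" unfolding Yb_def by (simp only: gN flip: matrix_mul_assoc)
    then have "?l ** Y ** (N ** (?l ** Y ** ?b)) = ?l ** (?l ** Y ** ?b)" by (simp only: matrix_mul_assoc YN)
    then show ?thesis unfolding \<Psi>_def matrix_sub_ldistrib by (simp add: matrix_mul_assoc ll)
  qed
  have "Y ** \<Psi> = cmat trunc ** Y ** \<Psi>" by (simp only: trunc_Y)
  also have "\<dots> = L" unfolding lt matrix_add_rdistrib t\<Psi> l\<Psi> by simp
  finally have "Y ** \<Psi> = L" .
  moreover have "?b ** \<Psi> = ?b"
  proof -
    have "?b ** N = ?b ** ?g ** N" by (simp only: gN flip: matrix_mul_assoc)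
    then have "?b ** N = 0" by (simp add: bg)
    then show ?thesis unfolding \<Psi>_def matrix_sub_ldistrib by (simp add: matrix_mul_assoc bb)
  qed
  moreover have "cmat trunc ** \<Psi> = \<Psi>"
  proof -
    have "cmat trunc ** N = cmat trunc ** ?g ** N" by (simp only: gN flip: matrix_mul_assoc)
    then have "cmat trunc ** N = N" by (simp only: tg gN)
    then show ?thesis unfolding \<Psi>_def matrix_sub_ldistrib by (simp add: matrix_mul_assoc tb)
  qed
  moreover have "?t ** L = L" unfolding t\<Psi>[symmetric] by (simp add: matrix_mul_assoc tt)
  ultimately show ?thesis by blast
qed

lemma coset_eq_iff:
  "coset (left_ideal S) w = coset (left_ideal S) 0 \<longleftrightarrow> w \<in> left_ideal S"
proof
  assume "coset (left_ideal S) w = coset (left_ideal S) 0"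
  moreover have "w \<in> coset (left_ideal S) w"
    unfolding coset_def by (rule image_eqI[of _ _ 0]) (simp_all add: left_ideal.intros)
  ultimately show "w \<in> left_ideal S" by (auto simp: coset_def)
next
  assume w: "w \<in> left_ideal S"
  have "y \<in> (\<lambda>p. w + p) ` left_ideal S" if "y \<in> left_ideal S" for y
    by (rule image_eqI[of _ _ "y - w"]) (use that w left_ideal_diff in auto)
  then show "coset (left_ideal S) w = coset (left_ideal S) 0"
    unfolding coset_def using left_ideal_add[OF w] by auto
qed

theorem lax_coefficients_invariant:
  "coset (W_ideal B f x) (fps_nth ((cmat Q_hw ** L ** cmat Q_hw) $ r $ s) n) \<in> finite_W_algebra B f x"
proof -
  obtain \<Psi> where \<Psi>: "Y ** \<Psi> = L" "cmat (wproj {-k}) ** \<Psi> = cmat (wproj {-k})"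
    "cmat trunc ** \<Psi> = \<Psi>" "cmat (wproj {k}) ** L = L"
    using lax_column by blast
  define \<Psi>U where "\<Psi>U = \<Psi> ** cmat Q_hw"
  define \<psi> where "\<psi> = (\<lambda>m::int. if m < 0 then 0 else mcoeff (nat m) \<Psi>U)"
  define \<Lambda> where "\<Lambda> = (\<lambda>m::int. if m < 0 then 0 else mcoeff (nat m) (L ** cmat Q_hw))"
  interpret lax_solution \<phi> f x e ps k c B I u u' \<delta> Dk \<psi> \<Lambda>
  proof unfold_locales
    show "Dk = shift_matrix \<phi> I u u' \<delta>" by (rule Dk_def)
    fix m :: int
    show "smat (trunc + F_trunc) ** \<psi> m
        + (\<Sum>i\<in>{i\<in>I. d i \<le> 0}. mat (uea_of (u i)) ** smat (\<phi> (u' i)) ** \<psi> (m - (2 - 2 * d i)))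
        + smat Dk ** \<psi> (m - 2) = \<Lambda> m"
    proof (cases "m < 0")
      case True
      then show ?thesis by (simp add: \<psi>_def \<Lambda>_def)
    next
      case False
      have "Y ** \<Psi>U = L ** cmat Q_hw" by (simp add: \<Psi>U_def matrix_mul_assoc \<Psi>(1))
      then have "\<Lambda> m = mcoeff (nat m) (Y ** \<Psi>U)" using False by (simp add: \<Lambda>_def)
      moreover have "int (nat m) = m" using False by simp
      ultimately show ?thesis using mcoeff_Y_mult[of \<psi> \<Psi>U "nat m"] by (simp only: \<psi>_def)
    qed
    show "m < 0 \<Longrightarrow> \<psi> m = 0" by (simp add: \<psi>_def)
    have "cmat (wproj {k}) ** (L ** cmat Q_hw) = L ** cmat Q_hw" by (simp add: matrix_mul_assoc \<Psi>(4))
    then show "smat (wproj {k}) ** \<Lambda> m = \<Lambda> m" by (simp add: \<Lambda>_def flip: mcoeff_cmat_mult)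
    have "cmat (wproj {-k}) ** \<Psi>U = cmat (wproj {-k} ** Q_hw)" by (simp add: \<Psi>U_def matrix_mul_assoc \<Psi>(2) cmat_mult)
    then show "smat (wproj {-k}) ** \<psi> m = (if m = 0 then smat (wproj {-k} ** Q_hw) else 0)"
      by (simp add: \<psi>_def mcoeff_cmat flip: mcoeff_cmat_mult)
    have "cmat trunc ** \<Psi>U = \<Psi>U" by (simp add: \<Psi>U_def matrix_mul_assoc \<Psi>(3))
    then show "smat trunc ** \<psi> m = \<psi> m" by (simp add: \<psi>_def flip: mcoeff_cmat_mult)
  qed
  define w where "w = fps_nth ((cmat Q_hw ** L ** cmat Q_hw) $ r $ s) n"
  have w: "w = (smat Q_hw ** \<Lambda> (int n)) $ r $ s"
    unfolding w_def mcoeff_nth[symmetric] by (simp add: \<Lambda>_def mcoeff_cmat_mult flip: matrix_mul_assoc)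
  have J: "W_ideal B f x = left_ideal gens" by (simp add: W_ideal_def gens_def)
  \<comment> \<open>Both memberships are needed for the commutator with \<open>w\<close>. They are
    linear in \<open>a\<close>, so homogeneous elements suffice.\<close>
  have good: "uea_of a - uea_scalar (B f a) \<in> left_ideal gens \<and> (uea_of a - uea_scalar (B f a)) * w \<in> left_ideal gens"
    if "a \<in> ad_ge x (1/2)" for a
    using that unfolding ad_ge_def
  proof (induction rule: clie.span_induct_alt)
    case base
    show ?case by (simp add: B_0_right uea_of_0 uea_scalar_0 left_ideal.intros)
  next
    case (step z a b)
    then obtain j where j: "j \<ge> 1/2" "lie x a = of_real j *\<^sub>C a" by blast
    have a: "uea_of a - uea_scalar (B f a) \<in> left_ideal gens \<and> (uea_of a - uea_scalar (B f a)) * w \<in> left_ideal gens"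
    proof (cases "a = 0")
      case True
      then show ?thesis by (simp add: B_0_right uea_of_0 uea_scalar_0 left_ideal.intros)
    next
      case False
      obtain l :: int where l: "j = of_int l" using degree_int[OF j(2) False] by blast
      \<comment> \<open>Integrality turns degree at least 1/2 into degree at least 1, which puts the
        shifted \<open>a\<close> among the generators.\<close>
      then have l1: "1 \<le> l" using j(1) by linarith
      have "a \<in> ad_ge x 1"
        unfolding ad_ge_def using j(2) l l1 by (intro clie.span_base) (auto intro!: exI[of _ j])
      then have "uea_of a - uea_scalar (B f a) \<in> left_ideal gens"
        by (intro left_ideal_generator) (auto simp: gens_def)
      moreover have "left_cong gens (shifted a ** (smat Q_hw ** \<Lambda> (int n))) 0"
        using j(2) l by (intro \<Lambda>_commutator[OF l1]) simp
      then have "(uea_of a - uea_scalar (B f a)) * w \<in> left_ideal gens"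
        unfolding w left_cong_def shifted_def by (simp add: mat_mult_nth)
      ultimately show ?thesis ..
    qed
    have "B f (z *\<^sub>C a + b) = z * B f a + B f b"
      by (metis B_add_left B_commute B_scale_left)
    then have eq: "uea_of (z *\<^sub>C a + b) - uea_scalar (B f (z *\<^sub>C a + b))
        = uea_scalar z * (uea_of a - uea_scalar (B f a)) + (uea_of b - uea_scalar (B f b))"
      by (simp add: uea_of_add uea_of_scale uea_scalar_add uea_scalar_mult algebra_simps)
    show ?case unfolding eq distrib_right mult.assoc
      using a step.IH by (auto intro!: left_ideal_add left_ideal_mult)
  qed
  have "uea_of a * w - w * uea_of a \<in> left_ideal gens" if "a \<in> ad_ge x (1/2)" for a
  proof -
    have "uea_of a * w - w * uea_of a = (uea_of a - uea_scalar (B f a)) * w - w * (uea_of a - uea_scalar (B f a))"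
      by (simp add: algebra_simps uea_scalar_commute)
    then show ?thesis using good[OF that] by (simp add: left_ideal_diff left_ideal_mult)
  qed
  then show ?thesis
    unfolding finite_W_algebra_def J coset_eq_iff w_def[symmetric] by blast
qed

end

text \<open>\<open>X\<close> is skew for \<open>G\<close>, so weight spaces are orthogonal unless
  their weights are opposite, and the interval is symmetric. It is the reason why so and sp are
  stable under truncation.\<close>

lemma (in sl2_triple) wproj_adjoint:
  assumes G: "transpose X ** G + G ** X = 0"
  shows "transpose (wproj {-k..k}) ** G = G ** wproj {-k..k}"
proof -
  let ?P = "wproj {-k..k}"
  \<comment> \<open>The bilinear pairing, without complex conjugation, to match
    \<open>transpose\<close>.\<close>
  define dot where "dot = (\<lambda>y v :: complex^'n. \<Sum>i\<in>UNIV. y $ i * v $ i)"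
  have dot_transpose: "dot (transpose A *v y) v = dot y (A *v v)" for A :: "complex^'n^'n" and y v
    unfolding dot_def matrix_vector_mult_def transpose_def
    by (simp add: sum_distrib_left sum_distrib_right mult_ac) (subst sum.swap, simp)
  have dot_scale: "dot (z *s y) v = z * dot y v" "dot y (z *s v) = z * dot y v" for z y v
    by (simp_all add: dot_def sum_distrib_left mult_ac)
  have dot0: "y = 0" if "\<And>i j b. b \<in> chain i j \<Longrightarrow> dot y b = 0" for y
  proof -
    have "(\<chi> r s. y $ s) = (0 :: complex^'n^'n)"
      by (rule matrix_eq_on_chains) (use that in \<open>simp add: matrix_vector_mult_def dot_def vec_eq_iff\<close>)
    then show ?thesis by (simp add: vec_eq_iff)
  qed
  have XG: "transpose X *v (G *v v) = - (G *v (X *v v))" for v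
    using G by (metis add_eq_0_iff matrix_minus_vector matrix_vector_mul_assoc minus_minus)
  have orth: "dot (G *v b) b' = 0" if b: "b \<in> chain i j" and b': "b' \<in> chain i' j'" and ne: "wt i j + wt i' j' \<noteq> 0" for b b' i j i' j'
  proof -
    have "dot (transpose X *v (G *v b)) b' = dot (G *v b) (X *v b')" by (rule dot_transpose)
    moreover have "transpose X *v (G *v b) = (- of_real (wt i j)) *s (G *v b)"
      unfolding XG chain_X[OF b] by (simp add: vec.scale)
    ultimately have "(- of_real (wt i j)) * dot (G *v b) b' = of_real (wt i' j') * dot (G *v b) b'"
      unfolding chain_X[OF b'] by (simp only: dot_scale)
    then have "of_real (wt i j + wt i' j') * dot (G *v b) b' = 0"
      unfolding of_real_add distrib_right by (metis add.right_inverse mult_minus_left)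
    then show ?thesis using ne by (simp only: mult_eq_0_iff of_real_eq_0_iff simp_thms)
  qed
  show ?thesis
  proof (rule matrix_eq_on_chains)
    fix i j b assume b: "b \<in> chain i j"
    have "transpose ?P *v (G *v b) - G *v (?P *v b) = 0"
    proof (rule dot0)
      fix i' j' b' assume b': "b' \<in> chain i' j'"
      have "dot (transpose ?P *v (G *v b) - G *v (?P *v b)) b' = dot (G *v b) (?P *v b') - dot (G *v (?P *v b)) b'"
        unfolding dot_transpose[symmetric] by (simp add: dot_def left_diff_distrib sum_subtractf)
      also have "\<dots> = 0"
      proof (cases "wt i j + wt i' j' = 0")
        case True
        then have "wt i' j' = - wt i j" by simp
        then show ?thesis by (auto simp: wproj_chain[OF b] wproj_chain[OF b'] dot_def)
      next
        case False
        then show ?thesis using orth[OF b b' False] by (auto simp: wproj_chain[OF b] wproj_chain[OF b'] dot_def)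
      qed
      finally show "dot (transpose ?P *v (G *v b) - G *v (?P *v b)) b' = 0" .
    qed
    then show "(transpose ?P ** G) *v b = (G ** ?P) *v b" by (simp flip: matrix_vector_mul_assoc)
  qed
qed

theorem theorem1p2:
  fixes \<phi> :: "'g::complex_lie_algebra \<Rightarrow> complex^'n^'n"
    and B :: "'g \<Rightarrow> 'g \<Rightarrow> complex" and c :: complex
    and f x e :: 'g and ps :: "nat list" and k :: real
    and P :: "complex^'n^'n"
    and I :: "'i set" and u u' :: "'i \<Rightarrow> 'g" and \<delta> :: "'i \<Rightarrow> real"
    and L U :: "('g uea fps)^'n^'n"
  assumes "faithful_rep \<phi>" and "classical_type (range \<phi>)"
    and "c \<noteq> 0" and "\<And>a b. B a b = c * trace (\<phi> a ** \<phi> b)"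
    and "jordan_type (\<phi> f) ps" and "\<forall>p\<in>set ps. \<forall>q\<in>set ps. even p \<longleftrightarrow> even q"
    and "lie x e = e" and "lie x f = - f" and "lie e f = 2 *\<^sub>C x"
    and "k \<ge> 0" and "2 * k \<in> \<nat>"
    and P_def: "P = weight_proj (mat 1) (\<phi> x) {-k..k}"
    and "range \<phi> = sl_set \<Longrightarrow> \<forall>a. P ** \<phi> a ** P \<in> range \<phi>"
    and "dual_eigenbases B (range (compress \<phi> P)) (compress \<phi> P x) I u u' \<delta>"
    and L_def: "L = lax_op \<phi> P (compress \<phi> P f) (compress \<phi> P x) I u u' \<delta>"
    and U_def: "U = cmat (isotypic_proj (\<phi> f) (\<phi> x) (\<phi> e) k)"
  shows "\<forall>r s n. coset (W_ideal B f x) (fps_nth ((U ** L ** U) $ r $ s) n)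
                   \<in> finite_W_algebra B f x"
proof -
  have rep: "\<phi> (a + b) = \<phi> a + \<phi> b" "\<phi> (z *\<^sub>C a) = mat z ** \<phi> a" "\<phi> (lie a b) = \<phi> a ** \<phi> b - \<phi> b ** \<phi> a" for a b z
    using assms(1) by (simp_all add: faithful_rep_def)
  have "\<phi> 0 = 0" using rep(1)[of 0 0] by simp
  then have "\<phi> (- f) = - \<phi> f" using rep(1)[of f "- f"] by (simp add: eq_neg_iff_add_eq_0 add.commute)
  interpret sl2_triple "\<phi> f" "\<phi> x" "\<phi> e"
  proof
    show "\<phi> x ** \<phi> e - \<phi> e ** \<phi> x = \<phi> e" by (simp add: assms(7) flip: rep(3))
    show "\<phi> x ** \<phi> f - \<phi> f ** \<phi> x = - \<phi> f" by (simp add: assms(8) \<open>\<phi> (- f) = - \<phi> f\<close> flip: rep(3))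
    have "\<phi> e ** \<phi> f - \<phi> f ** \<phi> e = mat 2 ** \<phi> x" by (simp add: assms(9) rep(2) flip: rep(3))
    also have "\<dots> = \<phi> x + \<phi> x" by (simp add: vec_eq_iff mat_mult_nth)
    finally show "\<phi> e ** \<phi> f - \<phi> f ** \<phi> e = \<phi> x + \<phi> x" .
  qed
  \<comment> \<open>Immediate for gl and a hypothesis for sl; for so and sp, \<open>P\<close> is
    self-adjoint for the form and can be moved across \<open>G\<close>.\<close>
  have closed: "P ** \<phi> a ** P \<in> range \<phi>" for a
  proof -
    consider "range \<phi> = UNIV" | "range \<phi> = sl_set" | G where "range \<phi> = isometry_algebra G"
      using assms(2) unfolding classical_type_def by blast
    then show ?thesis
    proof cases
      case 3
      have iso: "transpose (\<phi> y) ** G + G ** \<phi> y = 0" for y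
        using 3 by (auto simp: isometry_algebra_def)
      have PG: "transpose P ** G = G ** P" unfolding P_def by (rule wproj_adjoint[OF iso])
      have "transpose (P ** \<phi> a ** P) ** G + G ** (P ** \<phi> a ** P)
          = transpose P ** transpose (\<phi> a) ** (transpose P ** G) + (G ** P) ** \<phi> a ** P"
        by (simp only: matrix_transpose_mul matrix_mul_assoc)
      also have "transpose P ** transpose (\<phi> a) ** (transpose P ** G) = transpose P ** (transpose (\<phi> a) ** G) ** P"
        unfolding PG by (simp only: matrix_mul_assoc)
      also have "(G ** P) ** \<phi> a ** P = transpose P ** (G ** \<phi> a) ** P"
        unfolding PG[symmetric] by (simp only: matrix_mul_assoc)
      also have "transpose P ** (transpose (\<phi> a) ** G) ** P + transpose P ** (G ** \<phi> a) ** P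
          = transpose P ** (transpose (\<phi> a) ** G + G ** \<phi> a) ** P"
        by (simp only: matrix_add_ldistrib matrix_add_rdistrib)
      also have "\<dots> = 0" unfolding iso times0_right times0_left by (rule refl)
      finally show ?thesis unfolding 3 isometry_algebra_def by (rule CollectI)
    qed (use assms(13) in auto)
  qed
  show ?thesis
  proof (cases "\<exists>v. v \<noteq> 0 \<and> \<phi> x *v v = of_real k *s v")
    case True
    interpret g: graded_sl2_triple "\<phi> f" "\<phi> x" "\<phi> e" ps k
    proof
      show "jordan_type (\<phi> f) ps" by (rule assms(5))
      show "\<forall>p\<in>set ps. \<forall>q\<in>set ps. even p \<longleftrightarrow> even q" by (rule assms(6))
      show "k \<ge> 0" "2 * k \<in> \<nat>" by (rule assms(10,11))+
      show "\<exists>v. v \<noteq> 0 \<and> \<phi> x *v v = of_real k *s v" by (rule True)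
    qed
    have P: "P = g.trunc" unfolding P_def g.trunc_def by (rule refl)
    interpret lax: truncated_lax \<phi> f x e ps k c B I u u' \<delta>
    proof
      show "faithful_rep \<phi>" by (rule assms(1))
      show "B a b = c * trace (\<phi> a ** \<phi> b)" for a b by (rule assms(4))
      show "g.trunc ** \<phi> a ** g.trunc \<in> range \<phi>" for a using closed unfolding P .
      show "dual_eigenbases B (range (compress \<phi> g.trunc)) (compress \<phi> g.trunc x) I u u' \<delta>"
        using assms(14) unfolding P .
    qed
    show ?thesis
    proof (intro allI)
      fix r s n
      have "U = cmat g.Q_hw" unfolding U_def g.Q_hw_def by (rule refl)
      moreover have "L = lax_op \<phi> g.trunc (compress \<phi> g.trunc f) (compress \<phi> g.trunc x) I u u' \<delta>"
        unfolding L_def P by (rule refl)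
      ultimately show "coset (W_ideal B f x) (fps_nth ((U ** L ** U) $ r $ s) n) \<in> finite_W_algebra B f x"
        using lax.lax_coefficients_invariant[of r s n] by (simp only: lax.L_def)
    qed
  next
    case False
    \<comment> \<open>If \<open>k\<close> is not a weight then no non-zero string has highest weight
      \<open>k\<close>; so \<open>U\<close> is zero, and every coefficient gives the zero
      coset.\<close>
    have "isotypic_proj (\<phi> f) (\<phi> x) (\<phi> e) k = 0"
    proof (rule matrix_eq_on_chains)
      fix i j b assume b: "b \<in> chain i j"
      have "b = 0" if "real i / 2 = k"
      proof -
        obtain w where w: "b = mpow (\<phi> f) j *v w" "w \<in> chain i 0"
          using b by (auto simp: chain_def)
        have "\<phi> x *v w = of_real k *s w" using chain_X[OF w(2)] that by (simp add: wt_def)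
        then have "w = 0" using False by blast
        then show ?thesis by (simp add: w(1))
      qed
      then show "isotypic_proj (\<phi> f) (\<phi> x) (\<phi> e) k *v b = 0 *v b"
        by (simp add: isotypic_proj_chain[OF assms(10) b])
    qed
    then have "U = 0" by (simp add: U_def cmat_0)
    then have "fps_nth ((U ** L ** U) $ r $ s) n = 0" for r s n by simp
    then show ?thesis unfolding finite_W_algebra_def by (auto intro!: exI[of _ 0])
  qed
qed

end
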